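(* Let $G=A_1*\cdots*A_n*F_k$ be a free product, where the $A_i$ are finitely generated, freely indecomposable and not infinite cyclic, and $F_k$ is free of rank $k$. There is a normal form for $\mathrm{Aut}^0(G)$ in the Fouxe-Rabinovitch generators, and a method that takes as input an $(n+k)$-tuple $(g_1,\dots,g_{n+k})$ of elements of $G$ and determines whether the subgroups $g_i^{-1}A_ig_i$, $1\le i\le n$, together with $\{g_{n+1},\dots,g_{n+k}\}$ generate $G$, and if so produces a normal form, in the Fouxe-Rabinovitch generators, for an automorphism $\Phi\in\mathrm{Aut}^0(G)$ taking each $A_i$ ($1\le i\le n$) to $g_i^{-1}A_ig_i$ and taking a free basis of $F_k$ to $\{g_{n+1},\dots,g_{n+k}\}$.
   Context: Fix a free basis $F_k=\langle x_1,\dots,x_k\rangle$ and write $A_{n+i}=\langle x_i\rangle$ for $1\le i\le k$. For distinct $1\le i,j\le n+k$ and $g_i\in A_i$, the partial conjugation $\chi_{g_i,j}$ is the automorphism with $g_j\mapsto g_i^{-1}g_jg_i$ for $g_j\in A_j$ and the identity on $A_\ell$, $\ell\ne j$. For $1\le i\le n+k$, $1\le j\le k$, $i\neq n+j$ and $g_i\in A_i$, the left and right transvections $\lambda_{g_i,j}$ and $\rho_{g_i,j}$ send $x_j$ to $g_ix_j$ and $x_jg_i$ respectively, and are the identity on $A_\ell$ for $\ell\ne n+j$. $\mathrm{Aut}^0(G)$ is the subgroup of $\mathrm{Aut}(G)$ generated by all partial conjugations and transvections. A choice of finite generating set for each $A_i$ yields a finite set of partial conjugations and transvections (those by the chosen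 generators) generating $\mathrm{Aut}^0(G)$; this is a set of Fouxe-Rabinovitch generators. A normal form is an assignment to each element of $\mathrm{Aut}^0(G)$ of a word in these generators representing it. "Method" is meant relative to computation in the factors: one takes as given a normal form for elements of each $A_i$ and an algorithm putting elements of $A_i$ in normal form. With these the method is an effective procedure; for arbitrary finitely generated $A_i$ no algorithm in the strict sense is claimed. *)

theory Defs
  imports "HOL-Algebra.Algebra" "HOL-Library.Nat_Bijection"
begin

section \<open>Words and normal forms\<close>

text \<open>
  A word over a set \<open>L\<close> of letters is a list of signed letters; \<open>(a, True)\<close> stands for the letter
  \<open>a\<close> and \<open>(a, False)\<close> for its formal inverse.
\<close>

type_synonym 'a word = "('a \<times> bool) list"

definition words :: "'a set \<Rightarrow> 'a word set" where
  "words L = lists (L \<times> UNIV)"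

definition word_val :: "('g, 'm) monoid_scheme \<Rightarrow> ('a \<Rightarrow> 'g) \<Rightarrow> 'a word \<Rightarrow> 'g" where
  "word_val G f w =
     foldr (\<lambda>(a, e) r. (if e then f a else inv\<^bsub>G\<^esub> (f a)) \<otimes>\<^bsub>G\<^esub> r) w \<one>\<^bsub>G\<^esub>"

definition normal_form ::
  "('g, 'm) monoid_scheme \<Rightarrow> ('a \<Rightarrow> 'g) \<Rightarrow> 'a set \<Rightarrow> 'g set \<Rightarrow> ('g \<Rightarrow> 'a word) \<Rightarrow> bool" where
  "normal_form G f L C nf \<longleftrightarrow> (\<forall>c\<in>C. nf c \<in> words L \<and> word_val G f (nf c) = c)"

definition freely_reduced :: "'a word \<Rightarrow> bool" where
  "freely_reduced w \<longleftrightarrow> successively (\<lambda>(a, e) (b, e'). a = b \<longrightarrow> e = e') w"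


section \<open>Free products\<close>

text \<open>
  \<open>G\<close> is the (internal) free product of the subgroups \<open>H i\<close>, \<open>i \<in> I\<close>: they generate \<open>G\<close>, and a
  nonempty product of nontrivial elements of the \<open>H i\<close>, consecutive ones from factors with
  different indices, is never trivial.
\<close>

definition free_product :: "('g, 'm) monoid_scheme \<Rightarrow> 'i set \<Rightarrow> ('i \<Rightarrow> 'g set) \<Rightarrow> bool" where
  "free_product G I H \<longleftrightarrow>
     (\<forall>i\<in>I. subgroup (H i) G) \<and>
     generate G (\<Union>i\<in>I. H i) = carrier G \<and>
     (\<forall>ps. ps \<noteq> [] \<and> (\<forall>(i, h)\<in>set ps. i \<in> I \<and> h \<in> H i \<and> h \<noteq> \<one>\<^bsub>G\<^esub>) \<and>
           distinct_adj (map fst ps)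
        \<longrightarrow> foldr (\<otimes>\<^bsub>G\<^esub>) (map snd ps) \<one>\<^bsub>G\<^esub> \<noteq> \<one>\<^bsub>G\<^esub>)"

definition freely_indecomposable :: "('g, 'm) monoid_scheme \<Rightarrow> bool" where
  "freely_indecomposable G \<longleftrightarrow>
     carrier G \<noteq> {\<one>\<^bsub>G\<^esub>} \<and>
     (\<forall>K L. free_product G (UNIV :: bool set) (\<lambda>b. if b then K else L)
        \<longrightarrow> K = {\<one>\<^bsub>G\<^esub>} \<or> L = {\<one>\<^bsub>G\<^esub>})"

definition infinite_cyclic :: "('g, 'm) monoid_scheme \<Rightarrow> bool" where
  "infinite_cyclic G \<longleftrightarrow> cyclic_group G \<and> infinite (carrier G)"

definition free_basis :: "('g, 'm) monoid_scheme \<Rightarrow> 'g set \<Rightarrow> bool" where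
  "free_basis G B \<longleftrightarrow>
     B \<subseteq> carrier G \<and> generate G B = carrier G \<and>
     (\<forall>w\<in>words B. w \<noteq> [] \<and> freely_reduced w \<longrightarrow> word_val G (\<lambda>b. b) w \<noteq> \<one>\<^bsub>G\<^esub>)"


section \<open>Partial conjugations, transvections and the group they generate\<close>

text \<open>
  Indices start at 0: the factors are \<open>A i\<close> for \<open>i < n + k\<close>, the free basis is \<open>x j\<close> for \<open>j < k\<close>,
  and \<open>A (n + j)\<close> is the cyclic subgroup generated by \<open>x j\<close>.  The members of \<^term>\<open>auto G\<close> are
  extensional, so each of the following automorphisms is determined by its values on the factors.
\<close>

definition partial_conj ::
  "('g, 'm) monoid_scheme \<Rightarrow> nat \<Rightarrow> (nat \<Rightarrow> 'g set) \<Rightarrow> 'g \<Rightarrow> nat \<Rightarrow> 'g \<Rightarrow> 'g" where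
  "partial_conj G N A g j =
     (THE \<phi>. \<phi> \<in> auto G \<and>
        (\<forall>h\<in>A j. \<phi> h = inv\<^bsub>G\<^esub> g \<otimes>\<^bsub>G\<^esub> h \<otimes>\<^bsub>G\<^esub> g) \<and>
        (\<forall>l<N. l \<noteq> j \<longrightarrow> (\<forall>h\<in>A l. \<phi> h = h)))"

definition left_transvection ::
  "('g, 'm) monoid_scheme \<Rightarrow> nat \<Rightarrow> nat \<Rightarrow> (nat \<Rightarrow> 'g set) \<Rightarrow> (nat \<Rightarrow> 'g) \<Rightarrow> 'g \<Rightarrow> nat \<Rightarrow> 'g \<Rightarrow> 'g"
  where
  "left_transvection G n k A x g j =
     (THE \<phi>. \<phi> \<in> auto G \<and> \<phi> (x j) = g \<otimes>\<^bsub>G\<^esub> x j \<and>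
        (\<forall>l<n + k. l \<noteq> n + j \<longrightarrow> (\<forall>h\<in>A l. \<phi> h = h)))"

definition right_transvection ::
  "('g, 'm) monoid_scheme \<Rightarrow> nat \<Rightarrow> nat \<Rightarrow> (nat \<Rightarrow> 'g set) \<Rightarrow> (nat \<Rightarrow> 'g) \<Rightarrow> 'g \<Rightarrow> nat \<Rightarrow> 'g \<Rightarrow> 'g"
  where
  "right_transvection G n k A x g j =
     (THE \<phi>. \<phi> \<in> auto G \<and> \<phi> (x j) = x j \<otimes>\<^bsub>G\<^esub> g \<and>
        (\<forall>l<n + k. l \<noteq> n + j \<longrightarrow> (\<forall>h\<in>A l. \<phi> h = h)))"

definition Aut0 ::
  "('g, 'm) monoid_scheme \<Rightarrow> nat \<Rightarrow> nat \<Rightarrow> (nat \<Rightarrow> 'g set) \<Rightarrow> (nat \<Rightarrow> 'g) \<Rightarrow> ('g \<Rightarrow> 'g) set" where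
  "Aut0 G n k A x = generate (AutoGroup G)
     ({partial_conj G (n + k) A g j |i j g. i < n + k \<and> j < n + k \<and> i \<noteq> j \<and> g \<in> A i} \<union>
      {left_transvection G n k A x g j |i j g. i < n + k \<and> j < k \<and> i \<noteq> n + j \<and> g \<in> A i} \<union>
      {right_transvection G n k A x g j |i j g. i < n + k \<and> j < k \<and> i \<noteq> n + j \<and> g \<in> A i})"

text \<open>
  Fix for every factor a finite list \<open>gens i\<close> of generators.  The Fouxe-Rabinovitch generators are
  the partial conjugations and transvections by the elements \<open>gens i ! m\<close>; they are named by the
  letters below, whose arguments are \<open>i\<close>, \<open>m\<close> and the index \<open>j\<close> of what is being moved.
\<close>

datatype fr_letter = PConj nat nat nat | LTrans nat nat nat | RTrans nat nat nat

fun fr_val ::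
  "('g, 'm) monoid_scheme \<Rightarrow> nat \<Rightarrow> nat \<Rightarrow> (nat \<Rightarrow> 'g set) \<Rightarrow> (nat \<Rightarrow> 'g) \<Rightarrow> (nat \<Rightarrow> 'g list) \<Rightarrow>
   fr_letter \<Rightarrow> 'g \<Rightarrow> 'g" where
  "fr_val G n k A x gens (PConj i m j) = partial_conj G (n + k) A (gens i ! m) j"
| "fr_val G n k A x gens (LTrans i m j) = left_transvection G n k A x (gens i ! m) j"
| "fr_val G n k A x gens (RTrans i m j) = right_transvection G n k A x (gens i ! m) j"

definition fr_letters :: "nat \<Rightarrow> nat \<Rightarrow> (nat \<Rightarrow> 'g list) \<Rightarrow> fr_letter set" where
  "fr_letters n k gens =
     {PConj i m j |i m j. i < n + k \<and> m < length (gens i) \<and> j < n + k \<and> i \<noteq> j} \<union>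
     {LTrans i m j |i m j. i < n + k \<and> m < length (gens i) \<and> j < k \<and> i \<noteq> n + j} \<union>
     {RTrans i m j |i m j. i < n + k \<and> m < length (gens i) \<and> j < k \<and> i \<noteq> n + j}"

text \<open>Elements of \<open>G\<close> are written as words in the letters \<open>(i, m)\<close>, standing for \<open>gens i ! m\<close>.\<close>

definition gen_letters :: "nat \<Rightarrow> (nat \<Rightarrow> 'g list) \<Rightarrow> (nat \<times> nat) set" where
  "gen_letters N gens = {(i, m). i < N \<and> m < length (gens i)}"

definition gen_val :: "(nat \<Rightarrow> 'g list) \<Rightarrow> nat \<times> nat \<Rightarrow> 'g" where
  "gen_val gens = (\<lambda>(i, m). gens i ! m)"


section \<open>Relative computability\<close>

text \<open>
  Partial recursive functions relative to a total function \<open>orc\<close>, in the unary presentation in which the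
  pairing bijection \<^const>\<open>prod_encode\<close> takes the place of arities; \<open>None\<close> means divergence.
\<close>

inductive recursive_in :: "(nat \<Rightarrow> nat) \<Rightarrow> (nat \<Rightarrow> nat option) \<Rightarrow> bool"
  for orc :: "nat \<Rightarrow> nat" where
  query: "recursive_in orc (\<lambda>a. Some (orc a))"
| zero: "recursive_in orc (\<lambda>a. Some 0)"
| succ: "recursive_in orc (\<lambda>a. Some (Suc a))"
| left: "recursive_in orc (\<lambda>a. Some (fst (prod_decode a)))"
| right: "recursive_in orc (\<lambda>a. Some (snd (prod_decode a)))"
| pair: "recursive_in orc f \<Longrightarrow> recursive_in orc g \<Longrightarrow>
    recursive_in orc
      (\<lambda>a. Option.bind (f a) (\<lambda>b. Option.bind (g a) (\<lambda>c. Some (prod_encode (b, c)))))"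
| comp: "recursive_in orc f \<Longrightarrow> recursive_in orc g \<Longrightarrow>
    recursive_in orc (\<lambda>a. Option.bind (g a) f)"
| prim_rec: "recursive_in orc f \<Longrightarrow> recursive_in orc g \<Longrightarrow>
    recursive_in orc
      (\<lambda>a. case prod_decode a of (b, m) \<Rightarrow>
         rec_nat (f b)
           (\<lambda>y r. Option.bind r (\<lambda>c. g (prod_encode (b, prod_encode (y, c))))) m)"
| minimize: "recursive_in orc f \<Longrightarrow>
    recursive_in orc
      (\<lambda>a. let P = (\<lambda>m. f (prod_encode (a, m)) = Some 0 \<and>
                       (\<forall>l<m. \<exists>c. f (prod_encode (a, l)) = Some (Suc c)))
           in if \<exists>m. P m then Some (THE m. P m) else None)"


text \<open>Explicit codings of the inputs and outputs by natural numbers.\<close>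

definition word_code :: "('a \<Rightarrow> nat) \<Rightarrow> 'a word \<Rightarrow> nat" where
  "word_code c w = list_encode (map (\<lambda>(a, e). prod_encode (c a, of_bool e)) w)"

fun fr_code :: "fr_letter \<Rightarrow> nat" where
  "fr_code (PConj i m j) = list_encode [0, i, m, j]"
| "fr_code (LTrans i m j) = list_encode [1, i, m, j]"
| "fr_code (RTrans i m j) = list_encode [2, i, m, j]"

definition input_code :: "(nat \<times> nat) word list \<Rightarrow> nat" where
  "input_code ws = list_encode (map (word_code prod_encode) ws)"

definition answer_code :: "fr_letter word option \<Rightarrow> nat" where
  "answer_code r = (case r of None \<Rightarrow> 0 | Some w \<Rightarrow> Suc (word_code fr_code w))"

text \<open>
  \<open>orc\<close> implements an algorithm that, given \<open>i < n\<close> and a word in the generators of \<open>A i\<close>, returns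
  the normal form \<open>nf i\<close> of the element represented by the word.  Its values at other arguments are
  irrelevant.
\<close>

definition normalizing_oracle ::
  "('g, 'm) monoid_scheme \<Rightarrow> nat \<Rightarrow> (nat \<Rightarrow> 'g list) \<Rightarrow> (nat \<Rightarrow> 'g \<Rightarrow> nat word) \<Rightarrow>
   (nat \<Rightarrow> nat) \<Rightarrow> bool" where
  "normalizing_oracle G n gens nf orc \<longleftrightarrow>
     (\<forall>i<n. \<forall>w\<in>words {..<length (gens i)}.
        orc (prod_encode (i, word_code (\<lambda>m. m) w)) =
        word_code (\<lambda>m. m) (nf i (word_val G (\<lambda>m. gens i ! m) w)))"

text \<open>
  An operation on \<open>N\<close>-tuples of elements of \<open>G\<close> is effective relative to \<open>orc\<close> if some function
  recursive in \<open>orc\<close> computes it from any words representing the tuple, always halting on these.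
\<close>

definition effective ::
  "('g, 'm) monoid_scheme \<Rightarrow> nat \<Rightarrow> (nat \<Rightarrow> 'g list) \<Rightarrow> (nat \<Rightarrow> nat) \<Rightarrow>
   ('g list \<Rightarrow> fr_letter word option) \<Rightarrow> bool" where
  "effective G N gens orc M \<longleftrightarrow>
     (\<exists>f. recursive_in orc f \<and>
        (\<forall>ws. length ws = N \<and> set ws \<subseteq> words (gen_letters N gens) \<longrightarrow>
           f (input_code ws) =
           Some (answer_code (M (map (word_val G (gen_val gens)) ws)))))"


section \<open>Tuples generating the free product\<close>

definition conj_subgroup :: "('g, 'm) monoid_scheme \<Rightarrow> 'g \<Rightarrow> 'g set \<Rightarrow> 'g set" where
  "conj_subgroup G g H = (\<lambda>h. inv\<^bsub>G\<^esub> g \<otimes>\<^bsub>G\<^esub> h \<otimes>\<^bsub>G\<^esub> g) ` H"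

definition tuple_generates ::
  "('g, 'm) monoid_scheme \<Rightarrow> nat \<Rightarrow> nat \<Rightarrow> (nat \<Rightarrow> 'g set) \<Rightarrow> 'g list \<Rightarrow> bool" where
  "tuple_generates G n k A gs \<longleftrightarrow>
     generate G ((\<Union>i<n. conj_subgroup G (gs ! i) (A i)) \<union> {gs ! (n + j) |j. j < k}) = carrier G"

end

(* Every tuple has a finite certificate, checkable with the normal forms of the factors.  The
   positive certificate is a word in the Fouxe-Rabinovitch generators, whose automorphism is compared
   with the tuple.  The negative one is an action of G on the natural numbers in which the subgroup
   generated by the tuple fixes 0 and G does not; every factor acts by a fixed model action conjugated
   by finitely many transpositions, and every basis element of the free part by transpositions.

   That one of the two exists is a folding argument.  In the Bass-Serre-like graph with vertices the
   elements g of G and the cosets g A_i, take a finite connected set V that contains 1 and the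
   cosets t_i A_i, where t_i is the inverse of g_i, and in which every further element y_j of the
   tuple is linked, i.e. maps some vertex of V to one equal or adjacent to a vertex of V.
   If a letter h from a conjugate of A_i or from the y_j identifies two distinct vertices of V,
   V is cut at an edge and one part is translated by h, which corresponds to partial conjugations
   and transvections of the tuple and makes V smaller.  If h is a y_j that fixes a vertex, the tuple
   has lost rank, which homomorphisms to Z/2 detect.  If there is no such letter, V and its links
   form a folded graph, so that V extends to a permutation action of G: either 0 is moved, or the
   tuple is the standard one up to permutation and inversion.

   The method searches for the certificate with the least code.  Whether a certificate is valid
   depends only on the automorphism and not on the word, so the search finds the word of least code
   for the automorphism, and this is its normal form. *)
theory Submission
  imports Defs
begin

section \<open>Total functions recursive in an oracle\<close>

text \<open>The obstacle is the negative answer: the \<open>A i\<close> are arbitrary, so finite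
  quotients of G need not distinguish the subgroup generated by the tuple from G. An action on an
  infinite set is needed that is still computable. It comes from \<open>A i\<close> translating its
  own normal forms: a generator acts by one oracle call, and unlimited spare regular orbits and
  fixed points make room to place finitely many prescribed points with finitely many transpositions.
  So an action is a finite object although its orbits may be infinite. None of the folding has to be
  effective. It only proves that an unbounded search halts; cuts and translations are never
  computed. Correctness of a certificate that has been found is independent of it. Folding halts
  because each translation identifies two vertices of V. In a folded state the element 1 gets the
  number 0, and the partial action is extended so that 0 is moved whenever the graph leaves freedom
  at 1; hence 0 stays fixed only if the graph around 1 is already that of the standard
  tuple.\<close>

definition trec :: "(nat \<Rightarrow> nat) \<Rightarrow> (nat \<Rightarrow> nat) \<Rightarrow> bool" where
  "trec orc f \<longleftrightarrow> recursive_in orc (\<lambda>a. Some (f a))"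

definition tdec :: "(nat \<Rightarrow> nat) \<Rightarrow> (nat \<Rightarrow> bool) \<Rightarrow> bool" where
  "tdec orc P \<longleftrightarrow> trec orc (\<lambda>a. of_bool (P a))"

definition tlist :: "(nat \<Rightarrow> nat) \<Rightarrow> (nat \<Rightarrow> nat list) \<Rightarrow> bool" where
  "tlist orc F \<longleftrightarrow> trec orc (\<lambda>a. list_encode (F a))"

abbreviation pfst :: "nat \<Rightarrow> nat" where "pfst a \<equiv> fst (prod_decode a)"
abbreviation psnd :: "nat \<Rightarrow> nat" where "psnd a \<equiv> snd (prod_decode a)"

text \<open>Closure rules collected here let a function be shown recursive by taking its term apart.
  Everything up to the final search is total, so \<open>trec\<close>, \<open>tdec\<close> and
  \<open>tlist\<close> speak of total functions.\<close>

named_theorems rec_intros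

lemma trec_comp:
  assumes "trec orc f" "trec orc g"
  shows "trec orc (\<lambda>a. f (g a))"
  using recursive_in.comp[OF assms[unfolded trec_def]] by (simp add: trec_def)

lemma trec_pair [rec_intros]:
  assumes "trec orc f" "trec orc g"
  shows "trec orc (\<lambda>a. prod_encode (f a, g a))"
  using recursive_in.pair[OF assms[unfolded trec_def]] by (simp add: trec_def)

lemma trec_fst [rec_intros]: "trec orc f \<Longrightarrow> trec orc (\<lambda>a. pfst (f a))"
  using trec_comp[of orc "\<lambda>a. pfst a" f] recursive_in.left by (simp add: trec_def)

lemma trec_snd [rec_intros]: "trec orc f \<Longrightarrow> trec orc (\<lambda>a. psnd (f a))"
  using trec_comp[of orc "\<lambda>a. psnd a" f] recursive_in.right by (simp add: trec_def)

text \<open>The identity is not among the basic functions; pairing the two projections yields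
  it.\<close>

lemma trec_id [rec_intros]: "trec orc (\<lambda>a. a)"
proof -
  have "trec orc (\<lambda>a. prod_encode (pfst a, psnd a))"
    by (intro trec_pair) (simp_all add: trec_def recursive_in.left recursive_in.right)
  then show ?thesis by simp
qed

lemma trec_Suc [rec_intros]: "trec orc f \<Longrightarrow> trec orc (\<lambda>a. Suc (f a))"
  using trec_comp[of orc Suc f] recursive_in.succ by (simp add: trec_def)

lemma trec_const [rec_intros]: "trec orc (\<lambda>a. c)"
proof (induction c)
  case 0
  show ?case using recursive_in.zero by (simp add: trec_def)
next
  case (Suc c)
  then show ?case by (rule trec_Suc)
qed

lemma trec_query [rec_intros]: "trec orc f \<Longrightarrow> trec orc (\<lambda>a. orc (f a))"
  using trec_comp[of orc orc f] recursive_in.query by (simp add: trec_def)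

text \<open>The basic scheme passes parameter, counter and previous value to the step as one nested
  pair, which dictates the shape of the hypothesis on \<open>g\<close>; depth and parameter are
  separated by composing with a pairing.\<close>

lemma trec_rec_nat:
  assumes h: "trec orc h" and f: "trec orc f"
    and g: "trec orc (\<lambda>b. g (pfst b) (pfst (psnd b)) (psnd (psnd b)))"
  shows "trec orc (\<lambda>a. rec_nat (f a) (g a) (h a))"
proof -
  have eq: "(case prod_decode a of (b, m) \<Rightarrow>
       rec_nat (Some (f b)) (\<lambda>y r. Option.bind r (\<lambda>c. Some (g (pfst (prod_encode (b, prod_encode (y, c))))
            (pfst (psnd (prod_encode (b, prod_encode (y, c))))) (psnd (psnd (prod_encode (b, prod_encode (y, c)))))))) m)
       = Some (rec_nat (f (pfst a)) (g (pfst a)) (psnd a))" for a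
  proof -
    obtain b m where bm: "prod_decode a = (b, m)" by force
    have "rec_nat (Some (f b)) (\<lambda>y r. Option.bind r (\<lambda>c. Some (g b y c))) m = Some (rec_nat (f b) (g b) m)"
      by (induction m) auto
    then show ?thesis using bm by simp
  qed
  have "trec orc (\<lambda>a. rec_nat (f (pfst a)) (g (pfst a)) (psnd a))"
    using recursive_in.prim_rec[OF f[unfolded trec_def] g[unfolded trec_def]]
    unfolding eq trec_def .
  from trec_comp[OF this trec_pair[OF trec_id h]] show ?thesis by simp
qed

lemma trec_pred [rec_intros]: "trec orc f \<Longrightarrow> trec orc (\<lambda>a. f a - 1)"
proof -
  assume f: "trec orc f"
  have "trec orc (\<lambda>a. rec_nat 0 (\<lambda>y r. y) (f a))"
    by (rule trec_rec_nat[OF f]) (intro rec_intros)+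
  moreover have "rec_nat 0 (\<lambda>y r. y) m = m - 1" for m :: nat
    by (cases m) auto
  ultimately show ?thesis by simp
qed

lemma trec_add [rec_intros]:
  assumes "trec orc f" "trec orc g" shows "trec orc (\<lambda>a. f a + g a)"
proof -
  have "trec orc (\<lambda>a. rec_nat (f a) (\<lambda>y r. Suc r) (g a))"
    by (rule trec_rec_nat[OF assms(2,1)]) (intro rec_intros)
  moreover have "rec_nat p (\<lambda>y r. Suc r) m = p + m" for m p :: nat
    by (induction m) auto
  ultimately show ?thesis by simp
qed

lemma trec_diff [rec_intros]:
  assumes "trec orc f" "trec orc g" shows "trec orc (\<lambda>a. f a - g a)"
proof -
  have "trec orc (\<lambda>a. rec_nat (f a) (\<lambda>y r. r - 1) (g a))"
    by (rule trec_rec_nat[OF assms(2,1)]) (intro rec_intros)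
  moreover have "rec_nat p (\<lambda>y r. r - 1) m = p - m" for m p :: nat
    by (induction m) auto
  ultimately show ?thesis by simp
qed

lemma trec_of_bool [rec_intros]: "tdec orc P \<Longrightarrow> trec orc (\<lambda>a. of_bool (P a))"
  by (simp add: tdec_def)

text \<open>Case distinction is recursion whose depth is the truth value: depth 0 returns the else
  branch, depth 1 replaces it.\<close>

lemma trec_if [rec_intros]:
  assumes "tdec orc P" "trec orc f" "trec orc g"
  shows "trec orc (\<lambda>a. if P a then f a else g a)"
proof -
  have "trec orc (\<lambda>a. rec_nat (g a) (\<lambda>y r. f a) (of_bool (P a)))"
    by (rule trec_rec_nat) (rule trec_of_bool assms trec_comp[OF assms(2)] trec_fst trec_id)+
  moreover have "rec_nat q (\<lambda>y r. p) (of_bool b) = (if b then p else q)" for p q :: nat and b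
    by (cases b) auto
  ultimately show ?thesis by simp
qed

lemma tdec_eq [rec_intros]:
  assumes "trec orc f" "trec orc g" shows "tdec orc (\<lambda>a. f a = g a)"
proof -
  \<comment> \<open>Truncated subtraction in both directions vanishes exactly for equal
    arguments.\<close>
  have "trec orc (\<lambda>a. 1 - ((f a - g a) + (g a - f a)))"
    by (intro rec_intros assms)
  moreover have "(1::nat) - ((x - y) + (y - x)) = of_bool (x = y)" for x y :: nat by auto
  ultimately show ?thesis by (simp add: tdec_def)
qed

lemma tdec_comp: "tdec orc P \<Longrightarrow> trec orc f \<Longrightarrow> tdec orc (\<lambda>a. P (f a))"
  unfolding tdec_def using trec_comp[of orc "\<lambda>a. of_bool (P a)" f] by simp

lemma tdec_const [rec_intros]: "tdec orc (\<lambda>a. c)"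
  unfolding tdec_def by (rule trec_const)

lemma tdec_not [rec_intros]:
  assumes "tdec orc P" shows "tdec orc (\<lambda>a. \<not> P a)"
proof -
  have "trec orc (\<lambda>a. 1 - of_bool (P a))" by (intro rec_intros assms)
  moreover have "(1::nat) - of_bool p = of_bool (\<not> p)" for p by simp
  ultimately show ?thesis by (simp only: tdec_def)
qed

lemma tdec_and [rec_intros]:
  assumes "tdec orc P" "tdec orc Q" shows "tdec orc (\<lambda>a. P a \<and> Q a)"
proof -
  have "trec orc (\<lambda>a. if P a then of_bool (Q a) else 0)" by (intro rec_intros assms)
  moreover have "(if p then of_bool q else 0) = (of_bool (p \<and> q) :: nat)" for p q by simp
  ultimately show ?thesis by (simp only: tdec_def)
qed

lemma tdec_or [rec_intros]: "tdec orc P \<Longrightarrow> tdec orc Q \<Longrightarrow> tdec orc (\<lambda>a. P a \<or> Q a)"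
  using tdec_not[OF tdec_and[OF tdec_not tdec_not], of orc P Q] by simp

lemma tdec_if [rec_intros]:
  "tdec orc P \<Longrightarrow> tdec orc Q \<Longrightarrow> tdec orc R \<Longrightarrow> tdec orc (\<lambda>a. if P a then Q a else R a)"
  using tdec_or[OF tdec_and[of orc P Q] tdec_and[OF tdec_not[of orc P], of R]]
  by (simp add: if_bool_eq_disj)

text \<open>The set is fixed in advance, so the quantifier unrolls into a finite conjunction, and
  the programs for the single \<open>s\<close> need not be uniform.\<close>

lemma tdec_Ball [rec_intros]:
  assumes "finite S" "\<And>s. s \<in> S \<Longrightarrow> tdec orc (P s)"
  shows "tdec orc (\<lambda>a. \<forall>s\<in>S. P s a)"
  using assms by (induction S) (auto intro!: rec_intros)

lemma tdec_Bex [rec_intros]: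
  assumes "finite S" "\<And>s. s \<in> S \<Longrightarrow> tdec orc (P s)"
  shows "tdec orc (\<lambda>a. \<exists>s\<in>S. P s a)"
  using assms by (induction S) (auto intro!: rec_intros)

lemma tdec_all_less [rec_intros]:
  assumes "\<And>i. i < (N::nat) \<Longrightarrow> tdec orc (P i)"
  shows "tdec orc (\<lambda>a. \<forall>i<N. P i a)"
  using tdec_Ball[of "{..<N}" orc P] assms by (simp add: Ball_def lessThan_def)

lemma tdec_mem [rec_intros]:
  assumes "finite S" "trec orc f" shows "tdec orc (\<lambda>a. f a \<in> S)"
proof -
  have "tdec orc (\<lambda>a. \<exists>s\<in>S. f a = s)" by (intro rec_intros assms)
  then show ?thesis by simp
qed

text \<open>A lookup with finitely many keys: every key may have its own program, with constants
  built in that were merely proved to exist. Later choices such as \<open>subst\<close> and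
  \<open>ex_nat\<close> become computable this way.\<close>

lemma trec_dispatch:
  assumes "finite S" "trec orc g" "\<And>s. s \<in> S \<Longrightarrow> trec orc (f s)" "trec orc d"
  shows "trec orc (\<lambda>a. if g a \<in> S then f (g a) a else d a)"
  using assms(1,3)
proof (induction S)
  case empty
  then show ?case using assms(4) by simp
next
  case (insert s S)
  have "trec orc (\<lambda>a. if g a = s then f s a else if g a \<in> S then f (g a) a else d a)"
    by (rule trec_if) (intro rec_intros assms(2), use insert in auto)
  moreover have "(\<lambda>a. if g a = s then f s a else if g a \<in> S then f (g a) a else d a) =
      (\<lambda>a. if g a \<in> insert s S then f (g a) a else d a)"
    by auto
  ultimately show ?case by simp
qed

lemma trec_iterate:
  assumes h: "trec orc h" and f: "trec orc f"
    and g: "trec orc (\<lambda>b. g (pfst b) (psnd b))"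
  shows "trec orc (\<lambda>a. (g a ^^ h a) (f a))"
proof -
  have "trec orc (\<lambda>b. (\<lambda>a y r. g a r) (pfst b) (pfst (psnd b)) (psnd (psnd b)))"
  proof -
    have "trec orc (\<lambda>b. prod_encode (pfst b, psnd (psnd b)))" by (intro rec_intros)
    from trec_comp[OF g this] show ?thesis by simp
  qed
  from trec_rec_nat[OF h f this]
  have "trec orc (\<lambda>a. rec_nat (f a) (\<lambda>y r. g a r) (h a))" by simp
  moreover have "rec_nat p (\<lambda>y r. q r) m = (q ^^ m) p" for p :: nat and q m
    by (induction m) auto
  ultimately show ?thesis by simp
qed

text \<open>The only use of unbounded minimisation. Nothing is claimed where no witness exists;
  there the search diverges.\<close>

lemma recursive_in_LEAST:
  assumes "tdec orc (\<lambda>b. P (pfst b) (psnd b))" and "trec orc h"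
  shows "\<exists>f. recursive_in orc f \<and> (\<forall>a. (\<exists>m. P a m) \<longrightarrow> f a = Some (h (LEAST m. P a m)))"
proof -
  let ?c = "\<lambda>b. of_bool (\<not> P (pfst b) (psnd b)) :: nat"
  let ?f = "\<lambda>a. let Q = (\<lambda>m. Some (?c (prod_encode (a, m))) = Some 0 \<and>
                       (\<forall>l<m. \<exists>c. Some (?c (prod_encode (a, l))) = Some (Suc c)))
           in if \<exists>m. Q m then Some (THE m. Q m) else None"
  have f: "recursive_in orc ?f"
    using recursive_in.minimize[of orc "\<lambda>b. Some (?c b)"] tdec_not[OF assms(1)]
    by (simp add: tdec_def trec_def)
  have g: "recursive_in orc (\<lambda>a. Option.bind (?f a) (\<lambda>b. Some (h b)))"
    by (rule recursive_in.comp[OF _ f]) (use assms(2) in \<open>simp add: trec_def\<close>)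
  have "?f a = Some (LEAST m. P a m)" if ex: "\<exists>m. P a m" for a
  proof -
    let ?Q = "\<lambda>m. P a m \<and> (\<forall>l<m. \<not> P a l)"
    have q: "?Q (LEAST m. P a m)"
      using ex by (metis LeastI_ex not_less_Least)
    have the: "(THE m. ?Q m) = (LEAST m. P a m)"
    proof (rule the_equality)
      show "?Q (LEAST m. P a m)" by (rule q)
    next
      fix m assume "?Q m"
      then show "m = (LEAST m. P a m)" by (metis Least_equality not_less)
    qed
    have eq: "(Some (?c (prod_encode (a, m))) = Some 0 \<and>
                       (\<forall>l<m. \<exists>c. Some (?c (prod_encode (a, l))) = Some (Suc c))) = ?Q m" for m
    proof -
      have "(\<exists>c. Some (of_bool p) = Some (Suc c)) = p" for p by (cases p) auto
      then show ?thesis by simp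
    qed
    have "?f a = (if \<exists>m. ?Q m then Some (THE m. ?Q m) else None)"
      unfolding Let_def by (simp only: eq)
    also have "(\<exists>m. ?Q m) = True" using q by blast
    finally show ?thesis by (simp only: if_True the)
  qed
  with g show ?thesis by (intro exI[of _ "\<lambda>a. Option.bind (?f a) (\<lambda>b. Some (h b))"]) simp
qed


section \<open>Closure properties for lists coded by numbers\<close>

lemma tlist_decode [rec_intros]: "trec orc f \<Longrightarrow> tlist orc (\<lambda>a. list_decode (f a))"
  by (simp add: tlist_def)

lemma trec_list_encode [rec_intros]: "tlist orc F \<Longrightarrow> trec orc (\<lambda>a. list_encode (F a))"
  by (simp add: tlist_def)

lemma tlist_const [rec_intros]: "tlist orc (\<lambda>a. xs)"
  by (simp add: tlist_def trec_const)

lemma tlist_Cons [rec_intros]: "trec orc f \<Longrightarrow> tlist orc F \<Longrightarrow> tlist orc (\<lambda>a. f a # F a)"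
  unfolding tlist_def list_encode.simps by (intro trec_Suc trec_pair)

text \<open>The code of a list can thus serve as the number of rounds of a loop over it.\<close>

lemma length_le_list_encode: "length xs \<le> list_encode xs"
proof (induction xs)
  case (Cons x xs)
  then show ?case using le_prod_encode_2[of "list_encode xs" x] by simp
qed simp

lemma trec_foldl:
  assumes F: "tlist orc F" and f: "trec orc f"
    and g: "trec orc (\<lambda>b. g (pfst b) (pfst (psnd b)) (psnd (psnd b)))"
  shows "trec orc (\<lambda>a. foldl (g a) (f a) (F a))"
proof -
  define st where "st a b = (if psnd b = 0 then b else
      prod_encode (g a (pfst b) (pfst (psnd b - 1)), psnd (psnd b - 1)))" for a b
  have st: "trec orc (\<lambda>b. st (pfst b) (psnd b))"
  proof -
    have "trec orc (\<lambda>b. prod_encode (pfst b, prod_encode (pfst (psnd b), pfst (psnd (psnd b) - 1))))"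
      by (intro rec_intros)
    from trec_comp[OF g this]
    have "trec orc (\<lambda>b. g (pfst b) (pfst (psnd b)) (pfst (psnd (psnd b) - 1)))"
      by (simp only: prod_encode_inverse fst_conv snd_conv)
    then show ?thesis unfolding st_def by (intro rec_intros)
  qed
  have st0: "st a (prod_encode (s, 0)) = prod_encode (s, 0)"
    and stS: "st a (prod_encode (s, list_encode (y # ys))) = prod_encode (g a s y, list_encode ys)"
    for a s y ys
    by (simp_all add: st_def)
  have iter: "length xs \<le> m \<Longrightarrow>
      (st a ^^ m) (prod_encode (s, list_encode xs)) = prod_encode (foldl (g a) s xs, 0)" for a s xs m
  proof (induction m arbitrary: s xs)
    case 0
    then show ?case by simp
  next
    case (Suc m)
    have "(st a ^^ Suc m) (prod_encode (s, list_encode xs)) =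
        (st a ^^ m) (st a (prod_encode (s, list_encode xs)))"
      by (simp add: funpow_swap1)
    also have "\<dots> = prod_encode (foldl (g a) s xs, 0)"
    proof (cases xs)
      case Nil
      then show ?thesis using Suc.IH[of "[]" s] by (simp add: st0)
    next
      case (Cons y ys)
      then show ?thesis using Suc by (simp add: stS del: list_encode.simps)
    qed
    finally show ?case .
  qed
  have F': "trec orc (\<lambda>a. list_encode (F a))" using F by (simp add: tlist_def)
  have "trec orc (\<lambda>a. pfst ((st a ^^ list_encode (F a)) (prod_encode (f a, list_encode (F a)))))"
    by (intro trec_fst trec_iterate st trec_pair f F')
  then show ?thesis by (simp add: iter[OF length_le_list_encode])
qed

lemma foldl_Cons_rev: "foldl (\<lambda>r x. x # r) ys xs = rev xs @ ys"
  by (induction xs arbitrary: ys) auto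

lemma tlist_foldl:
  assumes F: "tlist orc F" and f: "tlist orc f"
    and g: "tlist orc (\<lambda>b. g (pfst b) (list_decode (pfst (psnd b))) (psnd (psnd b)))"
  shows "tlist orc (\<lambda>a. foldl (g a) (f a) (F a))"
proof -
  have "trec orc (\<lambda>a. foldl (\<lambda>s x. list_encode (g a (list_decode s) x)) (list_encode (f a)) (F a))"
    by (rule trec_foldl[OF F]) (use f g in \<open>simp_all add: tlist_def\<close>)
  moreover have "foldl (\<lambda>s x. list_encode (g a (list_decode s) x)) (list_encode s) xs =
      list_encode (foldl (g a) s xs)" for a s xs
    by (induction xs arbitrary: s) auto
  ultimately show ?thesis by (simp add: tlist_def)
qed

lemma tlist_rev_append:
  assumes "tlist orc F" "tlist orc H" shows "tlist orc (\<lambda>a. rev (F a) @ H a)"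
proof -
  have "tlist orc (\<lambda>a. foldl (\<lambda>r x. x # r) (H a) (F a))"
    by (rule tlist_foldl[OF assms]) (intro rec_intros)
  then show ?thesis by (simp add: foldl_Cons_rev)
qed

lemma tlist_rev [rec_intros]: "tlist orc F \<Longrightarrow> tlist orc (\<lambda>a. rev (F a))"
  using tlist_rev_append[of orc F "\<lambda>_. []"] tlist_const[of orc "[]"] by simp

lemma tlist_append [rec_intros]: "tlist orc F \<Longrightarrow> tlist orc H \<Longrightarrow> tlist orc (\<lambda>a. F a @ H a)"
  using tlist_rev_append[of orc "\<lambda>a. rev (F a)" H] tlist_rev by simp

lemma trec_foldr:
  assumes "tlist orc F" "trec orc f"
    and g: "trec orc (\<lambda>b. g (pfst b) (pfst (psnd b)) (psnd (psnd b)))"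
  shows "trec orc (\<lambda>a. foldr (g a) (F a) (f a))"
proof -
  have *: "trec orc (\<lambda>b. prod_encode (pfst b, prod_encode (psnd (psnd b), pfst (psnd b))))"
    by (intro rec_intros)
  have "trec orc (\<lambda>a. foldl (\<lambda>s x. g a x s) (f a) (rev (F a)))"
    by (rule trec_foldl) (use trec_comp[OF g *] assms in \<open>simp_all add: tlist_rev\<close>)
  then show ?thesis by (simp add: foldl_conv_foldr)
qed

lemma tlist_concat_map:
  assumes "tlist orc F" and g: "tlist orc (\<lambda>b. g (pfst b) (psnd b))"
  shows "tlist orc (\<lambda>a. concat (map (g a) (F a)))"
proof -
  have "trec orc (\<lambda>b. prod_encode (pfst b, psnd (psnd b)))" by (intro rec_intros)
  from trec_comp[OF g[unfolded tlist_def] this]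
  have *: "tlist orc (\<lambda>b. g (pfst b) (psnd (psnd b)))" by (simp add: tlist_def)
  have "tlist orc (\<lambda>a. foldl (\<lambda>s x. s @ g a x) [] (F a))"
    by (rule tlist_foldl[OF assms(1)]) (intro rec_intros *)+
  moreover have "foldl (\<lambda>s x. s @ g a x) r xs = r @ concat (map (g a) xs)" for a r xs
    by (induction xs arbitrary: r) auto
  ultimately show ?thesis by (simp only: append_Nil)
qed

lemma tdec_list_all:
  assumes "tlist orc F" and P: "tdec orc (\<lambda>b. P (pfst b) (psnd b))"
  shows "tdec orc (\<lambda>a. \<forall>x\<in>set (F a). P a x)"
proof -
  have *: "trec orc (\<lambda>b. prod_encode (pfst b, psnd (psnd b)))" by (intro rec_intros)
  have "trec orc (\<lambda>a. foldl (\<lambda>s x. if P a x then s else 0) 1 (F a))"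
  proof (rule trec_foldl[OF assms(1)])
    show "trec orc (\<lambda>b. if P (pfst b) (psnd (psnd b)) then pfst (psnd b) else 0)"
      using tdec_comp[OF P *] by simp (intro rec_intros)
  qed (intro rec_intros)
  moreover have "foldl (\<lambda>s x. if p x then s else 0) s xs = (if \<forall>x\<in>set xs. p x then s else 0)"
    for p :: "nat \<Rightarrow> bool" and s :: nat and xs
    by (induction xs arbitrary: s) auto
  ultimately show ?thesis by (simp only: tdec_def of_bool_def)
qed

text \<open>The default 0 is the code of the empty list, so a missing entry of a coded tuple of
  lists reads as an empty list.\<close>

definition nth0 :: "nat list \<Rightarrow> nat \<Rightarrow> nat" where
  "nth0 xs i = (if i < length xs then xs ! i else 0)"

lemma prod_decode_0: "prod_decode 0 = (0, 0)"
  by (simp add: prod_decode_def prod_decode_aux.simps)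

lemma tlist_tl [rec_intros]: "tlist orc F \<Longrightarrow> tlist orc (\<lambda>a. tl (F a))"
proof -
  assume "tlist orc F"
  then have "trec orc (\<lambda>a. psnd (list_encode (F a) - 1))" by (intro rec_intros)
  \<comment> \<open>For the empty list, 0 - 1 is 0, which unpairs to (0, 0), and 0 is again the code
    of the empty list.\<close>
  moreover have "psnd (list_encode xs - 1) = list_encode (tl xs)" for xs
  proof (cases xs)
    case Nil
    then show ?thesis by (simp add: prod_decode_0)
  qed simp
  ultimately show ?thesis by (simp add: tlist_def)
qed

text \<open>The index is a constant, so the lookup is a composition of that many tails.\<close>

lemma trec_nth0 [rec_intros]: "tlist orc F \<Longrightarrow> trec orc (\<lambda>a. nth0 (F a) i)"
proof (induction i arbitrary: F)
  case 0
  then have "trec orc (\<lambda>a. pfst (list_encode (F a) - 1))" by (intro rec_intros)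
  moreover have "pfst (list_encode xs - 1) = nth0 xs 0" for xs
  proof (cases xs)
    case Nil
    then show ?thesis by (simp add: prod_decode_0 nth0_def)
  qed (simp add: nth0_def)
  ultimately show ?case by simp
next
  case (Suc i)
  have "nth0 xs (Suc i) = nth0 (tl xs) i" for xs by (cases xs) (auto simp: nth0_def)
  then show ?case using Suc.IH[OF tlist_tl[OF Suc.prems]] by simp
qed

lemma tdec_eq_Nil [rec_intros]: "tlist orc F \<Longrightarrow> tdec orc (\<lambda>a. F a = [])"
proof -
  assume "tlist orc F"
  then have "tdec orc (\<lambda>a. list_encode (F a) = 0)" by (intro rec_intros)
  moreover have "list_encode xs = 0 \<longleftrightarrow> xs = []" for xs by (cases xs) auto
  ultimately show ?thesis by simp
qed

section \<open>Words and free products\<close>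

context group
begin

lemma inv_cancel [simp]:
  assumes "a \<in> carrier G" "b \<in> carrier G"
  shows "inv a \<otimes> (a \<otimes> b) = b" "a \<otimes> (inv a \<otimes> b) = b"
  using assms by (simp_all flip: m_assoc)

definition lprod :: "'a list \<Rightarrow> 'a" where
  "lprod xs = foldr (\<otimes>) xs \<one>"

lemma lprod_simps [simp]: "lprod [] = \<one>" "lprod (a # xs) = a \<otimes> lprod xs"
  by (simp_all add: lprod_def)

lemma lprod_closed [simp]: "set xs \<subseteq> carrier G \<Longrightarrow> lprod xs \<in> carrier G"
  by (induction xs) auto

lemma lprod_append [simp]:
  "set xs \<subseteq> carrier G \<Longrightarrow> set ys \<subseteq> carrier G \<Longrightarrow> lprod (xs @ ys) = lprod xs \<otimes> lprod ys"
  by (induction xs) (auto simp: m_assoc)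

lemma lprod_rev_inv:
  "set xs \<subseteq> carrier G \<Longrightarrow> lprod (rev (map (\<lambda>a. inv a) xs)) = inv (lprod xs)"
proof (induction xs)
  case (Cons a xs)
  have "set (rev (map (\<lambda>a. inv a) xs)) \<subseteq> carrier G" using Cons.prems by auto
  then show ?case using Cons by (simp add: inv_mult_group)
qed simp

lemma word_val_Nil [simp]: "word_val G f [] = \<one>"
  by (simp add: word_val_def)

lemma word_val_Cons [simp]:
  "word_val G f ((a, e) # w) = (if e then f a else inv (f a)) \<otimes> word_val G f w"
  by (simp add: word_val_def)

lemma word_val_closed [simp]:
  "f ` L \<subseteq> carrier G \<Longrightarrow> w \<in> words L \<Longrightarrow> word_val G f w \<in> carrier G"
  unfolding words_def by (induction w) auto

lemma word_val_append:
  "f ` L \<subseteq> carrier G \<Longrightarrow> u \<in> words L \<Longrightarrow> v \<in> words L \<Longrightarrow>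
   word_val G f (u @ v) = word_val G f u \<otimes> word_val G f v"
proof (induction u)
  case (Cons p u)
  obtain a e where p: "p = (a, e)" by force
  have "f a \<in> carrier G" "u \<in> words L" using Cons.prems by (auto simp: words_def p)
  then show ?case using Cons.IH Cons.prems word_val_closed[of f L] by (simp add: p m_assoc)
qed simp

end

definition word_inv :: "'a word \<Rightarrow> 'a word" where
  "word_inv w = rev (map (\<lambda>(a, e). (a, \<not> e)) w)"

lemma words_simps [simp]:
  "[] \<in> words L" "(a, e) # w \<in> words L \<longleftrightarrow> a \<in> L \<and> w \<in> words L"
  "u @ v \<in> words L \<longleftrightarrow> u \<in> words L \<and> v \<in> words L"
  "word_inv w \<in> words L \<longleftrightarrow> w \<in> words L"
proof -
  show "word_inv w \<in> words L \<longleftrightarrow> w \<in> words L"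
    by (force simp: words_def word_inv_def in_lists_conv_set)
qed (auto simp: words_def)

lemma (in group) word_val_inv:
  assumes "f ` L \<subseteq> carrier G" "w \<in> words L"
  shows "word_val G f (word_inv w) = inv (word_val G f w)"
  using assms(2)
proof (induction w)
  case (Cons p w)
  obtain a e where p: "p = (a, e)" by force
  have a: "f a \<in> carrier G" "a \<in> L" "w \<in> words L" using assms Cons.prems by (auto simp: p)
  have "word_val G f (word_inv (p # w)) = word_val G f (word_inv w @ [(a, \<not> e)])"
    by (simp add: word_inv_def p)
  also have "\<dots> = word_val G f (word_inv w) \<otimes> word_val G f [(a, \<not> e)]"
    by (rule word_val_append[OF assms(1)]) (use a in auto)
  finally show ?case using a Cons.IH word_val_closed[OF assms(1) a(3)] by (auto simp: p inv_mult_group)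
qed (simp add: word_inv_def)

lemma (in group) word_val_generate:
  assumes "f ` L \<subseteq> carrier G" "g \<in> generate G (f ` L)"
  shows "\<exists>w\<in>words L. word_val G f w = g"
  using assms(2)
proof (induction rule: generate.induct)
  case one
  show ?case by (rule bexI[of _ "[]"]) auto
next
  case (incl h)
  then obtain a where "a \<in> L" "h = f a" by auto
  then show ?case using assms(1) by (intro bexI[of _ "[(a, True)]"]) auto
next
  case (inv h)
  then obtain a where "a \<in> L" "h = f a" by auto
  then show ?case using assms(1) by (intro bexI[of _ "[(a, False)]"]) auto
next
  case (eng h1 h2)
  then obtain u v where "u \<in> words L" "v \<in> words L" "word_val G f u = h1" "word_val G f v = h2" by auto
  then show ?case using word_val_append[OF assms(1)] by (intro bexI[of _ "u @ v"]) auto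
qed

lemma (in group) word_val_in_subgroup:
  assumes "subgroup H G" "f ` L \<subseteq> H" "w \<in> words L"
  shows "word_val G f w \<in> H"
  using assms(3)
proof (induction w)
  case (Cons p w)
  then show ?case using assms(1,2)
    by (cases p) (auto intro!: subgroup.m_closed subgroup.m_inv_closed)
qed (simp add: assms(1) subgroup.one_closed)

lemma not_distinct_adjE:
  assumes "\<not> distinct_adj (map fst ps)"
  obtains as i g h bs where "ps = as @ (i, g) # (i, h) # bs"
  using assms
proof (induction ps arbitrary: thesis)
  case (Cons p ps)
  show ?case
  proof (cases "distinct_adj (map fst ps)")
    case True
    with Cons.prems(2) obtain q qs where q: "ps = q # qs" "fst p = fst q"
      by (cases ps) auto
    show ?thesis
      by (rule Cons.prems(1)[of "[]" "fst p" "snd p" "snd q" qs]) (simp add: q(1), simp add: q(2))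
  next
    case False
    then obtain as i g h bs where "ps = as @ (i, g) # (i, h) # bs" by (rule Cons.IH[rotated])
    then show ?thesis using Cons.prems(1)[of "p # as"] by simp
  qed
qed simp

text \<open>Peels off one generator on the left, where \<open>generate.induct\<close> would split
  products at arbitrary places; fixed-point and connectivity arguments need this form.\<close>

lemma (in group) generate_induct_left [consumes 2, case_names one left]:
  assumes "g \<in> generate G S" "S \<subseteq> carrier G"
    and "P \<one>"
    and step: "\<And>s g. s \<in> S \<or> (\<exists>t\<in>S. s = inv t) \<Longrightarrow> g \<in> carrier G \<Longrightarrow> P g \<Longrightarrow> P (s \<otimes> g)"
  shows "P g"
proof -
  have "(\<lambda>a. a) ` S \<subseteq> carrier G" using assms(2) by simp
  then obtain w where w: "w \<in> words S" "word_val G (\<lambda>a. a) w = g"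
    using word_val_generate[of "\<lambda>a. a" S g] assms(1) by auto
  have "P (word_val G (\<lambda>a. a) w)" using w(1)
  proof (induction w)
    case (Cons p w)
    obtain a e where p: "p = (a, e)" by force
    have a: "a \<in> S" "w \<in> words S" using Cons.prems p by auto
    have "word_val G (\<lambda>a. a) w \<in> carrier G" by (rule word_val_closed[of _ S]) (use a assms(2) in auto)
    moreover have "P (word_val G (\<lambda>a. a) w)" by (rule Cons.IH[OF a(2)])
    ultimately show ?case using step[of a] step[of "inv a"] a(1) by (cases e) (auto simp: p)
  qed (simp add: assms(3))
  then show ?thesis using w(2) by simp
qed

text \<open>The image of a syllable list depends only on its product, because a list with product one
  can be reduced to the empty list by deleting trivial syllables and merging neighbours.\<close>

lemma (in group) free_product_hom_one:
  assumes fp: "free_product G I H" and "group K"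
    and h: "\<And>i. i \<in> I \<Longrightarrow> h i \<in> hom (G\<lparr>carrier := H i\<rparr>) K"
    and "\<forall>(i, a)\<in>set ps. i \<in> I \<and> a \<in> H i" and "lprod (map snd ps) = \<one>"
  shows "foldr (\<otimes>\<^bsub>K\<^esub>) (map (\<lambda>(i, a). h i a) ps) \<one>\<^bsub>K\<^esub> = \<one>\<^bsub>K\<^esub>"
  using assms(4,5)
proof (induction ps rule: length_induct)
  case (1 ps)
  interpret K: group K by fact
  have H: "subgroup (H i) G" if "i \<in> I" for i using fp that by (simp add: free_product_def)
  have Hc: "a \<in> carrier G" if "i \<in> I" "a \<in> H i" for i a
    using subgroup.mem_carrier[OF H] that by blast
  have hc: "h i a \<in> carrier K" if "i \<in> I" "a \<in> H i" for i a
    using h[OF that(1)] that(2) by (auto simp: hom_def)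
  have hm: "h i (a \<otimes> b) = h i a \<otimes>\<^bsub>K\<^esub> h i b" if "i \<in> I" "a \<in> H i" "b \<in> H i" for i a b
    using h[OF that(1)] that(2,3) by (auto simp: hom_def)
  have h1: "h i \<one> = \<one>\<^bsub>K\<^esub>" if "i \<in> I" for i
    using hom_one[OF h[OF that] subgroup_imp_group[OF H[OF that]] \<open>group K\<close>] by simp
  let ?img = "\<lambda>ps. K.lprod (map (\<lambda>(i, a). h i a) ps)"
  have valid: "set (map snd qs) \<subseteq> carrier G" "set (map (\<lambda>(i, a). h i a) qs) \<subseteq> carrier K"
    if "\<forall>(i, a)\<in>set qs. i \<in> I \<and> a \<in> H i" for qs
    using that Hc hc by fastforce+
  have IH: "?img qs = \<one>\<^bsub>K\<^esub>"
    if "length qs < length ps" "\<forall>(i, a)\<in>set qs. i \<in> I \<and> a \<in> H i" "lprod (map snd qs) = \<one>" for qs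
    using 1(1) that by (auto simp: K.lprod_def)
  show ?case
  proof (cases "ps = []")
    case ne: False
    \<comment> \<open>A nonempty list with product one cannot be reduced in the sense of
      \<open>free_product\<close>, so one of these two simplifications applies and shortens
      it.\<close>
    consider (triv) i where "(i, \<one>) \<in> set ps" | (adj) "\<not> distinct_adj (map fst ps)"
    proof -
      have "\<not> ((\<forall>(i, a)\<in>set ps. i \<in> I \<and> a \<in> H i \<and> a \<noteq> \<one>) \<and> distinct_adj (map fst ps))"
        using fp 1(3) ne unfolding free_product_def lprod_def by blast
      then show ?thesis using that 1(2) by blast
    qed
    then have "?img ps = \<one>\<^bsub>K\<^esub>"
    proof cases
      case triv
      then obtain as bs where ps: "ps = as @ (i, \<one>) # bs" by (meson split_list)
      have v: "\<forall>(i, a)\<in>set as. i \<in> I \<and> a \<in> H i" "\<forall>(i, a)\<in>set bs. i \<in> I \<and> a \<in> H i" "i \<in> I"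
        using 1(2) by (auto simp: ps)
      have "?img (as @ bs) = \<one>\<^bsub>K\<^esub>"
        using IH[of "as @ bs"] 1(2,3) v valid[OF v(1)] valid[OF v(2)] by (auto simp: ps)
      then show ?thesis using v valid[OF v(1)] valid[OF v(2)] h1 by (simp add: ps)
    next
      case adj
      then obtain as i a b bs where ps: "ps = as @ (i, a) # (i, b) # bs" by (rule not_distinct_adjE)
      have v: "\<forall>(i, a)\<in>set as. i \<in> I \<and> a \<in> H i" "\<forall>(i, a)\<in>set bs. i \<in> I \<and> a \<in> H i" "i \<in> I"
        "a \<in> H i" "b \<in> H i"
        using 1(2) by (auto simp: ps)
      have c: "a \<in> carrier G" "b \<in> carrier G" "h i a \<in> carrier K" "h i b \<in> carrier K"
        "a \<otimes> b \<in> H i" using v Hc hc subgroup.m_closed[OF H] by auto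
      have "?img (as @ (i, a \<otimes> b) # bs) = \<one>\<^bsub>K\<^esub>"
        using IH[of "as @ (i, a \<otimes> b) # bs"] 1(2,3) v valid[OF v(1)] valid[OF v(2)] c
        by (auto simp: ps m_assoc)
      then show ?thesis using v valid[OF v(1)] valid[OF v(2)] c by (simp add: ps hm K.m_assoc)
    qed
    then show ?thesis by (simp add: K.lprod_def)
  qed simp
qed

text \<open>The universal property. \<open>free_product\<close> only talks about reduced products
  inside G, so the extension is defined through a chosen syllable list for each element.\<close>

lemma (in group) free_product_hom_extension:
  fixes I :: "'i set"
  assumes fp: "free_product G I H" and "group K"
    and h: "\<And>i. i \<in> I \<Longrightarrow> h i \<in> hom (G\<lparr>carrier := H i\<rparr>) K"
  shows "\<exists>\<phi>\<in>hom G K. \<forall>i\<in>I. \<forall>a\<in>H i. \<phi> a = h i a"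
proof -
  interpret K: group K by fact
  have H: "subgroup (H i) G" if "i \<in> I" for i using fp that by (simp add: free_product_def)
  have Hc: "a \<in> carrier G" if "i \<in> I" "a \<in> H i" for i a
    using subgroup.mem_carrier[OF H] that by blast
  have hc: "h i a \<in> carrier K" if "i \<in> I" "a \<in> H i" for i a
    using h[OF that(1)] that(2) by (auto simp: hom_def)
  define valid where "valid ps \<longleftrightarrow> (\<forall>(i, a)\<in>set ps. i \<in> I \<and> a \<in> H i)" for ps
  define v where "v ps = lprod (map snd ps)" for ps :: "('i \<times> 'a) list"
  define img where "img ps = K.lprod (map (\<lambda>(i, a). h i a) ps)" for ps
  have sv: "set (map snd ps) \<subseteq> carrier G" "set (map (\<lambda>(i, a). h i a) ps) \<subseteq> carrier K"
    if "valid ps" for ps using that Hc hc by (auto simp: valid_def)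
  have valid_app: "valid (ps @ qs) \<longleftrightarrow> valid ps \<and> valid qs" for ps qs
    by (auto simp: valid_def)
  have v_app: "v (ps @ qs) = v ps \<otimes> v qs" if "valid ps" "valid qs" for ps qs
    using sv[OF that(1)] sv[OF that(2)] by (simp add: v_def)
  have img_app: "img (ps @ qs) = img ps \<otimes>\<^bsub>K\<^esub> img qs" if "valid ps" "valid qs" for ps qs
    using sv[OF that(1)] sv[OF that(2)] by (simp add: img_def)
  have vc: "v ps \<in> carrier G" "img ps \<in> carrier K" if "valid ps" for ps
    using sv[OF that] by (simp_all add: v_def img_def)
  define ivs where "ivs ps = rev (map (\<lambda>(i, a). (i, inv a)) ps)" for ps :: "('i \<times> 'a) list"
  have ivs_valid: "valid (ivs ps)" if "valid ps" for ps
    using that H subgroup.m_inv_closed by (fastforce simp: valid_def ivs_def)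
  have ivs_v: "v (ivs ps) = inv (v ps)" if "valid ps" for ps
  proof -
    have "map snd (ivs ps) = rev (map (\<lambda>a. inv a) (map snd ps))"
      by (simp add: ivs_def rev_map case_prod_unfold)
    then show ?thesis using lprod_rev_inv[OF sv(1)[OF that]] by (simp add: v_def)
  qed
  have ex: "\<exists>ps. valid ps \<and> v ps = g" if "g \<in> carrier G" for g
  proof -
    have "g \<in> generate G (\<Union>i\<in>I. H i)" using that fp by (simp add: free_product_def)
    moreover have "(\<Union>i\<in>I. H i) \<subseteq> carrier G" using Hc by auto
    ultimately show ?thesis
    proof (induction rule: generate_induct_left)
      case one
      show ?case by (rule exI[of _ "[]"]) (simp add: valid_def v_def)
    next
      case (left s g)
      then obtain ps where ps: "valid ps" "v ps = g" by blast
      from left(1) obtain i where "i \<in> I" "s \<in> H i" using H subgroup.m_inv_closed by fastforce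
      then show ?case using ps by (intro exI[of _ "(i, s) # ps"]) (auto simp: valid_def v_def)
    qed
  qed
  have same: "img ps = img qs" if "valid ps" "valid qs" "v ps = v qs" for ps qs
  proof -
    have one: "img rs = \<one>\<^bsub>K\<^esub>" if "valid rs" "v rs = \<one>" for rs
      using free_product_hom_one[OF fp \<open>group K\<close> h, of rs] that
      by (simp add: valid_def v_def img_def K.lprod_def)
    \<comment> \<open>Both \<open>ps\<close> and \<open>qs\<close>, followed by the formal inverse
      of \<open>qs\<close>, have product one; cancelling in K compares their images.\<close>
    have "img (ps @ ivs qs) = \<one>\<^bsub>K\<^esub>"
      using that by (intro one) (simp_all add: valid_app v_app ivs_valid ivs_v vc)
    moreover have "img (qs @ ivs qs) = \<one>\<^bsub>K\<^esub>"
      using that by (intro one) (simp_all add: valid_app v_app ivs_valid ivs_v vc)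
    ultimately show ?thesis using that by (simp add: img_app ivs_valid vc)
      (metis K.r_cancel ivs_valid vc(2))
  qed
  define \<phi> where "\<phi> g = img (SOME ps. valid ps \<and> v ps = g)" for g
  have phi: "\<phi> (v ps) = img ps" if "valid ps" for ps
    unfolding \<phi>_def using someI_ex[of "\<lambda>qs. valid qs \<and> v qs = v ps"] that same by blast
  have "\<phi> \<in> hom G K"
  proof (rule homI)
    fix a assume "a \<in> carrier G"
    then show "\<phi> a \<in> carrier K" using ex phi vc by metis
  next
    fix a b assume "a \<in> carrier G" "b \<in> carrier G"
    then obtain ps qs where "valid ps" "v ps = a" "valid qs" "v qs = b" using ex by metis
    moreover have "valid (ps @ qs)" using calculation by (auto simp: valid_def)
    ultimately show "\<phi> (a \<otimes> b) = \<phi> a \<otimes>\<^bsub>K\<^esub> \<phi> b"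
      using phi[of "ps @ qs"] phi[of ps] phi[of qs] by (simp add: v_app img_app)
  qed
  moreover have "\<phi> a = h i a" if "i \<in> I" "a \<in> H i" for i a
    using phi[of "[(i, a)]"] that Hc hc by (simp add: valid_def v_def img_def)
  ultimately show ?thesis by blast
qed

section \<open>The free product decomposition\<close>

lemma word_val_carrier_update:
  assumes "group G" "subgroup F G" "w \<in> words F"
  shows "word_val (G\<lparr>carrier := F\<rparr>) (\<lambda>b. b) w = word_val G (\<lambda>b. b) w"
  using assms(3)
proof (induction w)
  case (Cons p w)
  then show ?case using group.m_inv_consistent[OF assms(1,2)]
    by (cases p) (auto simp: word_val_def)
qed (simp add: word_val_def)

text \<open>Index n carries the whole free part F in \<open>fp\<close>, whereas
  \<open>A (n + j)\<close> is its j-th cyclic factor; both decompositions are needed, and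
  \<open>free_product_factors\<close> passes from one to the other.\<close>

locale free_product_data = group G for G (structure) +
  fixes n k :: nat and A :: "nat \<Rightarrow> 'a set" and F :: "'a set" and x :: "nat \<Rightarrow> 'a"
  assumes fp: "free_product G {..n} (\<lambda>i. if i < n then A i else F)"
    and nontrivial: "i < n \<Longrightarrow> A i \<noteq> {\<one>}"
    and basis: "free_basis (G\<lparr>carrier := F\<rparr>) (x ` {..<k})"
    and inj_x: "inj_on x {..<k}"
    and A_cyclic: "j < k \<Longrightarrow> A (n + j) = generate G {x j}"
begin

lemma subgroup_F: "subgroup F G"
  using fp[unfolded free_product_def, THEN conjunct1, rule_format, of n] by simp

lemma x_F: "j < k \<Longrightarrow> x j \<in> F"
  using basis by (auto simp: free_basis_def)

lemma x_closed [simp]: "j < k \<Longrightarrow> x j \<in> carrier G"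
  using x_F subgroup.mem_carrier[OF subgroup_F] by blast

lemma subgroup_A: "i < n + k \<Longrightarrow> subgroup (A i) G"
proof (cases "i < n")
  case True
  then show ?thesis using fp[unfolded free_product_def, THEN conjunct1, rule_format, of i] by simp
next
  case False
  moreover assume "i < n + k"
  ultimately have "A i = generate G {x (i - n)}" "i - n < k" using A_cyclic[of "i - n"] by auto
  then show ?thesis using generate_is_subgroup[of "{x (i - n)}"] by simp
qed

lemma A_closed [simp]: "a \<in> A i \<Longrightarrow> i < n + k \<Longrightarrow> a \<in> carrier G"
  using subgroup.mem_carrier[OF subgroup_A] by blast

lemma A_ops [simp]:
  "i < n + k \<Longrightarrow> \<one> \<in> A i"
  "i < n + k \<Longrightarrow> a \<in> A i \<Longrightarrow> inv a \<in> A i"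
  "i < n + k \<Longrightarrow> a \<in> A i \<Longrightarrow> b \<in> A i \<Longrightarrow> a \<otimes> b \<in> A i"
  using subgroup_A by (auto intro: subgroup.one_closed subgroup.m_inv_closed subgroup.m_closed)

lemma x_A: "j < k \<Longrightarrow> x j \<in> A (n + j)"
  using A_cyclic generate.incl[of "x j" "{x j}"] by simp

lemma A_cyclic_pow: "j < k \<Longrightarrow> A (n + j) = {x j [^] (z::int) | z. True}"
  using A_cyclic generate_pow[of "x j"] by simp

abbreviation BX :: "'a set" where "BX \<equiv> x ` {..<k}"

lemma X_closed: "BX \<subseteq> carrier G" "(\<lambda>b. b) ` BX \<subseteq> carrier G" by auto

lemma X_F: "BX \<subseteq> F" using x_F by auto

lemma F_eq: "F = generate G BX"
  using basis generate_consistent[OF X_F subgroup_F] by (simp add: free_basis_def)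

lemma reduced_word_nontrivial:
  assumes "w \<in> words BX" "w \<noteq> []" "freely_reduced w"
  shows "word_val G (\<lambda>b. b) w \<noteq> \<one>"
proof -
  have "words BX \<subseteq> words F" using X_F by (auto simp: words_def)
  then have "word_val (G\<lparr>carrier := F\<rparr>) (\<lambda>b. b) w = word_val G (\<lambda>b. b) w"
    using word_val_carrier_update[OF group_axioms subgroup_F] assms(1) subsetD by metis
  moreover have "word_val (G\<lparr>carrier := F\<rparr>) (\<lambda>b. b) w \<noteq> \<one>\<^bsub>G\<lparr>carrier := F\<rparr>\<^esub>"
    using basis[unfolded free_basis_def, THEN conjunct2, THEN conjunct2, rule_format, of w] assms by simp
  ultimately show ?thesis by simp
qed

lemma word_val_replicate:
  "b \<in> carrier G \<Longrightarrow> word_val G (\<lambda>b. b) (replicate m (b, e)) = (if e then b [^] m else inv (b [^] m))"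
proof (induction m)
  case (Suc m)
  then show ?case using nat_pow_Suc2[of b m] by (cases e) (simp_all flip: inv_mult_group)
qed simp

lemma freely_reduced_replicate_append:
  assumes "freely_reduced w" "w \<noteq> [] \<Longrightarrow> fst (hd w) \<noteq> b"
  shows "freely_reduced (replicate m (b, e) @ w)"
proof (induction m)
  case (Suc m)
  show ?case
  proof (cases m)
    case 0
    then show ?thesis
      using assms by (cases w) (simp_all add: freely_reduced_def split_beta del: prod.split_sel)
  next
    case (Suc m')
    then show ?thesis using Suc.IH by (simp add: freely_reduced_def)
  qed
qed (simp add: assms)

lemma int_pow_word:
  assumes "b \<in> carrier G"
  shows "b [^] (z::int) = word_val G (\<lambda>b. b) (replicate (nat \<bar>z\<bar>) (b, z \<ge> 0))"
proof -
  have "b [^] z = (if 0 \<le> z then b [^] nat z else inv (b [^] nat (- z)))"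
    unfolding int_pow_def2 by auto
  moreover have "nat \<bar>z\<bar> = (if 0 \<le> z then nat z else nat (- z))" by auto
  ultimately show ?thesis unfolding word_val_replicate[OF assms] by presburger
qed

lemma cyclic_word:
  assumes "j < k" "a \<in> A (n + j)" "a \<noteq> \<one>"
  obtains m e where "m > 0" "a = word_val G (\<lambda>b. b) (replicate m (x j, e))"
proof -
  obtain z :: int where z: "a = x j [^] z" using assms(1,2) A_cyclic_pow by auto
  have "z \<noteq> 0" using z assms by auto
  have "a = word_val G (\<lambda>b. b) (replicate (nat \<bar>z\<bar>) (x j, z \<ge> 0))"
    unfolding z by (rule int_pow_word) (use assms(1) in simp)
  with that[of "nat \<bar>z\<bar>"] \<open>z \<noteq> 0\<close> show ?thesis by auto
qed

lemma x_pow_eq_one: "j < k \<Longrightarrow> x j [^] (z::int) = \<one> \<longleftrightarrow> z = 0"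
proof
  assume j: "j < k" and z: "x j [^] z = \<one>"
  show "z = 0"
  proof (rule ccontr)
    assume "z \<noteq> 0"
    let ?w = "replicate (nat \<bar>z\<bar>) (x j, z \<ge> 0)"
    have "freely_reduced (?w @ [])"
      by (rule freely_reduced_replicate_append) (auto simp: freely_reduced_def)
    moreover have "?w \<in> words BX" using j by (auto simp: words_def)
    ultimately have "word_val G (\<lambda>b. b) ?w \<noteq> \<one>"
      using reduced_word_nontrivial[of ?w] \<open>z \<noteq> 0\<close> by auto
    then show False using z int_pow_word[of "x j" z] j by simp
  qed
qed simp

text \<open>Maximal runs of syllables with indices \<open>\<ge> n\<close> are collected into single syllables in \<open>F\<close>;
  the head index is recorded so that a run can be extended to the left by a reduced word.\<close>

lemma collect_syllables:
  assumes "\<forall>(i, a)\<in>set ps. i < n + k \<and> a \<in> A i \<and> a \<noteq> \<one>" "distinct_adj (map fst ps)" "ps \<noteq> []"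
  shows "\<exists>qs. qs \<noteq> [] \<and>
     (\<forall>(i, a)\<in>set qs. i \<le> n \<and> a \<in> (if i < n then A i else F) \<and> a \<noteq> \<one>) \<and>
     distinct_adj (map fst qs) \<and> lprod (map snd qs) = lprod (map snd ps) \<and>
     (if fst (hd ps) < n then fst (hd qs) = fst (hd ps)
      else fst (hd qs) = n \<and> (\<exists>w\<in>words BX. freely_reduced w \<and> w \<noteq> [] \<and>
         fst (hd w) = x (fst (hd ps) - n) \<and> snd (hd qs) = word_val G (\<lambda>b. b) w))"
  using assms
proof (induction ps)
  case (Cons p ps)
  obtain i a where p: "p = (i, a)" by force
  have i: "i < n + k" "a \<in> A i" "a \<noteq> \<one>" "a \<in> carrier G" using Cons.prems by (auto simp: p)
  have ps: "set (map snd ps) \<subseteq> carrier G" using Cons.prems by auto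
  let ?good = "\<lambda>qs. \<forall>(i, a)\<in>set qs. i \<le> n \<and> a \<in> (if i < n then A i else F) \<and> a \<noteq> \<one>"
  obtain qs where qs: "?good qs" "distinct_adj (map fst qs)" "lprod (map snd qs) = lprod (map snd ps)"
    "qs = [] \<longleftrightarrow> ps = []"
    "ps \<noteq> [] \<Longrightarrow> (if fst (hd ps) < n then fst (hd qs) = fst (hd ps)
      else fst (hd qs) = n \<and> (\<exists>w\<in>words BX. freely_reduced w \<and> w \<noteq> [] \<and>
         fst (hd w) = x (fst (hd ps) - n) \<and> snd (hd qs) = word_val G (\<lambda>b. b) w))"
  proof (cases "ps = []")
    case True
    then show ?thesis using that[of "[]"] by simp
  next
    case False
    then show ?thesis using that Cons.IH Cons.prems by (auto simp: distinct_adj_Cons)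
  qed
  have qc: "set (map snd qs) \<subseteq> carrier G"
    using qs(1) subgroup.mem_carrier[OF subgroup_F] by (fastforce split: if_splits)
  show ?case
  proof (cases "i < n")
    case True
    have "distinct_adj (map fst ((i, a) # qs))"
    proof (cases ps)
      case Nil
      then show ?thesis using qs(4) by simp
    next
      case (Cons p' ps')
      then show ?thesis using qs(2,4,5) Cons.prems True p by (cases qs) (auto split: if_splits)
    qed
    then show ?thesis using qs True i
      by (intro exI[of _ "(i, a) # qs"]) (auto simp: p)
  next
    case False
    define j where "j = i - n"
    have j: "i = n + j" "j < k" using False i by (auto simp: j_def)
    obtain m e where me: "m > 0" "a = word_val G (\<lambda>b. b) (replicate m (x j, e))"
      using cyclic_word[of j a] i j by metis
    have rep: "replicate m (x j, e) \<in> words BX" using j by (auto simp: words_def)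
    show ?thesis
    proof (cases "ps \<noteq> [] \<and> \<not> fst (hd ps) < n")
      \<comment> \<open>No cyclic syllable follows directly, so a new run consisting of a single
        power begins.\<close>
      case False
      have fr: "freely_reduced (replicate m (x j, e))"
        using freely_reduced_replicate_append[of "[]" "x j" m e] by (simp add: freely_reduced_def)
      have aF: "a \<in> F" using me rep word_val_in_subgroup[OF subgroup_F, of "\<lambda>b. b" BX] X_F by simp
      have "distinct_adj (map fst ((n, a) # qs))"
      proof (cases ps)
        case Nil
        then show ?thesis using qs(4) by simp
      next
        case (Cons p' ps')
        then show ?thesis using qs(2,4,5) False by (cases qs) auto
      qed
      then show ?thesis using qs aF i me rep fr j
        by (intro exI[of _ "(n, a) # qs"]) (auto simp: p intro!: bexI[of _ "replicate m (x j, e)"])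
    next
      case True
      then obtain w where w: "fst (hd qs) = n" "w \<in> words BX" "freely_reduced w" "w \<noteq> []"
        "fst (hd w) = x (fst (hd ps) - n)" "snd (hd qs) = word_val G (\<lambda>b. b) w"
        using qs(5) by auto
      obtain i' a' ps' where ps': "ps = (i', a') # ps'" using True by (cases ps) auto
      obtain b qs' where qs': "qs = (n, b) # qs'" using qs(4) True w(1) by (cases qs) auto
      have i': "i' < n + k" "\<not> i' < n" "i' \<noteq> i" using Cons.prems True by (auto simp: ps' p)
      \<comment> \<open>Neighbouring cyclic syllables have different indices, hence different basis
        elements, and prefixing the power keeps the run reduced.\<close>
      then have ne: "x (i' - n) \<noteq> x j" using inj_onD[OF inj_x, of "i' - n" j] j by auto
      let ?w = "replicate m (x j, e) @ w"
      have fr: "freely_reduced ?w"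
        using w ne by (intro freely_reduced_replicate_append) (auto simp: ps')
      have ww: "?w \<in> words BX" using rep w by simp
      have v: "word_val G (\<lambda>b. b) ?w = a \<otimes> b"
        using word_val_append[OF X_closed(2) rep w(2)] me w(6) by (simp add: qs')
      have aF: "a \<otimes> b \<in> F"
        using v ww word_val_in_subgroup[OF subgroup_F, of "\<lambda>b. b" BX] X_F by (metis image_ident)
      have a1: "a \<otimes> b \<noteq> \<one>" using reduced_word_nontrivial[OF ww _ fr] v me by simp
      have b: "b \<in> carrier G" "set (map snd qs') \<subseteq> carrier G" using qc by (auto simp: qs')
      then show ?thesis using qs v i me ww fr aF a1 j
        by (intro exI[of _ "(n, a \<otimes> b) # qs'"])
           (auto simp: p qs' m_assoc intro!: bexI[of _ ?w] simp flip: qs(3))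
    qed
  qed
qed simp

lemma generate_A_F: "generate G ((\<Union>i<n. A i) \<union> BX) = carrier G"
proof -
  have sub: "(\<Union>i<n. A i) \<union> BX \<subseteq> carrier G" by auto
  have "(\<Union>i\<le>n. if i < n then A i else F) \<subseteq> generate G ((\<Union>i<n. A i) \<union> BX)"
  proof -
    have "F \<subseteq> generate G ((\<Union>i<n. A i) \<union> BX)"
      unfolding F_eq by (rule mono_generate) auto
    moreover have "A i \<subseteq> generate G ((\<Union>i<n. A i) \<union> BX)" if "i < n" for i
      using that by (auto intro: generate.incl)
    ultimately show ?thesis by (auto split: if_splits)
  qed
  then have "carrier G \<subseteq> generate G ((\<Union>i<n. A i) \<union> BX)"
    using fp[unfolded free_product_def, THEN conjunct2, THEN conjunct1]
      generate_subgroup_incl[OF _ generate_is_subgroup[OF sub]] by blast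
  then show ?thesis using generate_in_carrier[OF sub] by blast
qed

text \<open>Collecting the runs of cyclic syllables turns a reduced product for the fine
  decomposition into one for the given decomposition, which is nontrivial.\<close>

lemma free_product_factors: "free_product G {..<n + k} A"
  unfolding free_product_def
proof (intro conjI ballI allI impI)
  show "subgroup (A i) G" if "i \<in> {..<n + k}" for i using that subgroup_A by simp
  have sub: "(\<Union>i<n + k. A i) \<subseteq> carrier G" by auto
  have "(\<Union>i<n. A i) \<union> BX \<subseteq> (\<Union>i<n + k. A i)"
    using x_A by (fastforce intro: trans_less_add1)
  then have "carrier G \<subseteq> generate G (\<Union>i<n + k. A i)"
    using mono_generate generate_A_F by metis
  then show "generate G (\<Union>i<n + k. A i) = carrier G" using generate_in_carrier[OF sub] by blast
next
  fix ps :: "(nat \<times> 'a) list"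
  assume ps: "ps \<noteq> [] \<and> (\<forall>(i, h)\<in>set ps. i \<in> {..<n + k} \<and> h \<in> A i \<and> h \<noteq> \<one>) \<and> distinct_adj (map fst ps)"
  then have "\<exists>qs. qs \<noteq> [] \<and>
     (\<forall>(i, a)\<in>set qs. i \<le> n \<and> a \<in> (if i < n then A i else F) \<and> a \<noteq> \<one>) \<and>
     distinct_adj (map fst qs) \<and> lprod (map snd qs) = lprod (map snd ps)"
    using collect_syllables[of ps] by auto
  then show "foldr (\<otimes>) (map snd ps) \<one> \<noteq> \<one>"
    using fp unfolding free_product_def lprod_def by fastforce
qed

section \<open>Induction over the factors and homomorphisms out of G\<close>

lemma factors_induct [consumes 1, case_names one factor basis]:
  assumes "g \<in> carrier G" "P \<one>"
    and "\<And>i a g. i < n \<Longrightarrow> a \<in> A i \<Longrightarrow> g \<in> carrier G \<Longrightarrow> P g \<Longrightarrow> P (a \<otimes> g)"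
    and "\<And>j g y. j < k \<Longrightarrow> y = x j \<or> y = inv (x j) \<Longrightarrow> g \<in> carrier G \<Longrightarrow> P g \<Longrightarrow> P (y \<otimes> g)"
  shows "P g"
proof -
  have "g \<in> generate G ((\<Union>i<n. A i) \<union> BX)" unfolding generate_A_F by (rule assms(1))
  moreover have "(\<Union>i<n. A i) \<union> BX \<subseteq> carrier G" by auto
  ultimately show ?thesis
  proof (induction rule: generate_induct_left)
    case (left s g)
    consider i where "i < n" "s \<in> A i" | j where "j < k" "s = x j \<or> s = inv (x j)"
    proof -
      have "s \<in> A i" if "i < n" "t \<in> A i" "s = t \<or> s = inv t" for i t using that by auto
      then show ?thesis using left(1) that by blast
    qed
    then show ?case using assms(3,4) left(2,3) by cases auto
  qed (rule assms(2))
qed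

lemma hom_eqI:
  assumes "group K" "\<phi> \<in> hom G K" "\<psi> \<in> hom G K"
    and "\<And>i a. i < n \<Longrightarrow> a \<in> A i \<Longrightarrow> \<phi> a = \<psi> a" "\<And>j. j < k \<Longrightarrow> \<phi> (x j) = \<psi> (x j)"
    and "g \<in> carrier G"
  shows "\<phi> g = \<psi> g"
proof -
  interpret p: group_hom G K \<phi> using assms(1,2) by (simp add: group_hom_def group_hom_axioms_def is_group)
  interpret q: group_hom G K \<psi> using assms(1,3) by (simp add: group_hom_def group_hom_axioms_def is_group)
  show ?thesis using assms(6)
  proof (induction rule: factors_induct)
    case (factor i a g)
    then show ?case using assms(4) by simp
  next
    case (basis j g y)
    then show ?case using assms(5) by auto
  qed simp
qed

text \<open>The basis can be mapped arbitrarily because x j has infinite order: the exponent of an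
  element of \<open>A (n + j)\<close> is well defined, and raising \<open>u j\<close> to it is a
  homomorphism.\<close>

lemma hom_extension:
  assumes "group K" "\<And>i. i < n \<Longrightarrow> h i \<in> hom (G\<lparr>carrier := A i\<rparr>) K" "\<And>j. j < k \<Longrightarrow> u j \<in> carrier K"
  shows "\<exists>\<phi>\<in>hom G K. (\<forall>i<n. \<forall>a\<in>A i. \<phi> a = h i a) \<and> (\<forall>j<k. \<phi> (x j) = u j)"
proof -
  interpret K: group K by fact
  define ex where "ex j a = (THE z::int. x j [^] z = a)" for j a
  have ex: "ex j (x j [^] z) = z" if "j < k" for j and z :: int
    unfolding ex_def
  proof (rule the_equality)
    fix z' :: int assume "x j [^] z' = x j [^] z"
    then have "x j [^] (z' - z) = \<one>" using that by (simp add: int_pow_diff)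
    then show "z' = z" using x_pow_eq_one[OF that] by simp
  qed simp
  define h' where "h' i = (if i < n then h i else (\<lambda>a. u (i - n) [^]\<^bsub>K\<^esub> ex (i - n) a))" for i
  have "h' i \<in> hom (G\<lparr>carrier := A i\<rparr>) K" if "i \<in> {..<n + k}" for i
  proof (cases "i < n")
    case False
    define j where "j = i - n"
    have j: "i = n + j" "j < k" using False that by (auto simp: j_def)
    show ?thesis
    proof (rule homI)
      fix a assume "a \<in> carrier (G\<lparr>carrier := A i\<rparr>)"
      then show "h' i a \<in> carrier K" using False j assms(3) by (simp add: h'_def)
    next
      fix a b assume "a \<in> carrier (G\<lparr>carrier := A i\<rparr>)" "b \<in> carrier (G\<lparr>carrier := A i\<rparr>)"
      then obtain p q :: int where pq: "a = x j [^] p" "b = x j [^] q"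
        using A_cyclic_pow j by auto
      then have "a \<otimes> b = x j [^] (p + q)" using j by (simp add: int_pow_mult)
      then show "h' i (a \<otimes>\<^bsub>G\<lparr>carrier := A i\<rparr>\<^esub> b) = h' i a \<otimes>\<^bsub>K\<^esub> h' i b"
        using False j pq assms(3) ex by (simp add: h'_def K.int_pow_mult)
    qed
  qed (simp add: h'_def assms)
  then obtain \<phi> where phi: "\<phi> \<in> hom G K" "\<forall>i\<in>{..<n + k}. \<forall>a\<in>A i. \<phi> a = h' i a"
    using free_product_hom_extension[OF free_product_factors \<open>group K\<close>, of h'] by blast
  have "\<phi> (x j) = u j" if "j < k" for j
  proof -
    have "\<phi> (x j) = u j [^]\<^bsub>K\<^esub> ex j (x j)"
      using phi(2)[rule_format, of "n + j" "x j"] that x_A[OF that] by (simp add: h'_def)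
    also have "ex j (x j) = 1" using ex[OF that, of 1] that by (simp add: int_pow_1)
    finally show ?thesis using that assms(3) by (simp add: K.int_pow_1)
  qed
  moreover have "\<phi> a = h i a" if "i < n" "a \<in> A i" for i a
    using phi(2)[rule_format, of i a] that by (simp add: h'_def)
  ultimately show ?thesis using phi(1) by blast
qed

end

section \<open>Partial conjugations and transvections\<close>

lemma (in group) hom_eq_on_generate:
  assumes "group K" "\<phi> \<in> hom G K" "\<psi> \<in> hom G K" "S \<subseteq> carrier G"
    and "\<And>s. s \<in> S \<Longrightarrow> \<phi> s = \<psi> s" "g \<in> generate G S"
  shows "\<phi> g = \<psi> g"
proof -
  interpret p: group_hom G K \<phi> using assms(1,2) by (simp add: group_hom_def group_hom_axioms_def is_group)
  interpret q: group_hom G K \<psi> using assms(1,3) by (simp add: group_hom_def group_hom_axioms_def is_group)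
  show ?thesis using assms(6)
  proof (induction rule: generate.induct)
    case (inv h)
    then show ?case using assms(4,5) by (auto simp: subset_iff)
  next
    case (eng h1 h2)
    then show ?case using generate_in_carrier[OF assms(4)] by simp
  qed (use assms(5) in auto)
qed

text \<open>The disjunction admits antihomomorphisms: left transvections compose in the opposite
  order of their multipliers.\<close>

lemma (in group) multiplicative_image_generate:
  assumes "group K" "subgroup H G" "S \<subseteq> H" "\<And>g. g \<in> H \<Longrightarrow> f g \<in> carrier K"
    and mult: "\<And>g h. g \<in> H \<Longrightarrow> h \<in> H \<Longrightarrow>
       f (g \<otimes> h) = f g \<otimes>\<^bsub>K\<^esub> f h \<or> f (g \<otimes> h) = f h \<otimes>\<^bsub>K\<^esub> f g"
    and "g \<in> generate G S"
  shows "f g \<in> generate K (f ` S)"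
proof -
  interpret K: group K by fact
  have one: "f \<one> = \<one>\<^bsub>K\<^esub>"
    using mult[of \<one> \<one>] assms(4)[of \<one>] subgroup.one_closed[OF assms(2)] by auto
  have S: "S \<subseteq> carrier G" using assms(2,3) subgroup.subset by blast
  have sub: "g \<in> H" if "g \<in> generate G S" for g
    using that generate_subgroup_incl[OF assms(3,2)] by auto
  show ?thesis using assms(6)
  proof (induction rule: generate.induct)
    case one
    show ?case unfolding \<open>f \<one> = _\<close> by (rule generate.one)
  next
    case (incl h)
    then show ?case by (intro generate.incl) auto
  next
    case (inv h)
    then have h: "h \<in> H" "inv h \<in> H" "h \<in> carrier G"
      using subgroup.m_inv_closed[OF assms(2)] assms(3) S by blast+
    have "f (inv h) = inv\<^bsub>K\<^esub> (f h)"
    proof -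
      have "f (inv h) \<otimes>\<^bsub>K\<^esub> f h = \<one>\<^bsub>K\<^esub>"
      proof -
        have "f (inv h \<otimes> h) = \<one>\<^bsub>K\<^esub>" using h(3) one by simp
        then show ?thesis using mult[OF h(2,1)] K.inv_comm assms(4)[OF h(1)] assms(4)[OF h(2)] by metis
      qed
      then show ?thesis using K.inv_equality assms(4)[OF h(1)] assms(4)[OF h(2)] by metis
    qed
    then show ?case using inv by (simp add: generate.inv)
  next
    case (eng h1 h2)
    then show ?case using mult[OF sub sub, of h1 h2] generate.eng by metis
  qed
qed

context free_product_data
begin

lemma factor_hom_eqI:
  assumes "group K" "\<phi> \<in> hom G K" "\<psi> \<in> hom G K"
    and "\<And>i a. i < n + k \<Longrightarrow> a \<in> A i \<Longrightarrow> \<phi> a = \<psi> a" and "g \<in> carrier G"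
  shows "\<phi> g = \<psi> g"
proof (rule hom_eqI[OF assms(1-3) _ _ assms(5)])
  show "\<phi> a = \<psi> a" if "i < n" "a \<in> A i" for i a using assms(4)[of i a] that by simp
  show "\<phi> (x j) = \<psi> (x j)" if "j < k" for j using assms(4)[OF _ x_A[OF that]] that by simp
qed

lemma factor_hom_extension:
  assumes "group K" "\<And>i. i < n + k \<Longrightarrow> h i \<in> hom (G\<lparr>carrier := A i\<rparr>) K"
  shows "\<exists>\<phi>\<in>hom G K. \<forall>i<n + k. \<forall>a\<in>A i. \<phi> a = h i a"
  using free_product_hom_extension[OF free_product_factors assms(1), of h] assms(2) by auto

lemma hom_fixes_cyclic:
  assumes "\<phi> \<in> hom G G" "j < k" "\<phi> (x j) = x j" "a \<in> A (n + j)"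
  shows "\<phi> a = a"
proof -
  have "(\<lambda>a. a) \<in> hom G G" by (simp add: hom_def)
  from hom_eq_on_generate[OF group_axioms assms(1) this, of "{x j}" a] show ?thesis
    using assms A_cyclic by auto
qed

lemma auto_hom: "\<phi> \<in> auto G \<Longrightarrow> \<phi> \<in> hom G G"
  by (simp add: auto_def)

lemma auto_closed: "\<phi> \<in> auto G \<Longrightarrow> g \<in> carrier G \<Longrightarrow> \<phi> g \<in> carrier G"
  by (auto simp: auto_def hom_def)

lemma auto_eqI:
  assumes "\<phi> \<in> auto G" "\<psi> \<in> auto G"
    and "\<And>i a. i < n + k \<Longrightarrow> a \<in> A i \<Longrightarrow> \<phi> a = \<psi> a"
  shows "\<phi> = \<psi>"
proof (rule extensionalityI)
  show "\<phi> \<in> extensional (carrier G)" "\<psi> \<in> extensional (carrier G)"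
    using assms by (auto simp: auto_def Bij_def)
qed (rule factor_hom_eqI[OF group_axioms auto_hom[OF assms(1)] auto_hom[OF assms(2)] assms(3)])

text \<open>Two homomorphisms that are inverse on the factors are inverse on G. Members of
  \<open>auto G\<close> are extensional, hence the restriction.\<close>

lemma restrict_autoI:
  assumes "\<phi> \<in> hom G G" "\<psi> \<in> hom G G"
    and "\<And>i a. i < n + k \<Longrightarrow> a \<in> A i \<Longrightarrow> \<phi> (\<psi> a) = a"
    and "\<And>i a. i < n + k \<Longrightarrow> a \<in> A i \<Longrightarrow> \<psi> (\<phi> a) = a"
  shows "restrict \<phi> (carrier G) \<in> auto G"
proof -
  have id: "(\<lambda>a. a) \<in> hom G G" by (simp add: hom_def)
  have c: "(\<lambda>a. \<phi> (\<psi> a)) \<in> hom G G" "(\<lambda>a. \<psi> (\<phi> a)) \<in> hom G G"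
    using assms(1,2) by (auto simp: hom_def Pi_iff)
  have "bij_betw \<phi> (carrier G) (carrier G)"
  proof (rule bij_betw_byWitness[where f' = \<psi>])
    show "\<forall>a\<in>carrier G. \<psi> (\<phi> a) = a"
      by (intro ballI factor_hom_eqI[OF group_axioms c(2) id assms(4)])
    show "\<forall>a\<in>carrier G. \<phi> (\<psi> a) = a"
      by (intro ballI factor_hom_eqI[OF group_axioms c(1) id assms(3)])
  qed (use assms(1,2) in \<open>auto simp: hom_def\<close>)
  then have "bij_betw (restrict \<phi> (carrier G)) (carrier G) (carrier G)"
    by (rule iffD1[OF bij_betw_cong, rotated]) simp
  then show ?thesis using assms(1) by (auto simp: auto_def Bij_def hom_def)
qed

abbreviation pconj :: "'a \<Rightarrow> nat \<Rightarrow> 'a \<Rightarrow> 'a" where "pconj g j \<equiv> partial_conj G (n + k) A g j"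
abbreviation ltrans :: "'a \<Rightarrow> nat \<Rightarrow> 'a \<Rightarrow> 'a" where "ltrans g j \<equiv> left_transvection G n k A x g j"
abbreviation rtrans :: "'a \<Rightarrow> nat \<Rightarrow> 'a \<Rightarrow> 'a" where "rtrans g j \<equiv> right_transvection G n k A x g j"

lemma pconj_ex:
  assumes "i < n + k" "j < n + k" "i \<noteq> j" "g \<in> A i"
  shows "\<exists>\<phi>. \<phi> \<in> auto G \<and> (\<forall>h\<in>A j. \<phi> h = inv g \<otimes> h \<otimes> g) \<and> (\<forall>l<n + k. l \<noteq> j \<longrightarrow> (\<forall>h\<in>A l. \<phi> h = h))"
proof -
  have g: "g \<in> carrier G" using assms A_closed by blast
  have ex: "\<exists>\<phi>\<in>hom G G. (\<forall>h\<in>A j. \<phi> h = inv g \<otimes> h \<otimes> g) \<and> (\<forall>l<n + k. l \<noteq> j \<longrightarrow> (\<forall>h\<in>A l. \<phi> h = h))"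
    if g: "g \<in> carrier G" for g
  proof -
    have "\<exists>\<phi>\<in>hom G G. \<forall>l<n + k. \<forall>a\<in>A l. \<phi> a = (if l = j then inv g \<otimes> a \<otimes> g else a)"
    proof (rule factor_hom_extension[OF group_axioms])
      fix l assume "l < n + k"
      then show "(\<lambda>a. if l = j then inv g \<otimes> a \<otimes> g else a) \<in> hom (G\<lparr>carrier := A l\<rparr>) G"
        using g by (auto simp: hom_def m_assoc A_closed)
    qed
    then obtain \<phi> where "\<phi> \<in> hom G G"
      "\<forall>l<n + k. \<forall>a\<in>A l. \<phi> a = (if l = j then inv g \<otimes> a \<otimes> g else a)" by blast
    then show ?thesis using assms(2) by (intro bexI[of _ \<phi>]) auto
  qed
  obtain \<phi> where p: "\<phi> \<in> hom G G" "\<forall>h\<in>A j. \<phi> h = inv g \<otimes> h \<otimes> g"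
    "\<forall>l<n + k. l \<noteq> j \<longrightarrow> (\<forall>h\<in>A l. \<phi> h = h)" using ex[OF g] by blast
  obtain \<psi> where q: "\<psi> \<in> hom G G" "\<forall>h\<in>A j. \<psi> h = inv (inv g) \<otimes> h \<otimes> inv g"
    "\<forall>l<n + k. l \<noteq> j \<longrightarrow> (\<forall>h\<in>A l. \<psi> h = h)" using ex[of "inv g"] g by blast
  interpret p: group_hom G G \<phi> using p by (simp add: group_hom_def group_hom_axioms_def is_group)
  interpret q: group_hom G G \<psi> using q by (simp add: group_hom_def group_hom_axioms_def is_group)
  \<comment> \<open>As \<open>g\<close> lies in a factor other than the conjugated one, both maps
    fix it, and so conjugation by \<open>g\<close> and by its inverse undo each other.\<close>
  have pg: "\<phi> g = g" "\<psi> g = g" using p(3) q(3) assms by auto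
  have "restrict \<phi> (carrier G) \<in> auto G"
  proof (rule restrict_autoI[OF p(1) q(1)])
    fix l a assume l: "l < n + k" "a \<in> A l"
    have a: "a \<in> carrier G" using A_closed l by blast
    show "\<phi> (\<psi> a) = a" using l a p(2,3) q(2,3) pg g by (cases "l = j") (auto simp: m_assoc)
    show "\<psi> (\<phi> a) = a" using l a p(2,3) q(2,3) pg g by (cases "l = j") (auto simp: m_assoc)
  qed
  then show ?thesis using p(2,3) assms(2)
    by (intro exI[of _ "restrict \<phi> (carrier G)"]) (auto simp: A_closed)
qed

text \<open>Existence and uniqueness make the definite description usable through its defining
  properties; the transvections are treated alike.\<close>

lemma pconj:
  assumes "i < n + k" "j < n + k" "i \<noteq> j" "g \<in> A i"
  shows "pconj g j \<in> auto G" "\<And>h. h \<in> A j \<Longrightarrow> pconj g j h = inv g \<otimes> h \<otimes> g"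
    "\<And>l h. l < n + k \<Longrightarrow> l \<noteq> j \<Longrightarrow> h \<in> A l \<Longrightarrow> pconj g j h = h"
proof -
  let ?P = "\<lambda>\<phi>. \<phi> \<in> auto G \<and> (\<forall>h\<in>A j. \<phi> h = inv g \<otimes> h \<otimes> g) \<and> (\<forall>l<n + k. l \<noteq> j \<longrightarrow> (\<forall>h\<in>A l. \<phi> h = h))"
  have "\<exists>!\<phi>. ?P \<phi>"
  proof (rule ex_ex1I)
    show "\<exists>\<phi>. ?P \<phi>" by (rule pconj_ex[OF assms])
    fix \<phi> \<psi> assume "?P \<phi>" "?P \<psi>"
    then show "\<phi> = \<psi>" by (intro auto_eqI) metis+
  qed
  from theI'[OF this] have "?P (pconj g j)" unfolding partial_conj_def .
  then show "pconj g j \<in> auto G" "\<And>h. h \<in> A j \<Longrightarrow> pconj g j h = inv g \<otimes> h \<otimes> g"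
    "\<And>l h. l < n + k \<Longrightarrow> l \<noteq> j \<Longrightarrow> h \<in> A l \<Longrightarrow> pconj g j h = h" by auto
qed

text \<open>Left and right transvections at once.\<close>

lemma transvection_ex:
  assumes "i < n + k" "j < k" "i \<noteq> n + j" "a \<in> A i" "b \<in> A i"
  shows "\<exists>\<phi>. \<phi> \<in> auto G \<and> \<phi> (x j) = a \<otimes> x j \<otimes> b \<and> (\<forall>l<n + k. l \<noteq> n + j \<longrightarrow> (\<forall>h\<in>A l. \<phi> h = h))"
proof -
  have ab: "a \<in> carrier G" "b \<in> carrier G" using assms A_closed by blast+
  have ex: "\<exists>\<phi>\<in>hom G G. \<phi> (x j) = a \<otimes> x j \<otimes> b \<and> (\<forall>l<n + k. l \<noteq> n + j \<longrightarrow> (\<forall>h\<in>A l. \<phi> h = h))"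
    if ab: "a \<in> carrier G" "b \<in> carrier G" for a b
  proof -
    have "\<exists>\<phi>\<in>hom G G. (\<forall>i<n. \<forall>c\<in>A i. \<phi> c = c) \<and>
        (\<forall>l<k. \<phi> (x l) = (if l = j then a \<otimes> x j \<otimes> b else x l))"
      by (rule hom_extension[OF group_axioms]) (use ab assms(2) in \<open>auto simp: hom_def A_closed\<close>)
    then obtain \<phi> where p: "\<phi> \<in> hom G G" "\<forall>i<n. \<forall>c\<in>A i. \<phi> c = c"
      "\<forall>l<k. \<phi> (x l) = (if l = j then a \<otimes> x j \<otimes> b else x l)" by blast
    have "\<phi> h = h" if "l < n + k" "l \<noteq> n + j" "h \<in> A l" for l h
    proof (cases "l < n")
      case False
      then have "n + (l - n) = l" "l - n < k" "l - n \<noteq> j" using that by auto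
      then show ?thesis using hom_fixes_cyclic[OF p(1), of "l - n" h] p(3) that(3) by simp
    qed (use p(2) that in auto)
    then show ?thesis using p assms(2) by (intro bexI[of _ \<phi>]) auto
  qed
  obtain \<phi> where p: "\<phi> \<in> hom G G" "\<phi> (x j) = a \<otimes> x j \<otimes> b"
    "\<forall>l<n + k. l \<noteq> n + j \<longrightarrow> (\<forall>h\<in>A l. \<phi> h = h)" using ex[OF ab] by blast
  obtain \<psi> where q: "\<psi> \<in> hom G G" "\<psi> (x j) = inv a \<otimes> x j \<otimes> inv b"
    "\<forall>l<n + k. l \<noteq> n + j \<longrightarrow> (\<forall>h\<in>A l. \<psi> h = h)" using ex[of "inv a" "inv b"] ab by auto
  interpret p: group_hom G G \<phi> using p by (simp add: group_hom_def group_hom_axioms_def is_group)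
  interpret q: group_hom G G \<psi> using q by (simp add: group_hom_def group_hom_axioms_def is_group)
  have pab: "\<phi> a = a" "\<psi> a = a" "\<phi> b = b" "\<psi> b = b" using p(3) q(3) assms by auto
  have c: "(\<lambda>a. \<phi> (\<psi> a)) \<in> hom G G" "(\<lambda>a. \<psi> (\<phi> a)) \<in> hom G G"
    using p(1) q(1) by (auto simp: hom_def Pi_iff)
  have xj: "\<phi> (\<psi> (x j)) = x j" "\<psi> (\<phi> (x j)) = x j"
    using assms(2) ab by (simp_all add: p(2) q(2) pab m_assoc)
  have "restrict \<phi> (carrier G) \<in> auto G"
  proof (rule restrict_autoI[OF p(1) q(1)])
    fix l h assume l: "l < n + k" "h \<in> A l"
    show "\<phi> (\<psi> h) = h"
      using l p(3) q(3) hom_fixes_cyclic[OF c(1) assms(2) xj(1)] by (cases "l = n + j") auto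
    show "\<psi> (\<phi> h) = h"
      using l p(3) q(3) hom_fixes_cyclic[OF c(2) assms(2) xj(2)] by (cases "l = n + j") auto
  qed
  then show ?thesis using p(2,3) assms(2)
    by (intro exI[of _ "restrict \<phi> (carrier G)"]) (auto simp: A_closed)
qed

lemma transvection_unique:
  assumes "j < k" "\<phi> \<in> auto G" "\<psi> \<in> auto G" "\<phi> (x j) = \<psi> (x j)"
    and "\<And>l h. l < n + k \<Longrightarrow> l \<noteq> n + j \<Longrightarrow> h \<in> A l \<Longrightarrow> \<phi> h = \<psi> h"
  shows "\<phi> = \<psi>"
proof (rule auto_eqI[OF assms(2,3)])
  fix l h assume l: "l < n + k" "h \<in> A l"
  show "\<phi> h = \<psi> h"
  proof (cases "l = n + j")
    case True
    then show ?thesis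
      using hom_eq_on_generate[OF group_axioms auto_hom[OF assms(2)] auto_hom[OF assms(3)], of "{x j}" h]
        assms(1,4) A_cyclic l by auto
  qed (use l assms(5) in auto)
qed

lemma ltrans:
  assumes "i < n + k" "j < k" "i \<noteq> n + j" "g \<in> A i"
  shows "ltrans g j \<in> auto G" "ltrans g j (x j) = g \<otimes> x j"
    "\<And>l h. l < n + k \<Longrightarrow> l \<noteq> n + j \<Longrightarrow> h \<in> A l \<Longrightarrow> ltrans g j h = h"
proof -
  let ?P = "\<lambda>\<phi>. \<phi> \<in> auto G \<and> \<phi> (x j) = g \<otimes> x j \<and> (\<forall>l<n + k. l \<noteq> n + j \<longrightarrow> (\<forall>h\<in>A l. \<phi> h = h))"
  have "\<exists>!\<phi>. ?P \<phi>"
  proof (rule ex_ex1I)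
    show "\<exists>\<phi>. ?P \<phi>" using transvection_ex[OF assms, of \<one>] assms A_closed[of g i] by simp
    fix \<phi> \<psi> assume "?P \<phi>" "?P \<psi>"
    then show "\<phi> = \<psi>" by (intro transvection_unique[OF assms(2)]) auto
  qed
  from theI'[OF this] have "?P (ltrans g j)" unfolding left_transvection_def .
  then show "ltrans g j \<in> auto G" "ltrans g j (x j) = g \<otimes> x j"
    "\<And>l h. l < n + k \<Longrightarrow> l \<noteq> n + j \<Longrightarrow> h \<in> A l \<Longrightarrow> ltrans g j h = h" by auto
qed

lemma rtrans:
  assumes "i < n + k" "j < k" "i \<noteq> n + j" "g \<in> A i"
  shows "rtrans g j \<in> auto G" "rtrans g j (x j) = x j \<otimes> g"
    "\<And>l h. l < n + k \<Longrightarrow> l \<noteq> n + j \<Longrightarrow> h \<in> A l \<Longrightarrow> rtrans g j h = h"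
proof -
  let ?P = "\<lambda>\<phi>. \<phi> \<in> auto G \<and> \<phi> (x j) = x j \<otimes> g \<and> (\<forall>l<n + k. l \<noteq> n + j \<longrightarrow> (\<forall>h\<in>A l. \<phi> h = h))"
  have "\<exists>!\<phi>. ?P \<phi>"
  proof (rule ex_ex1I)
    show "\<exists>\<phi>. ?P \<phi>" using transvection_ex[OF assms(1-3) _ assms(4), of \<one>] assms A_closed[of g i] by simp
    fix \<phi> \<psi> assume "?P \<phi>" "?P \<psi>"
    then show "\<phi> = \<psi>" by (intro transvection_unique[OF assms(2)]) auto
  qed
  from theI'[OF this] have "?P (rtrans g j)" unfolding right_transvection_def .
  then show "rtrans g j \<in> auto G" "rtrans g j (x j) = x j \<otimes> g"
    "\<And>l h. l < n + k \<Longrightarrow> l \<noteq> n + j \<Longrightarrow> h \<in> A l \<Longrightarrow> rtrans g j h = h" by auto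
qed

section \<open>The group generated by them\<close>

abbreviation "Aut \<equiv> AutoGroup G"
abbreviation "AutZ \<equiv> Aut0 G n k A x"

lemma Aut_group: "group Aut" by (rule AutoGroup)

lemma Aut_carrier [simp]: "carrier Aut = auto G"
  by (simp add: AutoGroup_def)

lemma Aut_mult: "\<phi> \<in> auto G \<Longrightarrow> \<psi> \<in> auto G \<Longrightarrow> \<phi> \<otimes>\<^bsub>Aut\<^esub> \<psi> = compose (carrier G) \<phi> \<psi>"
  by (simp add: AutoGroup_def BijGroup_def auto_def)

lemma Aut_mult_apply:
  "\<phi> \<in> auto G \<Longrightarrow> \<psi> \<in> auto G \<Longrightarrow> g \<in> carrier G \<Longrightarrow> (\<phi> \<otimes>\<^bsub>Aut\<^esub> \<psi>) g = \<phi> (\<psi> g)"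
  by (simp add: Aut_mult compose_eq)

lemma Aut_one: "\<one>\<^bsub>Aut\<^esub> = (\<lambda>g\<in>carrier G. g)"
  by (simp add: AutoGroup_def BijGroup_def)

lemma Aut_mult_closed: "\<phi> \<in> auto G \<Longrightarrow> \<psi> \<in> auto G \<Longrightarrow> \<phi> \<otimes>\<^bsub>Aut\<^esub> \<psi> \<in> auto G"
  using group.is_monoid[OF Aut_group] monoid.m_closed[of Aut \<phi> \<psi>] by simp

definition fr_gens :: "('a \<Rightarrow> 'a) set" where
  "fr_gens = {pconj g j |i j g. i < n + k \<and> j < n + k \<and> i \<noteq> j \<and> g \<in> A i} \<union>
      {ltrans g j |i j g. i < n + k \<and> j < k \<and> i \<noteq> n + j \<and> g \<in> A i} \<union>
      {rtrans g j |i j g. i < n + k \<and> j < k \<and> i \<noteq> n + j \<and> g \<in> A i}"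

lemma AutZ_eq: "AutZ = generate Aut fr_gens"
  by (simp add: Aut0_def fr_gens_def)

lemma fr_gens_auto: "fr_gens \<subseteq> auto G"
  unfolding fr_gens_def using pconj(1) ltrans(1) rtrans(1) by blast

lemma AutZ_auto: "AutZ \<subseteq> auto G"
  unfolding AutZ_eq using group.generate_in_carrier[OF Aut_group, of fr_gens] fr_gens_auto by auto

lemma AutZ_mult: "\<phi> \<in> AutZ \<Longrightarrow> \<psi> \<in> AutZ \<Longrightarrow> \<phi> \<otimes>\<^bsub>Aut\<^esub> \<psi> \<in> AutZ"
  unfolding AutZ_eq by (rule generate.eng)

lemma AutZ_one: "\<one>\<^bsub>Aut\<^esub> \<in> AutZ"
  unfolding AutZ_eq by (rule generate.one)

lemma AutZ_gens:
  assumes "i < n + k" "g \<in> A i"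
  shows "j < n + k \<Longrightarrow> i \<noteq> j \<Longrightarrow> pconj g j \<in> AutZ"
    "j < k \<Longrightarrow> i \<noteq> n + j \<Longrightarrow> ltrans g j \<in> AutZ"
    "j < k \<Longrightarrow> i \<noteq> n + j \<Longrightarrow> rtrans g j \<in> AutZ"
  unfolding AutZ_eq fr_gens_def using assms by (blast intro: generate.incl)+

text \<open>For a fixed target, each kind of generator depends on its multiplier by a homomorphism
  or antihomomorphism from the factor, so the chosen generators of the factors suffice.\<close>

lemma AutZ_generated:
  assumes gens: "\<And>i. i < n + k \<Longrightarrow> set (gens i) \<subseteq> A i \<and> generate G (set (gens i)) = A i"
    and "\<phi> \<in> AutZ"
  shows "\<phi> \<in> generate Aut (fr_val G n k A x gens ` fr_letters n k gens)"
proof -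
  let ?L = "fr_val G n k A x gens ` fr_letters n k gens"
  have "pconj g j \<in> generate Aut ?L" if "i < n + k" "j < n + k" "i \<noteq> j" "g \<in> A i" for i j g
  proof -
    have "(\<lambda>g. pconj g j) g \<in> generate Aut ((\<lambda>g. pconj g j) ` set (gens i))"
    proof (rule multiplicative_image_generate[OF Aut_group subgroup_A[OF that(1)]])
      fix a b assume ab: "a \<in> A i" "b \<in> A i"
      have c: "a \<in> carrier G" "b \<in> carrier G" using ab that A_closed by blast+
      have a: "pconj a j \<in> auto G" "pconj b j \<in> auto G" using pconj(1)[OF that(1-3)] ab by auto
      interpret p: group_hom G G "pconj a j"
        using auto_hom[OF a(1)] by (simp add: group_hom_def group_hom_axioms_def is_group)
      have "pconj (a \<otimes> b) j = pconj a j \<otimes>\<^bsub>Aut\<^esub> pconj b j"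
      proof (rule auto_eqI)
        show "pconj (a \<otimes> b) j \<in> auto G" using pconj(1)[OF that(1-3)] ab that(1) by simp
        show "pconj a j \<otimes>\<^bsub>Aut\<^esub> pconj b j \<in> auto G" by (rule Aut_mult_closed[OF a])
        fix l h assume l: "l < n + k" "h \<in> A l"
        then have h: "h \<in> carrier G" by simp
        show "pconj (a \<otimes> b) j h = (pconj a j \<otimes>\<^bsub>Aut\<^esub> pconj b j) h"
          using pconj(2,3)[OF that(1-3)] ab that l h c
          by (cases "l = j") (simp_all add: Aut_mult_apply[OF a] m_assoc inv_mult_group)
      qed
      then show "pconj (a \<otimes> b) j = pconj a j \<otimes>\<^bsub>Aut\<^esub> pconj b j \<or>
          pconj (a \<otimes> b) j = pconj b j \<otimes>\<^bsub>Aut\<^esub> pconj a j" ..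
    qed (use that gens[OF that(1)] pconj(1)[OF that(1-3)] in auto)
    moreover have "(\<lambda>g. pconj g j) ` set (gens i) \<subseteq> ?L"
    proof (rule image_subsetI)
      fix g assume "g \<in> set (gens i)"
      then obtain m where m: "m < length (gens i)" "g = gens i ! m" by (auto simp: in_set_conv_nth)
      have "PConj i m j \<in> fr_letters n k gens" using that m by (simp add: fr_letters_def)
      then show "pconj g j \<in> ?L" using m by (intro image_eqI[of _ _ "PConj i m j"]) simp_all
    qed
    ultimately show ?thesis using group.mono_generate[OF Aut_group] subsetD by metis
  qed
  moreover have "ltrans g j \<in> generate Aut ?L" if "i < n + k" "j < k" "i \<noteq> n + j" "g \<in> A i" for i j g
  proof -
    have "(\<lambda>g. ltrans g j) g \<in> generate Aut ((\<lambda>g. ltrans g j) ` set (gens i))"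
    proof (rule multiplicative_image_generate[OF Aut_group subgroup_A[OF that(1)]])
      fix a b assume ab: "a \<in> A i" "b \<in> A i"
      have c: "a \<in> carrier G" "b \<in> carrier G" using ab that A_closed by blast+
      have a: "ltrans a j \<in> auto G" "ltrans b j \<in> auto G" using ltrans(1)[OF that(1-3)] ab by auto
      interpret p: group_hom G G "ltrans b j"
        using auto_hom[OF a(2)] by (simp add: group_hom_def group_hom_axioms_def is_group)
      have "ltrans (a \<otimes> b) j = ltrans b j \<otimes>\<^bsub>Aut\<^esub> ltrans a j"
      proof (rule transvection_unique[OF that(2)])
        show "ltrans (a \<otimes> b) j \<in> auto G" using ltrans(1)[OF that(1-3)] ab that(1) by simp
        show "ltrans b j \<otimes>\<^bsub>Aut\<^esub> ltrans a j \<in> auto G" by (rule Aut_mult_closed[OF a(2,1)])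
        show "ltrans (a \<otimes> b) j (x j) = (ltrans b j \<otimes>\<^bsub>Aut\<^esub> ltrans a j) (x j)"
          using ltrans(2,3)[OF that(1-3)] ab that c by (simp add: Aut_mult_apply[OF a(2,1)] m_assoc)
        fix l h assume l: "l < n + k" "l \<noteq> n + j" "h \<in> A l"
        then have h: "h \<in> carrier G" by simp
        show "ltrans (a \<otimes> b) j h = (ltrans b j \<otimes>\<^bsub>Aut\<^esub> ltrans a j) h"
          using ltrans(3)[OF that(1-3)] ab that l h by (simp add: Aut_mult_apply[OF a(2,1)])
      qed
      then show "ltrans (a \<otimes> b) j = ltrans a j \<otimes>\<^bsub>Aut\<^esub> ltrans b j \<or>
          ltrans (a \<otimes> b) j = ltrans b j \<otimes>\<^bsub>Aut\<^esub> ltrans a j" ..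
    qed (use that gens[OF that(1)] ltrans(1)[OF that(1-3)] in auto)
    moreover have "(\<lambda>g. ltrans g j) ` set (gens i) \<subseteq> ?L"
    proof (rule image_subsetI)
      fix g assume "g \<in> set (gens i)"
      then obtain m where m: "m < length (gens i)" "g = gens i ! m" by (auto simp: in_set_conv_nth)
      have "LTrans i m j \<in> fr_letters n k gens" using that m by (simp add: fr_letters_def)
      then show "ltrans g j \<in> ?L" using m by (intro image_eqI[of _ _ "LTrans i m j"]) simp_all
    qed
    ultimately show ?thesis using group.mono_generate[OF Aut_group] subsetD by metis
  qed
  moreover have "rtrans g j \<in> generate Aut ?L" if "i < n + k" "j < k" "i \<noteq> n + j" "g \<in> A i" for i j g
  proof -
    have "(\<lambda>g. rtrans g j) g \<in> generate Aut ((\<lambda>g. rtrans g j) ` set (gens i))"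
    proof (rule multiplicative_image_generate[OF Aut_group subgroup_A[OF that(1)]])
      fix a b assume ab: "a \<in> A i" "b \<in> A i"
      have c: "a \<in> carrier G" "b \<in> carrier G" using ab that A_closed by blast+
      have a: "rtrans a j \<in> auto G" "rtrans b j \<in> auto G" using rtrans(1)[OF that(1-3)] ab by auto
      interpret p: group_hom G G "rtrans a j"
        using auto_hom[OF a(1)] by (simp add: group_hom_def group_hom_axioms_def is_group)
      have "rtrans (a \<otimes> b) j = rtrans a j \<otimes>\<^bsub>Aut\<^esub> rtrans b j"
      proof (rule transvection_unique[OF that(2)])
        show "rtrans (a \<otimes> b) j \<in> auto G" using rtrans(1)[OF that(1-3)] ab that(1) by simp
        show "rtrans a j \<otimes>\<^bsub>Aut\<^esub> rtrans b j \<in> auto G" by (rule Aut_mult_closed[OF a])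
        show "rtrans (a \<otimes> b) j (x j) = (rtrans a j \<otimes>\<^bsub>Aut\<^esub> rtrans b j) (x j)"
          using rtrans(2,3)[OF that(1-3)] ab that c by (simp add: Aut_mult_apply[OF a] m_assoc)
        fix l h assume l: "l < n + k" "l \<noteq> n + j" "h \<in> A l"
        then have h: "h \<in> carrier G" by simp
        show "rtrans (a \<otimes> b) j h = (rtrans a j \<otimes>\<^bsub>Aut\<^esub> rtrans b j) h"
          using rtrans(3)[OF that(1-3)] ab that l h by (simp add: Aut_mult_apply[OF a])
      qed
      then show "rtrans (a \<otimes> b) j = rtrans a j \<otimes>\<^bsub>Aut\<^esub> rtrans b j \<or>
          rtrans (a \<otimes> b) j = rtrans b j \<otimes>\<^bsub>Aut\<^esub> rtrans a j" ..
    qed (use that gens[OF that(1)] rtrans(1)[OF that(1-3)] in auto)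
    moreover have "(\<lambda>g. rtrans g j) ` set (gens i) \<subseteq> ?L"
    proof (rule image_subsetI)
      fix g assume "g \<in> set (gens i)"
      then obtain m where m: "m < length (gens i)" "g = gens i ! m" by (auto simp: in_set_conv_nth)
      have "RTrans i m j \<in> fr_letters n k gens" using that m by (simp add: fr_letters_def)
      then show "rtrans g j \<in> ?L" using m by (intro image_eqI[of _ _ "RTrans i m j"]) simp_all
    qed
    ultimately show ?thesis using group.mono_generate[OF Aut_group] subsetD by metis
  qed
  ultimately have incl: "fr_gens \<subseteq> generate Aut ?L" unfolding fr_gens_def by blast
  have "subgroup (generate Aut ?L) Aut"
  proof (rule group.generate_is_subgroup[OF Aut_group])
    show "?L \<subseteq> carrier Aut"
    proof
      fix f assume "f \<in> ?L"
      then obtain l where l: "l \<in> fr_letters n k gens" "f = fr_val G n k A x gens l" by blast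
      have m: "gens i ! m \<in> A i" if "i < n + k" "m < length (gens i)" for i m
        using gens[OF that(1)] nth_mem[OF that(2)] by blast
      show "f \<in> carrier Aut"
      proof (cases l)
        case (PConj i m' j)
        then show ?thesis using l pconj(1)[of i j] m[of i m'] by (simp add: fr_letters_def)
      next
        case (LTrans i m' j)
        then show ?thesis using l ltrans(1)[of i j] m[of i m'] by (simp add: fr_letters_def)
      next
        case (RTrans i m' j)
        then show ?thesis using l rtrans(1)[of i j] m[of i m'] by (simp add: fr_letters_def)
      qed
    qed
  qed
  from group.generate_subgroup_incl[OF Aut_group incl this] assms(2) show ?thesis
    unfolding AutZ_eq by (rule subsetD)
qed

end

section \<open>Permutation actions with finite descriptions\<close>

text \<open>Finitely supported permutations will be given as lists of transpositions, a form that
  fits into a certificate. In \<open>swaps\<close> the last element of a list acts first.\<close>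

fun swp :: "nat \<times> nat \<Rightarrow> nat \<Rightarrow> nat" where
  "swp (p, q) z = (if z = p then q else if z = q then p else z)"

definition swaps :: "(nat \<times> nat) list \<Rightarrow> nat \<Rightarrow> nat" where
  "swaps L z = foldr swp L z"

lemma swaps_Nil [simp]: "swaps [] z = z"
  by (simp add: swaps_def)

lemma swaps_append: "swaps (L @ M) z = swaps L (swaps M z)"
  by (simp add: swaps_def)

lemma swaps_rev [simp]: "swaps L (swaps (rev L) z) = z" "swaps (rev L) (swaps L z) = z"
proof -
  show *: "swaps L (swaps (rev L) z) = z" for L z
    by (induction L arbitrary: z) (auto simp: swaps_append, simp add: swaps_def)
  show "swaps (rev L) (swaps L z) = z" using *[of "rev L" z] by simp
qed

lemma bij_swaps: "bij (swaps L)"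
  by (rule bij_betw_byWitness[where f' = "swaps (rev L)"]) auto

lemma ex_swaps:
  assumes "finite S" "inj_on f S" "inj_on g S"
  shows "\<exists>L. \<forall>s\<in>S. swaps L (f s) = g s"
  using assms
proof (induction S)
  case (insert s S)
  then obtain L where L: "\<forall>s\<in>S. swaps L (f s) = g s" by auto
  \<comment> \<open>The new transposition corrects the image of \<open>s\<close> and leaves the
    earlier images alone, since by injectivity they meet neither swapped point.\<close>
  let ?M = "(swaps L (f s), g s) # L"
  have "swaps ?M (f u) = g u" if "u \<in> insert s S" for u
  proof (cases "u = s")
    case False
    then have "u \<in> S" using that by simp
    moreover have "g u \<noteq> g s" "f u \<noteq> f s"
      using insert.prems insert.hyps \<open>u \<in> S\<close> by (auto simp: inj_on_def)
    then have "swaps L (f u) \<noteq> swaps L (f s)" using bij_is_inj[OF bij_swaps] by (metis injD)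
    ultimately show ?thesis using L \<open>g u \<noteq> g s\<close> by (simp add: swaps_def)
  qed (simp add: swaps_def)
  then show ?case by blast
qed simp

definition SymN :: "(nat \<Rightarrow> nat) monoid" where
  "SymN = \<lparr>carrier = {f. bij f}, monoid.mult = (\<circ>), one = id\<rparr>"

lemma group_SymN: "group SymN"
proof (rule groupI)
  fix f assume "f \<in> carrier SymN"
  then show "\<exists>g\<in>carrier SymN. g \<otimes>\<^bsub>SymN\<^esub> f = \<one>\<^bsub>SymN\<^esub>"
    by (intro bexI[of _ "inv_into UNIV f"]) (auto simp: SymN_def bij_imp_bij_inv bij_is_inj)
qed (auto simp: SymN_def bij_comp)

definition Z2 :: "bool monoid" where
  "Z2 = \<lparr>carrier = UNIV, monoid.mult = (\<noteq>), one = False\<rparr>"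

lemma group_Z2: "group Z2"
  by (rule groupI) (auto simp: Z2_def)

locale fr_data = free_product_data +
  fixes gens :: "nat \<Rightarrow> 'a list" and nfA :: "nat \<Rightarrow> 'a \<Rightarrow> nat word"
  assumes gens: "i < n + k \<Longrightarrow> set (gens i) \<subseteq> A i \<and> generate G (set (gens i)) = A i"
    and nfA: "i < n \<Longrightarrow> normal_form G (\<lambda>m. gens i ! m) {..<length (gens i)} (A i) (nfA i)"
begin

text \<open>The oracle returns exactly these numbers, so an element of \<open>A i\<close> is
  represented by the value that a query would give.\<close>

definition enc :: "nat \<Rightarrow> 'a \<Rightarrow> nat" where
  "enc i a = word_code (\<lambda>m. m) (nfA i a)"

definition dec :: "nat \<Rightarrow> nat \<Rightarrow> 'a" where
  "dec i = inv_into (A i) (enc i)"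

lemma word_code_inj: "inj c \<Longrightarrow> word_code c u = word_code c v \<Longrightarrow> u = v"
proof -
  assume c: "inj c" and eq: "word_code c u = word_code c v"
  have "inj (\<lambda>(a, e). prod_encode (c a, of_bool e))"
    using c by (auto simp: inj_def of_bool_def split: if_splits)
  then show "u = v" using eq list_encode_eq unfolding word_code_def by (metis inj_map_eq_map)
qed

lemma enc_inj: "i < n \<Longrightarrow> inj_on (enc i) (A i)"
proof (rule inj_onI)
  fix a b assume *: "i < n" "a \<in> A i" "b \<in> A i" "enc i a = enc i b"
  then have "nfA i a = nfA i b" using word_code_inj[of "\<lambda>m. m"] by (simp add: enc_def)
  then show "a = b" using nfA[OF *(1)] *(2,3) unfolding normal_form_def by metis
qed

lemma dec_enc [simp]: "i < n \<Longrightarrow> a \<in> A i \<Longrightarrow> dec i (enc i a) = a"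
  unfolding dec_def using enc_inj by simp

text \<open>A model action of \<open>A i\<close> on the natural numbers with infinitely many fixed points, the
  pairs \<open>(0, r)\<close>, and infinitely many regular orbits, one for every first component \<open>c > 0\<close>.\<close>

definition alpha :: "nat \<Rightarrow> 'a \<Rightarrow> nat \<Rightarrow> nat" where
  "alpha i a z = (if pfst z > 0 \<and> psnd z \<in> enc i ` A i
     then prod_encode (pfst z, enc i (dec i (psnd z) \<otimes> inv a)) else z)"

lemma alpha_enc:
  "i < n \<Longrightarrow> b \<in> A i \<Longrightarrow> alpha i a (prod_encode (Suc c, enc i b)) = prod_encode (Suc c, enc i (b \<otimes> inv a))"
  unfolding alpha_def by (simp add: imageI)

lemma alpha_zero [simp]: "alpha i a (prod_encode (0, r)) = prod_encode (0, r)"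
  by (simp add: alpha_def)

text \<open>Translation on the right by the inverse is what turns this into a left action.\<close>

lemma alpha_mult:
  assumes "i < n" "a \<in> A i" "b \<in> A i"
  shows "alpha i (a \<otimes> b) z = alpha i a (alpha i b z)"
proof (cases "pfst z > 0 \<and> psnd z \<in> enc i ` A i")
  case True
  then obtain d where d: "d \<in> A i" "psnd z = enc i d" by blast
  have "a \<in> carrier G" "b \<in> carrier G" "d \<in> carrier G" "d \<otimes> inv b \<in> A i" using assms d by auto
  then show ?thesis using True d assms by (simp add: alpha_def m_assoc inv_mult_group)
next
  case False
  then show ?thesis by (auto simp: alpha_def)
qed

lemma alpha_one: "i < n \<Longrightarrow> alpha i \<one> z = z"
proof (cases "pfst z > 0 \<and> psnd z \<in> enc i ` A i")
  case True
  assume i: "i < n"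
  obtain d where d: "d \<in> A i" "psnd z = enc i d" using True by blast
  have "d \<in> carrier G" using d i by simp
  then have "alpha i \<one> z = prod_encode (pfst z, psnd z)"
    using True d(1) i unfolding alpha_def d(2) by simp
  then show ?thesis by simp
qed (auto simp: alpha_def)

lemma bij_alpha: "i < n \<Longrightarrow> a \<in> A i \<Longrightarrow> bij (alpha i a)"
  by (rule bij_betw_byWitness[where f' = "alpha i (inv a)"])
     (auto simp: alpha_mult[symmetric] alpha_one)

definition is_act :: "(nat \<Rightarrow> (nat \<times> nat) list) \<Rightarrow> ('a \<Rightarrow> nat \<Rightarrow> nat) \<Rightarrow> bool" where
  "is_act L \<rho> \<longleftrightarrow> \<rho> \<in> hom G SymN \<and>
     (\<forall>i<n. \<forall>a\<in>A i. \<rho> a = (\<lambda>z. swaps (L i) (alpha i a (swaps (rev (L i)) z)))) \<and>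
     (\<forall>j<k. \<rho> (x j) = swaps (L (n + j)))"

definition act :: "(nat \<Rightarrow> (nat \<times> nat) list) \<Rightarrow> 'a \<Rightarrow> nat \<Rightarrow> nat" where
  "act L = (SOME \<rho>. is_act L \<rho>)"

lemma is_act: "is_act L (act L)"
proof -
  have "\<exists>\<rho>\<in>hom G SymN. (\<forall>i<n. \<forall>a\<in>A i. \<rho> a = (\<lambda>z. swaps (L i) (alpha i a (swaps (rev (L i)) z)))) \<and>
      (\<forall>j<k. \<rho> (x j) = swaps (L (n + j)))"
  proof (rule hom_extension[OF group_SymN])
    fix i assume i: "i < n"
    show "(\<lambda>a z. swaps (L i) (alpha i a (swaps (rev (L i)) z))) \<in> hom (G\<lparr>carrier := A i\<rparr>) SymN"
    proof (rule homI)
      fix a assume "a \<in> carrier (G\<lparr>carrier := A i\<rparr>)"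
      then have "bij (swaps (L i) \<circ> (alpha i a \<circ> swaps (rev (L i))))"
        using i by (intro bij_comp bij_swaps bij_alpha) auto
      then show "(\<lambda>z. swaps (L i) (alpha i a (swaps (rev (L i)) z))) \<in> carrier SymN"
        by (simp add: SymN_def comp_def)
    qed (use i in \<open>auto simp: SymN_def alpha_mult\<close>)
  qed (simp add: SymN_def bij_swaps)
  then have "\<exists>\<rho>. is_act L \<rho>" by (simp only: Bex_def is_act_def)
  then show ?thesis unfolding act_def by (rule someI_ex)
qed

lemma act_hom: "act L \<in> hom G SymN"
  using is_act by (simp add: is_act_def)

lemma act_mult [simp]:
  "g \<in> carrier G \<Longrightarrow> h \<in> carrier G \<Longrightarrow> act L (g \<otimes> h) z = act L g (act L h z)"
  using hom_mult[OF act_hom[of L], of g h] unfolding SymN_def by simp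

lemma act_one [simp]: "act L \<one> z = z"
  using hom_one[OF act_hom[of L] group_axioms group_SymN] by (simp add: SymN_def)

lemma act_inv [simp]:
  assumes "g \<in> carrier G"
  shows "act L g (act L (inv g) z) = z" "act L (inv g) (act L g z) = z"
  using assms act_mult[of g "inv g" L z] act_mult[of "inv g" g L z] by simp_all

lemma act_A: "i < n \<Longrightarrow> a \<in> A i \<Longrightarrow> act L a z = swaps (L i) (alpha i a (swaps (rev (L i)) z))"
  using is_act[of L] by (simp add: is_act_def)

lemma act_x: "j < k \<Longrightarrow> act L (x j) z = swaps (L (n + j)) z"
  using is_act[of L] by (simp add: is_act_def)

lemma act_fix_inv: "g \<in> carrier G \<Longrightarrow> act L g z = z \<Longrightarrow> act L (inv g) z = z"
  using act_inv(2)[of g L z] by simp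

text \<open>Here \<open>t i\<close> plays the role of the inverse of the i-th entry of the tuple, so
  the conjugates are those of \<open>conj_subgroup\<close>.\<close>

definition Neg :: "(nat \<Rightarrow> 'a) \<Rightarrow> (nat \<Rightarrow> 'a) \<Rightarrow> bool" where
  "Neg t y \<longleftrightarrow> (\<exists>L. (\<forall>i<n. \<forall>a\<in>A i. act L (t i \<otimes> a \<otimes> inv (t i)) 0 = 0) \<and>
     (\<forall>j<k. act L (y j) 0 = 0) \<and> (\<exists>g\<in>carrier G. act L g 0 \<noteq> 0))"

section \<open>Parity homomorphisms\<close>

definition par :: "nat set \<Rightarrow> 'a \<Rightarrow> bool" where
  "par \<Lambda> = (SOME \<phi>. \<phi> \<in> hom G Z2 \<and> (\<forall>i<n. \<forall>a\<in>A i. \<not> \<phi> a) \<and> (\<forall>j<k. \<phi> (x j) \<longleftrightarrow> j \<in> \<Lambda>))"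

lemma par_props: "par \<Lambda> \<in> hom G Z2 \<and> (\<forall>i<n. \<forall>a\<in>A i. \<not> par \<Lambda> a) \<and> (\<forall>j<k. par \<Lambda> (x j) \<longleftrightarrow> j \<in> \<Lambda>)"
proof -
  have "\<exists>\<phi>\<in>hom G Z2. (\<forall>i<n. \<forall>a\<in>A i. \<phi> a = False) \<and> (\<forall>j<k. \<phi> (x j) = (j \<in> \<Lambda>))"
  proof (rule hom_extension[OF group_Z2])
    show "(\<lambda>a. False) \<in> hom (G\<lparr>carrier := A i\<rparr>) Z2" for i by (rule homI) (simp_all add: Z2_def)
  qed (simp add: Z2_def)
  then have "\<exists>\<phi>. \<phi> \<in> hom G Z2 \<and> (\<forall>i<n. \<forall>a\<in>A i. \<not> \<phi> a) \<and> (\<forall>j<k. \<phi> (x j) \<longleftrightarrow> j \<in> \<Lambda>)"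
    by (simp only: Bex_def eq_False)
  then show ?thesis unfolding par_def by (rule someI_ex)
qed

lemma par_mult [simp]: "g \<in> carrier G \<Longrightarrow> h \<in> carrier G \<Longrightarrow> par \<Lambda> (g \<otimes> h) = (par \<Lambda> g \<noteq> par \<Lambda> h)"
  using par_props[of \<Lambda>] by (simp add: hom_def Z2_def)

lemma par_A [simp]: "i < n \<Longrightarrow> a \<in> A i \<Longrightarrow> \<not> par \<Lambda> a"
  using par_props[of \<Lambda>] by blast

lemma par_x [simp]: "j < k \<Longrightarrow> par \<Lambda> (x j) \<longleftrightarrow> j \<in> \<Lambda>"
  using par_props[of \<Lambda>] by blast

lemma par_one [simp]: "\<not> par \<Lambda> \<one>"
  using par_mult[of \<one> \<one> \<Lambda>] by simp

lemma par_inv [simp]: "g \<in> carrier G \<Longrightarrow> par \<Lambda> (inv g) = par \<Lambda> g"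
  using par_mult[of g "inv g" \<Lambda>] by simp

text \<open>The parities form a vector space over the field with two elements, with subsets under
  symmetric difference as coordinates.\<close>

lemma par_symdiff:
  assumes "g \<in> carrier G"
  shows "par ((\<Lambda> - M) \<union> (M - \<Lambda>)) g = (par \<Lambda> g \<noteq> par M g)"
  using assms
proof (induction rule: factors_induct)
  case (factor i a g)
  then show ?case by simp
next
  case (basis j g y)
  have "par M' y \<longleftrightarrow> j \<in> M'" "y \<in> carrier G" for M' using basis(1,2) by auto
  then show ?case using basis(3,4) by auto
qed simp

text \<open>If some \<open>y j\<close> dies under all parity homomorphisms, only \<open>k - 1\<close> elements are left to
  generate the elementary abelian quotient of rank \<open>k\<close>.\<close>

lemma rank_loss:
  assumes "\<And>i. i < n \<Longrightarrow> t i \<in> carrier G" "\<And>j. j < k \<Longrightarrow> y j \<in> carrier G"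
    and "j < k" "\<And>\<Lambda>. \<not> par \<Lambda> (y j)"
  shows "Neg t y"
proof -
  \<comment> \<open>Parities on the remaining k - 1 entries cannot separate all 2^k subsets; the
    symmetric difference of two subsets that agree gives a nonzero parity that kills the whole
    tuple.\<close>
  define f where "f \<Lambda> = {l. l < k \<and> par \<Lambda> (y l)}" for \<Lambda>
  have "f ` Pow {..<k} \<subseteq> Pow ({..<k} - {j})" using assms(4) by (auto simp: f_def)
  then have "card (f ` Pow {..<k}) \<le> card (Pow ({..<k} - {j}))" by (intro card_mono) auto
  also have "\<dots> < card (Pow {..<k})" using assms(3) by (simp add: card_Pow)
  finally have "\<not> inj_on f (Pow {..<k})" by (rule pigeonhole)
  then obtain \<Lambda>1 \<Lambda>2 where L: "\<Lambda>1 \<subseteq> {..<k}" "\<Lambda>2 \<subseteq> {..<k}" "\<Lambda>1 \<noteq> \<Lambda>2" "f \<Lambda>1 = f \<Lambda>2"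
    unfolding inj_on_def by blast
  define \<Lambda> where "\<Lambda> = (\<Lambda>1 - \<Lambda>2) \<union> (\<Lambda>2 - \<Lambda>1)"
  have par_y: "\<not> par \<Lambda> (y l)" if "l < k" for l
    unfolding \<Lambda>_def par_symdiff[OF assms(2)[OF that]] using L(4) that by (auto simp: f_def)
  \<comment> \<open>The parity becomes an action on the points 0 and 1: basis elements of odd parity
    swap them. As codes, 0 and 1 are the pairs (0, 0) and (0, 1), fixed by every
    \<open>alpha i a\<close>.\<close>
  define L where "L i = (if i \<ge> n \<and> i - n \<in> \<Lambda> then [(0 :: nat, 1 :: nat)] else [])" for i :: nat
  have fixed: "alpha i a 0 = 0" "alpha i a 1 = 1" for i a
  proof -
    have "prod_encode (0, 0) = 0" "prod_encode (0, 1) = 1" by (simp_all add: prod_encode_def triangle_def)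
    then show "alpha i a 0 = 0" "alpha i a 1 = 1" using alpha_zero[of i a 0] alpha_zero[of i a 1] by simp_all
  qed
  have "act L g 0 = of_bool (par \<Lambda> g) \<and> act L g 1 = of_bool (\<not> par \<Lambda> g)" if "g \<in> carrier G" for g
    using that
  proof (induction rule: factors_induct)
    case (factor i a g)
    have a: "a \<in> carrier G" using factor by simp
    have "act L a z = z" if "z = 0 \<or> z = 1" for z
      using that factor fixed by (auto simp: act_A L_def)
    then show ?case using factor a by (simp add: of_bool_def)
  next
    case (basis j g y)
    have x: "act L (x j) 0 = of_bool (j \<in> \<Lambda>)" "act L (x j) 1 = of_bool (j \<notin> \<Lambda>)"
      using basis by (auto simp: act_x L_def swaps_def)
    have "act L (inv (x j)) 0 = of_bool (j \<in> \<Lambda>)" "act L (inv (x j)) 1 = of_bool (j \<notin> \<Lambda>)"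
      using x act_inv(2)[of "x j" L 0] act_inv(2)[of "x j" L 1] basis(1)
      by (cases "j \<in> \<Lambda>"; simp)+
    then show ?case using basis x by (auto simp: of_bool_def)
  qed simp
  then have act0: "act L g 0 = 0 \<longleftrightarrow> \<not> par \<Lambda> g" if "g \<in> carrier G" for g using that by simp
  obtain j' where "j' \<in> \<Lambda>" using L(3) by (auto simp: \<Lambda>_def)
  then have "j' < k" using L(1,2) by (auto simp: \<Lambda>_def)
  show ?thesis unfolding Neg_def
  proof (intro exI[of _ L] conjI allI impI ballI)
    show "act L (t i \<otimes> a \<otimes> inv (t i)) 0 = 0" if "i < n" "a \<in> A i" for i a
    proof -
      have "a \<in> carrier G" using that by simp
      then have "t i \<otimes> a \<otimes> inv (t i) \<in> carrier G" "\<not> par \<Lambda> (t i \<otimes> a \<otimes> inv (t i))"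
        using assms(1)[OF that(1)] that by simp_all
      then show ?thesis using act0 by blast
    qed
    show "act L (y l) 0 = 0" if "l < k" for l using act0 assms(2) par_y that by simp
    show "\<exists>g\<in>carrier G. act L g 0 \<noteq> 0"
      using act0[of "x j'"] \<open>j' \<in> \<Lambda>\<close> \<open>j' < k\<close> by (intro bexI[of _ "x j'"]) auto
  qed
qed

end

section \<open>Elementary moves on tuples\<close>

context fr_data
begin

text \<open>The slack \<open>c\<close> is there because \<open>t i\<close> and
  \<open>t i \<otimes> c\<close> give the same conjugate of \<open>A i\<close>. Permuting and
  inverting basis elements need not be possible inside \<open>Aut0\<close>; the free choice of a
  basis absorbs this.\<close>

definition Pos :: "(nat \<Rightarrow> 'a) \<Rightarrow> (nat \<Rightarrow> 'a) \<Rightarrow> bool" where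
  "Pos t y \<longleftrightarrow> (\<exists>\<Phi>\<in>AutZ.
     (\<forall>i<n. \<exists>c\<in>A i. \<forall>a\<in>A i. \<Phi> a = t i \<otimes> c \<otimes> a \<otimes> inv (t i \<otimes> c)) \<and>
     (\<exists>\<pi> \<epsilon>. inj_on \<pi> {..<k} \<and> \<pi> ` {..<k} \<subseteq> {..<k} \<and>
        (\<forall>j<k. y j = (if \<epsilon> j then \<Phi> (x (\<pi> j)) else inv (\<Phi> (x (\<pi> j)))))))"

definition tup :: "(nat \<Rightarrow> 'a) \<Rightarrow> (nat \<Rightarrow> 'a) \<Rightarrow> bool" where
  "tup t y \<longleftrightarrow> (\<forall>i<n. t i \<in> carrier G) \<and> (\<forall>j<k. y j \<in> carrier G)"

definition lett :: "(nat \<Rightarrow> 'a) \<Rightarrow> (nat \<Rightarrow> 'a) \<Rightarrow> nat \<Rightarrow> 'a \<Rightarrow> bool" where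
  "lett t y ix b \<longleftrightarrow> (ix < n \<and> (\<exists>a\<in>A ix. b = t ix \<otimes> a \<otimes> inv (t ix))) \<or>
     (n \<le> ix \<and> ix < n + k \<and> (b = y (ix - n) \<or> b = inv (y (ix - n))))"

lemma lett_closed: "tup t y \<Longrightarrow> lett t y ix b \<Longrightarrow> b \<in> carrier G"
proof -
  assume *: "tup t y" "lett t y ix b"
  have "t ix \<otimes> a \<otimes> inv (t ix) \<in> carrier G" if "ix < n" "a \<in> A ix" for a
    using *(1) that A_closed[of a ix] by (simp add: tup_def)
  moreover have "y (ix - n) \<in> carrier G" if "n \<le> ix" "ix < n + k"
    using *(1) that by (simp add: tup_def)
  ultimately show ?thesis using *(2) by (auto simp: lett_def)
qed

lemma lett_inv:
  assumes "tup t y" "lett t y ix b"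
  shows "lett t y ix (inv b)"
proof (cases "ix < n")
  case True
  then obtain a where a: "a \<in> A ix" "b = t ix \<otimes> a \<otimes> inv (t ix)" using assms(2) by (auto simp: lett_def)
  have c: "a \<in> carrier G" "t ix \<in> carrier G" using a True assms(1) by (auto simp: tup_def)
  have "inv b = t ix \<otimes> inv a \<otimes> inv (t ix)" using c by (simp add: a(2) inv_mult_group m_assoc)
  then show ?thesis using True a(1) by (auto simp: lett_def)
next
  case False
  then have "y (ix - n) \<in> carrier G" using assms by (auto simp: lett_def tup_def)
  then show ?thesis using assms(2) False by (auto simp: lett_def)
qed

text \<open>The letter comes from an entry other than the one it changes. Thus the generated
  subgroup is preserved, and the automorphism undoing a move satisfies the index conditions of
  partial conjugations and transvections.\<close>

inductive move :: "(nat \<Rightarrow> 'a) \<times> (nat \<Rightarrow> 'a) \<Rightarrow> (nat \<Rightarrow> 'a) \<times> (nat \<Rightarrow> 'a) \<Rightarrow> bool" where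
  move_t: "l < n \<Longrightarrow> l \<noteq> ix \<Longrightarrow> lett t y ix b \<Longrightarrow> move (t, y) (t(l := b \<otimes> t l), y)"
| move_y: "l < k \<Longrightarrow> n + l \<noteq> ix \<Longrightarrow> lett t y ix b \<Longrightarrow> move (t, y) (t, y(l := b \<otimes> y l))"
| move_inv: "l < k \<Longrightarrow> move (t, y) (t, y(l := inv (y l)))"

abbreviation moves where "moves \<equiv> move\<^sup>*\<^sup>*"

lemma move_tup: "move (t, y) (t', y') \<Longrightarrow> tup t y \<Longrightarrow> tup t' y'"
proof (erule move.cases)
  fix l ix t0 y0 b assume *: "tup t y" "(t, y) = (t0, y0)" "lett t0 y0 ix b"
  then have "b \<in> carrier G" using lett_closed[of t y] by simp
  then show "l < n \<Longrightarrow> (t', y') = (t0(l := b \<otimes> t0 l), y0) \<Longrightarrow> tup t' y'"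
    "l < k \<Longrightarrow> (t', y') = (t0, y0(l := b \<otimes> y0 l)) \<Longrightarrow> tup t' y'"
    using *(1,2) by (auto simp: tup_def)
qed (auto simp: tup_def)

lemma moves_tup: "moves p q \<Longrightarrow> tup (fst p) (snd p) \<Longrightarrow> tup (fst q) (snd q)"
proof (induction rule: rtranclp_induct)
  case (step q r)
  then show ?case using move_tup[of "fst q" "snd q" "fst r" "snd r"] by simp
qed

text \<open>If \<open>\<Phi>\<close> realises the moved tuple, then the letter \<open>b\<close> is the image under \<open>\<Phi>\<close> of an element of
  one factor, and composing \<open>\<Phi>\<close> with a partial conjugation or transvection by that element undoes
  the move.\<close>

lemma Pos_letter:
  assumes "tup t y" "\<Phi> \<in> auto G" "lett t y ix b"
    and "ix < n \<Longrightarrow> \<exists>c\<in>A ix. \<forall>a\<in>A ix. \<Phi> a = t ix \<otimes> c \<otimes> a \<otimes> inv (t ix \<otimes> c)"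
    and "inj_on \<pi> {..<k}" "\<pi> ` {..<k} \<subseteq> {..<k}"
    and "ix \<ge> n \<Longrightarrow> y (ix - n) = (if \<epsilon> (ix - n) then \<Phi> (x (\<pi> (ix - n))) else inv (\<Phi> (x (\<pi> (ix - n)))))"
  shows "\<exists>f \<beta>. f < n + k \<and> \<beta> \<in> A f \<and> b = \<Phi> \<beta> \<and>
    (if ix < n then f = ix else f = n + \<pi> (ix - n))"
proof -
  interpret p: group_hom G G \<Phi>
    using auto_hom[OF assms(2)] by (simp add: group_hom_def group_hom_axioms_def is_group)
  show ?thesis
  proof (cases "ix < n")
    case True
    then obtain c a where c: "c \<in> A ix" "\<forall>a\<in>A ix. \<Phi> a = t ix \<otimes> c \<otimes> a \<otimes> inv (t ix \<otimes> c)"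
      and a: "a \<in> A ix" "b = t ix \<otimes> a \<otimes> inv (t ix)"
      using assms(3,4) by (auto simp: lett_def)
    have cl: "c \<in> carrier G" "a \<in> carrier G" "t ix \<in> carrier G"
      using True a c assms(1) by (auto simp: tup_def)
    have m: "inv c \<otimes> a \<otimes> c \<in> A ix" using True a c by simp
    have "\<Phi> (inv c \<otimes> a \<otimes> c) = b"
      using c(2)[rule_format, OF m] cl by (simp add: a(2) m_assoc inv_mult_group)
    then show ?thesis using m True by (intro exI[of _ ix] exI[of _ "inv c \<otimes> a \<otimes> c"]) auto
  next
    case False
    define l where "l = ix - n"
    have l: "l < k" "b = y l \<or> b = inv (y l)" using False assms(3) by (auto simp: lett_def l_def)
    have pl: "\<pi> l < k" using assms(6) l by auto
    have yl: "y l = (if \<epsilon> l then \<Phi> (x (\<pi> l)) else inv (\<Phi> (x (\<pi> l))))"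
      using assms(7) False by (simp add: l_def)
    have "\<exists>\<beta>. (\<beta> = x (\<pi> l) \<or> \<beta> = inv (x (\<pi> l))) \<and> b = \<Phi> \<beta>"
      using l(2) pl unfolding yl by (auto split: if_splits)
    then obtain \<beta> where "\<beta> = x (\<pi> l) \<or> \<beta> = inv (x (\<pi> l))" "b = \<Phi> \<beta>" by blast
    moreover have "\<beta> \<in> A (n + \<pi> l)" using calculation(1) x_A[OF pl] pl by auto
    ultimately show ?thesis using False pl by (intro exI[of _ "n + \<pi> l"] exI[of _ \<beta>]) (auto simp: l_def)
  qed
qed

lemma Pos_move:
  assumes "tup t y" "move (t, y) (t', y')" "Pos t' y'"
  shows "Pos t y"
proof -
  obtain \<Phi> \<pi> \<epsilon> where P: "\<Phi> \<in> AutZ"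
    "\<And>i. i < n \<Longrightarrow> \<exists>c\<in>A i. \<forall>a\<in>A i. \<Phi> a = t' i \<otimes> c \<otimes> a \<otimes> inv (t' i \<otimes> c)"
    "inj_on \<pi> {..<k}" "\<pi> ` {..<k} \<subseteq> {..<k}"
    "\<And>j. j < k \<Longrightarrow> y' j = (if \<epsilon> j then \<Phi> (x (\<pi> j)) else inv (\<Phi> (x (\<pi> j))))"
    using assms(3) unfolding Pos_def by blast
  have Pa: "\<Phi> \<in> auto G" using P(1) AutZ_auto by blast
  interpret p: group_hom G G \<Phi>
    using auto_hom[OF Pa] by (simp add: group_hom_def group_hom_axioms_def is_group)
  have pk: "\<pi> j < k" if "j < k" for j using P(4) that by auto
  from assms(2) show ?thesis
  proof cases
    case (move_t l ix b)
    have b: "b \<in> carrier G" using lett_closed[OF assms(1) move_t(5)] .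
    have "\<exists>f \<beta>. f < n + k \<and> \<beta> \<in> A f \<and> b = \<Phi> \<beta> \<and> (if ix < n then f = ix else f = n + \<pi> (ix - n))"
    proof (rule Pos_letter[OF assms(1) Pa move_t(5) _ P(3,4), of \<epsilon>])
      show "\<exists>c\<in>A ix. \<forall>a\<in>A ix. \<Phi> a = t ix \<otimes> c \<otimes> a \<otimes> inv (t ix \<otimes> c)" if "ix < n"
        using P(2)[OF that] move_t by simp
      show "y (ix - n) = (if \<epsilon> (ix - n) then \<Phi> (x (\<pi> (ix - n))) else inv (\<Phi> (x (\<pi> (ix - n)))))"
        if "ix \<ge> n" using P(5)[of "ix - n"] move_t that by (auto simp: lett_def)
    qed
    then obtain f \<beta> where f: "f < n + k" "\<beta> \<in> A f" "b = \<Phi> \<beta>" "f \<noteq> l"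
      using move_t(3,4) by (metis not_add_less1)
    have bc: "\<beta> \<in> carrier G" using f by simp
    have l: "l < n + k" using move_t by simp
    let ?\<chi> = "pconj \<beta> l"
    have chi: "?\<chi> \<in> auto G" "\<And>h. h \<in> A l \<Longrightarrow> ?\<chi> h = inv \<beta> \<otimes> h \<otimes> \<beta>"
      "\<And>m h. m < n + k \<Longrightarrow> m \<noteq> l \<Longrightarrow> h \<in> A m \<Longrightarrow> ?\<chi> h = h"
      using pconj[OF f(1) l f(4,2)] by simp_all
    \<comment> \<open>Since \<open>\<Phi>\<close> takes \<open>\<beta>\<close> to \<open>b\<close>,
      it turns conjugation by \<open>\<beta>\<close> into conjugation by \<open>b\<close>, which
      removes the factor \<open>b\<close> from the moved entry.\<close>
    let ?\<Psi> = "\<Phi> \<otimes>\<^bsub>Aut\<^esub> ?\<chi>"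
    have "?\<Psi> \<in> AutZ" by (rule AutZ_mult[OF P(1) AutZ_gens(1)[OF f(1,2) l f(4)]])
    moreover have "\<exists>c\<in>A i. \<forall>a\<in>A i. ?\<Psi> a = t i \<otimes> c \<otimes> a \<otimes> inv (t i \<otimes> c)" if i: "i < n" for i
    proof (cases "i = l")
      case True
      obtain c where c: "c \<in> A l" "\<forall>a\<in>A l. \<Phi> a = b \<otimes> t l \<otimes> c \<otimes> a \<otimes> inv (b \<otimes> t l \<otimes> c)"
        using P(2)[OF i] move_t True by auto
      have "?\<Psi> a = t l \<otimes> c \<otimes> a \<otimes> inv (t l \<otimes> c)" if a: "a \<in> A l" for a
      proof -
        have cl: "a \<in> carrier G" "c \<in> carrier G" "t l \<in> carrier G"
          using a c(1) move_t assms(1) by (auto simp: tup_def)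
        have "?\<Psi> a = inv b \<otimes> \<Phi> a \<otimes> b"
          using Aut_mult_apply[OF Pa chi(1), of a] chi(2)[OF a] cl bc f(3) by simp
        then show ?thesis using c(2) a cl b by (simp add: m_assoc inv_mult_group)
      qed
      then show ?thesis using c(1) True by blast
    next
      case False
      obtain c where c: "c \<in> A i" "\<forall>a\<in>A i. \<Phi> a = t i \<otimes> c \<otimes> a \<otimes> inv (t i \<otimes> c)"
        using P(2)[OF i] move_t False by auto
      have "?\<Psi> a = \<Phi> a" if "a \<in> A i" for a
        using Aut_mult_apply[OF Pa chi(1), of a] chi(3)[of i a] that False i by simp
      then show ?thesis using c by auto
    qed
    moreover have "?\<Psi> (x j) = \<Phi> (x j)" if "j < k" for j
      using Aut_mult_apply[OF Pa chi(1), of "x j"] chi(3)[OF _ _ x_A[OF that]] that move_t by simp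
    then have "\<forall>j<k. y j = (if \<epsilon> j then ?\<Psi> (x (\<pi> j)) else inv (?\<Psi> (x (\<pi> j))))"
      using P(5) pk move_t by simp
    ultimately show ?thesis unfolding Pos_def using P(3,4) by blast
  next
    case (move_y l ix b)
    have b: "b \<in> carrier G" using lett_closed[OF assms(1) move_y(5)] .
    have yl: "y l \<in> carrier G" using assms(1) move_y by (simp add: tup_def)
    have "\<exists>f \<beta>. f < n + k \<and> \<beta> \<in> A f \<and> b = \<Phi> \<beta> \<and> (if ix < n then f = ix else f = n + \<pi> (ix - n))"
    proof (rule Pos_letter[OF assms(1) Pa move_y(5) _ P(3,4), of \<epsilon>])
      show "\<exists>c\<in>A ix. \<forall>a\<in>A ix. \<Phi> a = t ix \<otimes> c \<otimes> a \<otimes> inv (t ix \<otimes> c)" if "ix < n"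
        using P(2)[OF that] move_y by simp
      show "y (ix - n) = (if \<epsilon> (ix - n) then \<Phi> (x (\<pi> (ix - n))) else inv (\<Phi> (x (\<pi> (ix - n)))))"
        if "ix \<ge> n"
      proof -
        have "ix - n < k" "ix - n \<noteq> l" using move_y that by (auto simp: lett_def)
        then show ?thesis using P(5)[of "ix - n"] move_y(2) by simp
      qed
    qed
    then obtain f \<beta> where f: "f < n + k" "\<beta> \<in> A f" "b = \<Phi> \<beta>"
      "if ix < n then f = ix else f = n + \<pi> (ix - n)" by blast
    have pl: "\<pi> l < k" using pk move_y by simp
    have fl: "f \<noteq> n + \<pi> l"
    proof (cases "ix < n")
      case False
      then have "ix - n < k" "ix - n \<noteq> l" using move_y by (auto simp: lett_def)
      then show ?thesis using False f(4) inj_onD[OF P(3), of "ix - n" l] move_y by auto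
    qed (use f(4) in auto)
    have bc: "\<beta> \<in> carrier G" "inv \<beta> \<in> A f" using f by simp_all
    have xc: "x (\<pi> l) \<in> carrier G" "\<Phi> (x (\<pi> l)) \<in> carrier G" using pl by simp_all
    \<comment> \<open>If the moved entry is the inverse of an image, inversion exchanges the sides,
      so the left factor \<open>b\<close> is undone by a right transvection instead of a left
      one.\<close>
    obtain \<chi> where chi: "\<chi> \<in> auto G" "\<chi> \<in> AutZ"
      "\<And>m h. m < n + k \<Longrightarrow> m \<noteq> n + \<pi> l \<Longrightarrow> h \<in> A m \<Longrightarrow> \<chi> h = h"
      "y l = (if \<epsilon> l then \<Phi> (\<chi> (x (\<pi> l))) else inv (\<Phi> (\<chi> (x (\<pi> l)))))"
    proof (cases "\<epsilon> l")
      case True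
      have eq: "b \<otimes> y l = \<Phi> (x (\<pi> l))" using P(5)[of l] True move_y by simp
      have "\<Phi> (inv \<beta> \<otimes> x (\<pi> l)) = inv b \<otimes> \<Phi> (x (\<pi> l))" using f(3) bc(1) xc by simp
      also have "\<dots> = y l" using b yl by (simp flip: eq)
      finally show ?thesis
        using that[of "ltrans (inv \<beta>) (\<pi> l)"] ltrans[OF f(1) pl fl bc(2)] AutZ_gens(2)[OF f(1) bc(2) pl fl] True
        by simp
    next
      case False
      have eq: "b \<otimes> y l = inv (\<Phi> (x (\<pi> l)))" using P(5)[of l] False move_y by simp
      have "inv (\<Phi> (x (\<pi> l) \<otimes> \<beta>)) = inv b \<otimes> inv (\<Phi> (x (\<pi> l)))"
        using f(3) bc(1) xc by (simp add: inv_mult_group)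
      also have "\<dots> = y l" using b yl by (simp flip: eq)
      finally show ?thesis
        using that[of "rtrans \<beta> (\<pi> l)"] rtrans[OF f(1) pl fl f(2)] AutZ_gens(3)[OF f(1,2) pl fl] False
        by simp
    qed
    let ?\<Psi> = "\<Phi> \<otimes>\<^bsub>Aut\<^esub> \<chi>"
    have "?\<Psi> \<in> AutZ" by (rule AutZ_mult[OF P(1) chi(2)])
    moreover have "\<exists>c\<in>A i. \<forall>a\<in>A i. ?\<Psi> a = t i \<otimes> c \<otimes> a \<otimes> inv (t i \<otimes> c)" if i: "i < n" for i
    proof -
      obtain c where c: "c \<in> A i" "\<forall>a\<in>A i. \<Phi> a = t i \<otimes> c \<otimes> a \<otimes> inv (t i \<otimes> c)"
        using P(2)[OF i] move_y by auto
      have "?\<Psi> a = \<Phi> a" if "a \<in> A i" for a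
        using Aut_mult_apply[OF Pa chi(1), of a] chi(3)[of i a] that i by simp
      then show ?thesis using c by auto
    qed
    moreover have "y j = (if \<epsilon> j then ?\<Psi> (x (\<pi> j)) else inv (?\<Psi> (x (\<pi> j))))" if j: "j < k" for j
    proof (cases "j = l")
      case True
      then show ?thesis using chi(4) Aut_mult_apply[OF Pa chi(1) xc(1)] by simp
    next
      case False
      then have "\<pi> j \<noteq> \<pi> l" using inj_onD[OF P(3), of j l] j move_y by auto
      then have "?\<Psi> (x (\<pi> j)) = \<Phi> (x (\<pi> j))"
        using Aut_mult_apply[OF Pa chi(1), of "x (\<pi> j)"] chi(3)[OF _ _ x_A[OF pk[OF j]]] pk[OF j] by simp
      then show ?thesis using P(5)[OF j] move_y False by simp
    qed
    ultimately show ?thesis unfolding Pos_def using P(3,4) by blast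
  next
    case (move_inv l)
    have "y j = (if (\<epsilon>(l := \<not> \<epsilon> l)) j then \<Phi> (x (\<pi> j)) else inv (\<Phi> (x (\<pi> j))))" if j: "j < k" for j
    proof (cases "j = l")
      case True
      have "y l = inv (y' l)" using move_inv assms(1) by (simp add: tup_def)
      then show ?thesis using P(5)[OF j] True pk[OF j] by (auto split: if_splits)
    next
      case False
      then show ?thesis using P(5)[OF j] move_inv by simp
    qed
    then show ?thesis unfolding Pos_def using P(1-4) move_inv by blast
  qed
qed

text \<open>The same action works: the moved tuple generates the old entries, so 0 is fixed by those
  too.\<close>

lemma Neg_move:
  assumes "tup t y" "move (t, y) (t', y')" "Neg t' y'"
  shows "Neg t y"
proof -
  obtain L where L: "\<And>i a. i < n \<Longrightarrow> a \<in> A i \<Longrightarrow> act L (t' i \<otimes> a \<otimes> inv (t' i)) 0 = 0"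
    "\<And>j. j < k \<Longrightarrow> act L (y' j) 0 = 0" "\<exists>g\<in>carrier G. act L g 0 \<noteq> 0"
    using assms(3) unfolding Neg_def by blast
  have fixm: "act L (g \<otimes> h) 0 = 0" if "act L g 0 = 0" "act L h 0 = 0" "g \<in> carrier G" "h \<in> carrier G" for g h
    using that by simp
  have fixl: "act L b 0 = 0" if lt: "lett t y ix b" and eq: "ix < n \<Longrightarrow> t' ix = t ix" "ix \<ge> n \<Longrightarrow> y' (ix - n) = y (ix - n)"
    for b ix
  proof (cases "ix < n")
    case True
    then obtain a where a: "a \<in> A ix" "b = t ix \<otimes> a \<otimes> inv (t ix)" using lt by (auto simp: lett_def)
    then show ?thesis using L(1)[OF True a(1)] eq(1)[OF True] by simp
  next
    case False
    then have "ix - n < k" "y (ix - n) \<in> carrier G" "b = y (ix - n) \<or> b = inv (y (ix - n))"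
      using lt assms(1) by (auto simp: lett_def tup_def)
    then show ?thesis using eq(2) False L(2)[of "ix - n"] act_fix_inv by auto
  qed
  from assms(2) show ?thesis
  proof cases
    case (move_t l ix b)
    have b: "b \<in> carrier G" using lett_closed[OF assms(1) move_t(5)] .
    have fb: "act L b 0 = 0" by (rule fixl[OF move_t(5)]) (use move_t in auto)
    have "act L (t i \<otimes> a \<otimes> inv (t i)) 0 = 0" if i: "i < n" "a \<in> A i" for i a
    proof (cases "i = l")
      case True
      have c: "t l \<in> carrier G" "a \<in> carrier G" using assms(1) i True by (auto simp: tup_def)
      have "t i \<otimes> a \<otimes> inv (t i) = inv b \<otimes> (t' i \<otimes> a \<otimes> inv (t' i)) \<otimes> b"
        using c b True move_t by (simp add: m_assoc inv_mult_group)
      moreover have "t' i \<in> carrier G" using c b True move_t by simp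
      ultimately show ?thesis using L(1)[OF i] b c fb act_fix_inv[OF b fb] by simp
    qed (use L(1)[OF i] move_t in simp)
    then show ?thesis using L move_t unfolding Neg_def by (intro exI[of _ L]) simp
  next
    case (move_y l ix b)
    have b: "b \<in> carrier G" using lett_closed[OF assms(1) move_y(5)] .
    have fb: "act L b 0 = 0" by (rule fixl[OF move_y(5)]) (use move_y in auto)
    have "act L (y j) 0 = 0" if j: "j < k" for j
    proof (cases "j = l")
      case True
      have "y j \<in> carrier G" using assms(1) j by (simp add: tup_def)
      then have "y j = inv b \<otimes> y' j" "y' j \<in> carrier G" using True b move_y by simp_all
      then show ?thesis using L(2)[OF j] act_fix_inv[OF b fb] b by simp
    qed (use L(2)[OF j] move_y in simp)
    then show ?thesis using L move_y unfolding Neg_def by (intro exI[of _ L]) simp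
  next
    case (move_inv l)
    have "act L (y j) 0 = 0" if j: "j < k" for j
    proof (cases "j = l")
      case True
      have "y j \<in> carrier G" using assms(1) j by (simp add: tup_def)
      then have "act L (inv (y' j)) 0 = 0 \<and> y j = inv (y' j)"
        using True move_inv L(2)[OF j] act_fix_inv[of "y' j" L 0] by simp
      then show ?thesis by simp
    qed (use L(2)[OF j] move_inv in simp)
    then show ?thesis using L move_inv unfolding Neg_def by (intro exI[of _ L]) simp
  qed
qed

definition decided :: "(nat \<Rightarrow> 'a) \<Rightarrow> (nat \<Rightarrow> 'a) \<Rightarrow> bool" where
  "decided t y \<longleftrightarrow> Pos t y \<or> Neg t y"

lemma decided_moves:
  assumes "moves p q" "tup (fst p) (snd p)" "decided (fst q) (snd q)"
  shows "decided (fst p) (snd p)"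
  using assms
proof (induction rule: converse_rtranclp_induct)
  case (step p p')
  obtain t y t' y' where p: "p = (t, y)" "p' = (t', y')" by force
  show ?case using step Pos_move[of t y t' y'] Neg_move[of t y t' y'] move_tup[of t y t' y']
    by (auto simp: p decided_def)
qed

section \<open>Multiplying several entries by one letter\<close>

lemma moves_t:
  assumes "finite M" "M \<subseteq> {..<n}" "ix \<notin> M" "lett t y ix b"
  shows "moves (t, y) (\<lambda>l. if l \<in> M then b \<otimes> t l else t l, y)"
  using assms(1-3)
proof (induction M)
  case empty
  then show ?case by simp
next
  case (insert m M)
  let ?t = "\<lambda>l. if l \<in> M then b \<otimes> t l else t l"
  have "lett ?t y ix b" using assms(4) insert.prems by (simp add: lett_def)
  then have "move (?t, y) (?t(m := b \<otimes> ?t m), y)" using insert.prems by (intro move_t[of m ix]) auto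
  moreover have "?t(m := b \<otimes> ?t m) = (\<lambda>l. if l \<in> insert m M then b \<otimes> t l else t l)"
    using insert.hyps by auto
  ultimately show ?case using insert by auto
qed

text \<open>Right multiplication is left multiplication by the inverse letter between two
  inversions.\<close>

lemma move_y_right:
  assumes "tup t y" "l < k" "n + l \<noteq> ix" "lett t y ix b"
  shows "moves (t, y) (t, y(l := y l \<otimes> b))"
proof -
  have b: "b \<in> carrier G" using lett_closed[OF assms(1,4)] .
  have yl: "y l \<in> carrier G" using assms(1,2) by (simp add: tup_def)
  let ?y1 = "y(l := inv (y l))" let ?y2 = "?y1(l := inv b \<otimes> ?y1 l)"
  have "move (t, y) (t, ?y1)" using assms(2) by (rule move_inv)
  moreover have "lett t ?y1 ix (inv b)" using lett_inv[OF assms(1,4)] assms(3) by (auto simp: lett_def)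
  then have "move (t, ?y1) (t, ?y2)" by (rule move_y[OF assms(2,3)])
  moreover have "move (t, ?y2) (t, ?y2(l := inv (?y2 l)))" using assms(2) by (rule move_inv)
  moreover have "?y2(l := inv (?y2 l)) = y(l := y l \<otimes> b)"
    using b yl by (simp add: inv_mult_group)
  ultimately show ?thesis by (metis (no_types, lifting) converse_rtranclp_into_rtranclp rtranclp.rtrancl_refl)
qed

lemma moves_y_left:
  assumes "finite M" "M \<subseteq> {l. l < k \<and> n + l \<noteq> ix}" "lett t y ix b"
  shows "moves (t, y) (t, \<lambda>l. if l \<in> M then b \<otimes> y l else y l)"
  using assms(1,2)
proof (induction M)
  case empty
  then show ?case by simp
next
  case (insert m M)
  let ?y = "\<lambda>l. if l \<in> M then b \<otimes> y l else y l"
  have "lett t ?y ix b" using assms(3) insert.prems by (auto simp: lett_def)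
  then have "move (t, ?y) (t, ?y(m := b \<otimes> ?y m))" using insert.prems by (intro move_y[of m ix]) auto
  moreover have "?y(m := b \<otimes> ?y m) = (\<lambda>l. if l \<in> insert m M then b \<otimes> y l else y l)"
    using insert.hyps by auto
  ultimately show ?case using insert by auto
qed

lemma moves_y_right:
  assumes "tup t y" "finite M" "M \<subseteq> {l. l < k \<and> n + l \<noteq> ix}" "lett t y ix b"
  shows "moves (t, y) (t, \<lambda>l. if l \<in> M then y l \<otimes> b else y l)"
  using assms(2,3)
proof (induction M)
  case empty
  then show ?case by simp
next
  case (insert m M)
  let ?y = "\<lambda>l. if l \<in> M then y l \<otimes> b else y l"
  have IH: "moves (t, y) (t, ?y)" using insert by auto
  have "lett t ?y ix b" using assms(4) insert.prems by (auto simp: lett_def)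
  moreover have "tup t ?y" using moves_tup[OF IH] assms(1) by simp
  ultimately have "moves (t, ?y) (t, ?y(m := ?y m \<otimes> b))"
    using insert.prems by (intro move_y_right[of _ _ m ix]) auto
  moreover have "?y(m := ?y m \<otimes> b) = (\<lambda>l. if l \<in> insert m M then y l \<otimes> b else y l)"
    using insert.hyps by auto
  ultimately show ?case using IH by auto
qed

section \<open>Finite connected sets of vertices\<close>

text \<open>Vertices are the elements of \<open>G\<close>, as singletons, and the left cosets of the \<open>A i\<close>, \<open>i < n\<close>.\<close>

definition lc :: "'a \<Rightarrow> 'a set \<Rightarrow> 'a set" where
  "lc g P = (\<lambda>h. g \<otimes> h) ` P"

definition Vert :: "'a set set" where
  "Vert = {{g} |g. g \<in> carrier G} \<union> {lc g (A i) |g i. g \<in> carrier G \<and> i < n}"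

lemma Vert_single: "g \<in> carrier G \<Longrightarrow> {g} \<in> Vert"
  by (auto simp: Vert_def)

lemma Vert_coset: "g \<in> carrier G \<Longrightarrow> i < n \<Longrightarrow> lc g (A i) \<in> Vert"
  by (auto simp: Vert_def)

text \<open>All edges are given by right multiplication, so G acts on the graph by left
  translation.\<close>

inductive adj :: "'a set \<Rightarrow> 'a set \<Rightarrow> bool" where
  adj_coset: "g \<in> carrier G \<Longrightarrow> i < n \<Longrightarrow> adj {g} (lc g (A i))"
| adj_coset': "g \<in> carrier G \<Longrightarrow> i < n \<Longrightarrow> adj (lc g (A i)) {g}"
| adj_x: "g \<in> carrier G \<Longrightarrow> j < k \<Longrightarrow> adj {g} {g \<otimes> x j}"
| adj_x': "g \<in> carrier G \<Longrightarrow> j < k \<Longrightarrow> adj {g \<otimes> x j} {g}"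

lemma adj_sym: "adj P Q \<Longrightarrow> adj Q P"
  by (erule adj.cases) (auto intro: adj.intros)

lemma lc_single [simp]: "lc g {h} = {g \<otimes> h}"
  by (simp add: lc_def)

lemma Vert_carrier: "P \<in> Vert \<Longrightarrow> P \<subseteq> carrier G"
  by (auto simp: Vert_def lc_def)

lemma lc_lc:
  assumes "P \<subseteq> carrier G" "g \<in> carrier G" "h \<in> carrier G"
  shows "lc g (lc h P) = lc (g \<otimes> h) P"
proof -
  have "(\<lambda>p. g \<otimes> (h \<otimes> p)) ` P = (\<lambda>p. g \<otimes> h \<otimes> p) ` P"
    using assms by (intro image_cong) (auto simp: m_assoc)
  then show ?thesis by (simp add: lc_def image_image)
qed

lemma lc_one: "P \<subseteq> carrier G \<Longrightarrow> lc \<one> P = P"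
proof -
  assume "P \<subseteq> carrier G"
  then have "(\<lambda>h. \<one> \<otimes> h) ` P = (\<lambda>h. h) ` P" by (intro image_cong) auto
  then show ?thesis by (simp add: lc_def)
qed

lemma lc_inv:
  assumes "P \<subseteq> carrier G" "g \<in> carrier G"
  shows "lc (inv g) (lc g P) = P" "lc g (lc (inv g) P) = P"
  unfolding lc_lc[OF assms(1) inv_closed[OF assms(2)] assms(2)]
    lc_lc[OF assms(1) assms(2) inv_closed[OF assms(2)]] l_inv[OF assms(2)] r_inv[OF assms(2)]
  by (rule lc_one[OF assms(1)])+

lemma A_sub: "i < n \<Longrightarrow> A i \<subseteq> carrier G"
  by auto

lemma lc_Vert: "P \<in> Vert \<Longrightarrow> h \<in> carrier G \<Longrightarrow> lc h P \<in> Vert"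
proof -
  assume h: "h \<in> carrier G" and "P \<in> Vert"
  then consider g where "P = {g}" "g \<in> carrier G" | g i where "P = lc g (A i)" "g \<in> carrier G" "i < n"
    unfolding Vert_def by blast
  then show ?thesis
  proof cases
    case 1
    then show ?thesis using h Vert_single by simp
  next
    case 2
    then show ?thesis using h lc_lc[OF A_sub] Vert_coset by simp
  qed
qed

lemma adj_lc: "adj P Q \<Longrightarrow> h \<in> carrier G \<Longrightarrow> adj (lc h P) (lc h Q)"
proof (erule adj.cases)
  fix g i assume h: "h \<in> carrier G" "g \<in> carrier G" "i < n"
  then have "lc h (lc g (A i)) = lc (h \<otimes> g) (A i)" using lc_lc[OF A_sub] by simp
  then show "P = {g} \<Longrightarrow> Q = lc g (A i) \<Longrightarrow> adj (lc h P) (lc h Q)"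
    "P = lc g (A i) \<Longrightarrow> Q = {g} \<Longrightarrow> adj (lc h P) (lc h Q)"
    using h adj_coset[of "h \<otimes> g" i] adj_coset'[of "h \<otimes> g" i] by simp_all
next
  fix g j assume h: "h \<in> carrier G" "g \<in> carrier G" "j < k"
  then show "P = {g} \<Longrightarrow> Q = {g \<otimes> x j} \<Longrightarrow> adj (lc h P) (lc h Q)"
    "P = {g \<otimes> x j} \<Longrightarrow> Q = {g} \<Longrightarrow> adj (lc h P) (lc h Q)"
    using adj_x[of "h \<otimes> g" j] adj_x'[of "h \<otimes> g" j] by (simp_all add: m_assoc)
qed

text \<open>Cuts replace paths: a quantity that is invariant along edges is then seen at once to be
  constant on V.\<close>

definition con :: "'a set set \<Rightarrow> bool" where
  "con V \<longleftrightarrow> V \<noteq> {} \<and> (\<forall>S\<subseteq>V. S \<noteq> {} \<longrightarrow> S \<noteq> V \<longrightarrow> (\<exists>P\<in>S. \<exists>Q\<in>V - S. adj P Q))"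

lemma con_single: "con {P}"
  by (auto simp: con_def)

lemma con_cut: "con V \<Longrightarrow> S \<subseteq> V \<Longrightarrow> S \<noteq> {} \<Longrightarrow> S \<noteq> V \<Longrightarrow> \<exists>P\<in>S. \<exists>Q\<in>V - S. adj P Q"
  by (simp add: con_def)

lemma con_union:
  assumes "con V" "con W" "V \<inter> W \<noteq> {}"
  shows "con (V \<union> W)"
  unfolding con_def
proof (intro conjI allI impI)
  show "V \<union> W \<noteq> {}" using assms(3) by auto
next
  fix S assume S: "S \<subseteq> V \<union> W" "S \<noteq> {}" "S \<noteq> V \<union> W"
  obtain R where R: "R \<in> V" "R \<in> W" using assms(3) by auto
  have "S \<inter> V \<noteq> {} \<and> S \<inter> V \<noteq> V \<or> S \<inter> W \<noteq> {} \<and> S \<inter> W \<noteq> W"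
    using S R by blast
  then show "\<exists>P\<in>S. \<exists>Q\<in>V \<union> W - S. adj P Q"
    using con_cut[OF assms(1), of "S \<inter> V"] con_cut[OF assms(2), of "S \<inter> W"] by blast
qed

lemma con_pair: "adj P Q \<Longrightarrow> con {P, Q}"
  unfolding con_def
proof (intro conjI allI impI)
  fix S assume "adj P Q" "S \<subseteq> {P, Q}" "S \<noteq> {}" "S \<noteq> {P, Q}"
  then have "S = {P} \<and> P \<noteq> Q \<or> S = {Q} \<and> P \<noteq> Q" by auto
  then show "\<exists>R\<in>S. \<exists>R'\<in>{P, Q} - S. adj R R'" using \<open>adj P Q\<close> adj_sym by auto
qed simp

lemma con_insert: "con V \<Longrightarrow> P \<in> V \<Longrightarrow> adj P Q \<Longrightarrow> con (insert Q V)"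
proof -
  assume "con V" "P \<in> V" "adj P Q"
  moreover have "insert Q V = V \<union> {P, Q}" using \<open>P \<in> V\<close> by auto
  ultimately show ?thesis using con_union[of V "{P, Q}"] con_pair[of P Q] by auto
qed

lemma con_lc:
  assumes "con V" "h \<in> carrier G"
  shows "con (lc h ` V)"
  unfolding con_def
proof (intro conjI allI impI)
  show "lc h ` V \<noteq> {}" using assms(1) by (simp add: con_def)
next
  fix S assume S: "S \<subseteq> lc h ` V" "S \<noteq> {}" "S \<noteq> lc h ` V"
  let ?T = "{P \<in> V. lc h P \<in> S}"
  have "?T \<noteq> {}" "?T \<noteq> V" using S by auto
  then obtain P Q where "P \<in> ?T" "Q \<in> V - ?T" "adj P Q" using con_cut[OF assms(1), of ?T] by auto
  then show "\<exists>P\<in>S. \<exists>Q\<in>lc h ` V - S. adj P Q"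
    using adj_lc[OF _ assms(2)] by (intro bexI[of _ "lc h P"] bexI[of _ "lc h Q"]) auto
qed

text \<open>Two disjoint connected sets are grown from P and Q, one adjacent vertex at a time, until
  they exhaust V. The graph need not be known to be a tree for this.\<close>

lemma con_split:
  assumes "con V" "finite V" "P \<in> V" "Q \<in> V" "P \<noteq> Q"
  shows "\<exists>V1 V2. V1 \<union> V2 = V \<and> V1 \<inter> V2 = {} \<and> con V1 \<and> con V2 \<and> P \<in> V1 \<and> Q \<in> V2 \<and>
    (\<exists>c\<in>V1. \<exists>d\<in>V2. adj c d)"
proof -
  have "\<exists>V1 V2. V1 \<union> V2 = V \<and> V1 \<inter> V2 = {} \<and> con V1 \<and> con V2 \<and> P \<in> V1 \<and> Q \<in> V2"
    if "W1 \<union> W2 \<subseteq> V" "W1 \<inter> W2 = {}" "con W1" "con W2" "P \<in> W1" "Q \<in> W2" for W1 W2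
    using that
  proof (induction "card (V - (W1 \<union> W2))" arbitrary: W1 W2 rule: less_induct)
    case less
    show ?case
    proof (cases "W1 \<union> W2 = V")
      case True
      then show ?thesis using less.prems by blast
    next
      case False
      then obtain R R' where R: "R \<in> W1 \<union> W2" "R' \<in> V - (W1 \<union> W2)" "adj R R'"
        using con_cut[OF assms(1), of "W1 \<union> W2"] less.prems by auto
      have fin: "finite (V - (W1 \<union> W2))" using assms(2) by simp
      show ?thesis
      proof (cases "R \<in> W1")
        case True
        have "card (V - (insert R' W1 \<union> W2)) < card (V - (W1 \<union> W2))"
          using R(2) fin by (intro psubset_card_mono) auto
        then show ?thesis using less.hyps[of "insert R' W1" W2] less.prems R con_insert[OF _ True R(3)] by auto
      next
        case False
        then have RW: "R \<in> W2" using R(1) by auto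
        have "card (V - (W1 \<union> insert R' W2)) < card (V - (W1 \<union> W2))"
          using R(2) fin by (intro psubset_card_mono) auto
        then show ?thesis using less.hyps[of W1 "insert R' W2"] less.prems R con_insert[OF _ RW R(3)] by auto
      qed
    qed
  qed
  from this[of "{P}" "{Q}"] obtain V1 V2 where V: "V1 \<union> V2 = V" "V1 \<inter> V2 = {}" "con V1" "con V2"
    "P \<in> V1" "Q \<in> V2" using assms con_single by auto
  moreover have "V1 \<noteq> {}" "V1 \<noteq> V" "V - V1 = V2" using V by auto
  ultimately show ?thesis using con_cut[OF assms(1), of V1] by blast
qed

text \<open>Multiplying \<open>g\<close> by a letter on the left translates a connected set through
  1 and \<open>g\<close>; a short piece from 1 to the letter, through the coset \<open>A i\<close>
  in the case of a factor, closes the gap.\<close>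

lemma con_to_element:
  assumes "g \<in> carrier G"
  shows "\<exists>V. finite V \<and> con V \<and> V \<subseteq> Vert \<and> {\<one>} \<in> V \<and> {g} \<in> V"
  using assms
proof (induction rule: factors_induct)
  case one
  show ?case using con_single[of "{\<one>}"] by (intro exI[of _ "{{\<one>}}"]) (auto simp: Vert_def)
next
  case (factor i a g)
  then obtain V where V: "finite V" "con V" "V \<subseteq> Vert" "{\<one>} \<in> V" "{g} \<in> V" by blast
  have a: "a \<in> carrier G" using factor by simp
  have Ai: "lc \<one> (A i) = lc a (A i)"
  proof -
    have "lc a (A i) = A i"
    proof
      show "lc a (A i) \<subseteq> A i" using factor by (auto simp: lc_def)
      show "A i \<subseteq> lc a (A i)"
      proof
        fix b assume "b \<in> A i"
        then have "b = a \<otimes> (inv a \<otimes> b)" "inv a \<otimes> b \<in> A i" using factor a A_closed[of b i] by auto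
        then show "b \<in> lc a (A i)" unfolding lc_def by (metis imageI)
      qed
    qed
    then show ?thesis using lc_one[OF A_sub] factor by simp
  qed
  have "adj {\<one>} (lc \<one> (A i))" "adj (lc \<one> (A i)) {a}"
    using adj_coset[of \<one> i] adj_coset'[of a i] a factor unfolding Ai by simp_all
  then have "con {{\<one>}, lc \<one> (A i), {a}}"
    using con_insert[OF con_pair, of "{\<one>}" "lc \<one> (A i)" "lc \<one> (A i)" "{a}"]
    by (simp add: insert_commute)
  moreover have "con (lc a ` V)" using con_lc V a by simp
  moreover have "{a} \<in> lc a ` V" using V(4) a by (intro image_eqI[of _ _ "{\<one>}"]) auto
  ultimately have "con ({{\<one>}, lc \<one> (A i), {a}} \<union> lc a ` V)" by (intro con_union) auto
  moreover have "{a \<otimes> g} \<in> lc a ` V" using V(5) by (intro image_eqI[of _ _ "{g}"]) auto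
  moreover have "{{\<one>}, lc \<one> (A i), {a}} \<union> lc a ` V \<subseteq> Vert"
    using V(3) a lc_Vert factor(1) Vert_single Vert_coset by auto
  ultimately show ?case using V(1) by (intro exI[of _ "{{\<one>}, lc \<one> (A i), {a}} \<union> lc a ` V"]) auto
next
  case (basis j g y)
  then obtain V where V: "finite V" "con V" "V \<subseteq> Vert" "{\<one>} \<in> V" "{g} \<in> V" by blast
  have y: "y \<in> carrier G" using basis by auto
  have "adj {\<one>} {y}" using basis adj_x[of \<one> j] adj_x'[of "inv (x j)" j] by auto
  then have "con {{\<one>}, {y}}" by (rule con_pair)
  moreover have "con (lc y ` V)" using con_lc V y by simp
  moreover have "{y} \<in> lc y ` V" using V(4) y by (intro image_eqI[of _ _ "{\<one>}"]) auto
  ultimately have "con ({{\<one>}, {y}} \<union> lc y ` V)" by (intro con_union) auto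
  moreover have "{y \<otimes> g} \<in> lc y ` V" using V(5) by (intro image_eqI[of _ _ "{g}"]) auto
  moreover have "{{\<one>}, {y}} \<union> lc y ` V \<subseteq> Vert" using V(3) y lc_Vert Vert_single by auto
  ultimately show ?case using V(1) by (intro exI[of _ "{{\<one>}, {y}} \<union> lc y ` V"]) auto
qed

lemma con_to_vertices:
  assumes "finite W" "W \<subseteq> Vert"
  shows "\<exists>V. finite V \<and> con V \<and> V \<subseteq> Vert \<and> {\<one>} \<in> V \<and> W \<subseteq> V"
  using assms
proof (induction W)
  case empty
  then show ?case using con_to_element[of \<one>] by auto
next
  case (insert P W)
  then obtain V where V: "finite V" "con V" "V \<subseteq> Vert" "{\<one>} \<in> V" "W \<subseteq> V" by auto
  have "\<exists>U. finite U \<and> con U \<and> U \<subseteq> Vert \<and> {\<one>} \<in> U \<and> P \<in> U"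
  proof (cases "\<exists>g\<in>carrier G. P = {g}")
    case True
    then show ?thesis using con_to_element by auto
  next
    case False
    then obtain g i where P: "P = lc g (A i)" "g \<in> carrier G" "i < n" using insert.prems by (auto simp: Vert_def)
    obtain U where U: "finite U" "con U" "U \<subseteq> Vert" "{\<one>} \<in> U" "{g} \<in> U" using con_to_element[OF P(2)] by auto
    then show ?thesis using con_insert[OF U(2,5) adj_coset[OF P(2,3)]] P
      by (intro exI[of _ "insert P U"]) (auto simp: Vert_def)
  qed
  then obtain U where U: "finite U" "con U" "U \<subseteq> Vert" "{\<one>} \<in> U" "P \<in> U" by blast
  have "con (V \<union> U)" using con_union[OF V(2) U(2)] V(4) U(4) by blast
  then show ?case using V U by (intro exI[of _ "V \<union> U"]) auto
qed

end

section \<open>Merging vertices\<close>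

context fr_data
begin

lemma lc_closed: "P \<subseteq> carrier G \<Longrightarrow> g \<in> carrier G \<Longrightarrow> lc g P \<subseteq> carrier G"
  by (auto simp: lc_def)

lemma lc_self: "g \<in> carrier G \<Longrightarrow> i < n \<Longrightarrow> g \<in> lc g (A i)"
  using imageI[of \<one> "A i" "\<lambda>h. g \<otimes> h"] A_ops(1)[of i] by (simp add: lc_def)

lemma lc_A:
  assumes "i < n" "a \<in> A i"
  shows "lc a (A i) = A i"
proof
  show "lc a (A i) \<subseteq> A i" using assms by (auto simp: lc_def)
  show "A i \<subseteq> lc a (A i)"
  proof
    fix b assume b: "b \<in> A i"
    have "a \<in> carrier G" "b \<in> carrier G" using assms b by simp_all
    then have "b = a \<otimes> (inv a \<otimes> b)" by simp
    moreover have "inv a \<otimes> b \<in> A i" using assms b by simp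
    ultimately show "b \<in> lc a (A i)" unfolding lc_def by (metis imageI)
  qed
qed

text \<open>Links begin as equalities, in \<open>dichotomy\<close> with the vertex of
  \<open>y j\<close>; \<open>merge_core\<close> creates adjacencies, and in a state without merges
  only these survive.\<close>

definition linked :: "'a set set \<Rightarrow> 'a \<Rightarrow> bool" where
  "linked V y \<longleftrightarrow> (\<exists>P\<in>V. \<exists>Q\<in>V. P = lc y Q \<or> adj P (lc y Q))"

definition state :: "'a set set \<Rightarrow> (nat \<Rightarrow> 'a) \<Rightarrow> (nat \<Rightarrow> 'a) \<Rightarrow> bool" where
  "state V t y \<longleftrightarrow> finite V \<and> con V \<and> V \<subseteq> Vert \<and> {\<one>} \<in> V \<and> tup t y \<and>
     (\<forall>i<n. lc (t i) (A i) \<in> V) \<and> (\<forall>j<k. linked V (y j))"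

text \<open>Changing the spanning tree: the part \<open>V2\<close> is cut off at the edge \<open>c\<close>--\<open>d\<close> and glued back by
  \<open>h\<close>, and if \<open>h\<close> is one of the \<open>y j\<close>, the cut edge becomes the new link of its inverse.\<close>

lemma merge_core:
  assumes fin: "finite (V1 \<union> V2)" and con: "con V1" "con V2" and vert: "V1 \<union> V2 \<subseteq> Vert"
    and disj: "V1 \<inter> V2 = {}" and cut: "c \<in> V1" "d \<in> V2" "adj c d" and base: "{\<one>} \<in> V1"
    and tup: "tup t y" and tV: "\<And>i. i < n \<Longrightarrow> lc (t i) (A i) \<in> V1 \<union> V2"
    and lett: "lett t y ix h" and h_y: "n \<le> ix \<Longrightarrow> h = y (ix - n)"
    and links: "\<And>j. j < k \<Longrightarrow> n + j \<noteq> ix \<Longrightarrow> linked (V1 \<union> V2) (y j)"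
    and Q0: "Q0 \<in> V2" "lc h Q0 \<in> V1"
  shows "\<exists>V' t' y'. moves (t, y) (t', y') \<and> state V' t' y' \<and> card V' < card (V1 \<union> V2)"
proof -
  have h: "h \<in> carrier G" by (rule lett_closed[OF tup lett])
  have tc: "t i \<in> carrier G" if "i < n" for i using tup that by (simp add: tup_def)
  have yc: "y j \<in> carrier G" if "j < k" for j using tup that by (simp add: tup_def)
  have sub: "R \<subseteq> carrier G" if "R \<in> V1 \<union> V2" for R using vert that Vert_carrier by blast
  have "\<forall>j. \<exists>PQ. j < k \<and> n + j \<noteq> ix \<longrightarrow> fst PQ \<in> V1 \<union> V2 \<and> snd PQ \<in> V1 \<union> V2 \<and>
      (fst PQ = lc (y j) (snd PQ) \<or> adj (fst PQ) (lc (y j) (snd PQ)))"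
    using links unfolding linked_def by (metis fst_conv snd_conv)
  then obtain PQ where PQ: "\<And>j. j < k \<Longrightarrow> n + j \<noteq> ix \<Longrightarrow> fst (PQ j) \<in> V1 \<union> V2 \<and> snd (PQ j) \<in> V1 \<union> V2 \<and>
      (fst (PQ j) = lc (y j) (snd (PQ j)) \<or> adj (fst (PQ j)) (lc (y j) (snd (PQ j))))" by metis
  define P where "P j = fst (PQ j)" for j
  define Q where "Q j = snd (PQ j)" for j
  have PQ: "P j \<in> V1 \<union> V2" "Q j \<in> V1 \<union> V2" "P j = lc (y j) (Q j) \<or> adj (P j) (lc (y j) (Q j))"
    if "j < k" "n + j \<noteq> ix" for j using PQ[OF that] by (auto simp: P_def Q_def)
  \<comment> \<open>Data attached to \<open>V2\<close> travel with it: a coset there gets its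
    \<open>t i\<close> multiplied by \<open>h\<close>, and \<open>y j\<close> gains \<open>h\<close>
    on the left if the near end \<open>P j\<close> of its link is moved, and the inverse of
    \<open>h\<close> on the right if the far end \<open>Q j\<close> is.\<close>
  define T where "T = {i. i < n \<and> i \<noteq> ix \<and> lc (t i) (A i) \<in> V2}"
  define M1 where "M1 = {j. j < k \<and> n + j \<noteq> ix \<and> P j \<in> V2}"
  define M2 where "M2 = {j. j < k \<and> n + j \<noteq> ix \<and> Q j \<in> V2}"
  define t' where "t' = (\<lambda>i. if i \<in> T then h \<otimes> t i else t i)"
  define y1 where "y1 = (\<lambda>l. if l \<in> M1 then h \<otimes> y l else y l)"
  define y2 where "y2 = (\<lambda>l. if l \<in> M2 then y1 l \<otimes> inv h else y1 l)"
  \<comment> \<open>When \<open>h\<close> is itself an entry, it is inverted, because its new link,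
    across the cut edge, is stated for the inverse.\<close>
  define y3 where "y3 = (if ix < n then y2 else y2(ix - n := inv (y2 (ix - n))))"
  have mt: "moves (t, y) (t', y)" unfolding t'_def
    by (rule moves_t[OF _ _ _ lett]) (auto simp: T_def)
  have "lett t' y ix h" using lett by (auto simp: lett_def t'_def T_def)
  then have my1: "moves (t', y) (t', y1)" unfolding y1_def
    by (rule moves_y_left[rotated 2]) (auto simp: M1_def)
  have tup1: "tup t' y1" using moves_tup[OF mt] moves_tup[OF my1] tup by simp
  have l1: "lett t' y1 ix h" using lett by (auto simp: lett_def t'_def T_def y1_def M1_def)
  have my2: "moves (t', y1) (t', y2)" unfolding y2_def
    by (rule moves_y_right[OF tup1 _ _ lett_inv[OF tup1 l1]]) (auto simp: M2_def)
  have my3: "moves (t', y2) (t', y3)"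
  proof (cases "ix < n")
    case False
    then have "ix - n < k" using lett by (auto simp: lett_def)
    then show ?thesis using move_inv[of "ix - n" t' y2] False by (simp add: y3_def r_into_rtranclp)
  qed (simp add: y3_def)
  have mv: "moves (t, y) (t', y3)" using mt my1 my2 my3 by (meson rtranclp_trans)
  let ?V = "V1 \<union> lc h ` V2"
  have "state ?V t' y3" unfolding state_def
  proof (intro conjI allI impI)
    show "finite ?V" using fin by simp
    show "con ?V" using con_union[OF con(1) con_lc[OF con(2) h]] Q0 by blast
    show "?V \<subseteq> Vert" using vert lc_Vert h by auto
    show "{\<one>} \<in> ?V" using base by simp
    show "tup t' y3" using moves_tup[OF mv] tup by simp
    fix i assume i: "i < n"
    show "lc (t' i) (A i) \<in> ?V"
    proof (cases "lc (t i) (A i) \<in> V1")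
      case True
      then have "i \<notin> T" using disj by (auto simp: T_def)
      then show ?thesis using True by (simp add: t'_def)
    next
      case False
      then have V2: "lc (t i) (A i) \<in> V2" using tV[OF i] by simp
      have "lc (t' i) (A i) = lc h (lc (t i) (A i))"
      proof (cases "i = ix")
        case False
        then show ?thesis using V2 i lc_lc[OF A_sub[OF i] h tc[OF i]] by (simp add: t'_def T_def)
      next
        \<comment> \<open>The letter stems from the conjugate of \<open>A i\<close> itself, so it
          stabilises this coset and \<open>t i\<close> may stay.\<close>
        case True
        then obtain a where a: "a \<in> A i" "h = t i \<otimes> a \<otimes> inv (t i)" using lett i by (auto simp: lett_def)
        have ac: "a \<in> carrier G" using a i by simp
        have "lc h (lc (t i) (A i)) = lc (t i \<otimes> a) (A i)"
          using lc_lc[OF A_sub[OF i] h tc[OF i]] tc[OF i] ac by (simp add: a(2) m_assoc)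
        also have "\<dots> = lc (t i) (A i)"
          using lc_lc[OF A_sub[OF i] tc[OF i] ac] lc_A[OF i a(1)] by simp
        finally show ?thesis using True by (simp add: t'_def T_def)
      qed
      then show ?thesis using V2 by auto
    qed
  next
    fix j assume j: "j < k"
    show "linked ?V (y3 j)"
    proof (cases "n + j = ix")
      case True
      then have "j \<notin> M1" "j \<notin> M2" by (auto simp: M1_def M2_def)
      then have "y3 j = inv h" using True h_y by (auto simp: y3_def y2_def y1_def)
      \<comment> \<open>The old edge between \<open>c\<close> and \<open>d\<close> reappears as the
        link between \<open>c\<close> and \<open>lc h d\<close>.\<close>
      then have "lc (y3 j) (lc h d) = d" using lc_inv(1)[OF sub h] cut(2) by simp
      then show ?thesis unfolding linked_def using cut by (intro bexI[of _ c] bexI[of _ "lc h d"]) auto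
    next
      case False
      note pq = PQ[OF j False]
      have y3: "y3 j = (if j \<in> M2 then (if j \<in> M1 then h \<otimes> y j else y j) \<otimes> inv h
          else (if j \<in> M1 then h \<otimes> y j else y j))"
        using False by (auto simp: y3_def y2_def y1_def)
      have m: "j \<in> M1 \<longleftrightarrow> P j \<in> V2" "j \<in> M2 \<longleftrightarrow> Q j \<in> V2" using j False by (auto simp: M1_def M2_def)
      define P' where "P' = (if P j \<in> V2 then lc h (P j) else P j)"
      define Q' where "Q' = (if Q j \<in> V2 then lc h (Q j) else Q j)"
      have "P' \<in> ?V" "Q' \<in> ?V" using pq by (auto simp: P'_def Q'_def)
      moreover have "lc (y3 j) Q' = (if P j \<in> V2 then lc h (lc (y j) (Q j)) else lc (y j) (Q j))"
        using sub[OF pq(2)] yc[OF j] h unfolding y3 m Q'_def by (simp add: lc_lc m_assoc)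
      then have "P' = lc (y3 j) Q' \<or> adj P' (lc (y3 j) Q')"
        using pq(3) adj_lc[OF _ h] by (auto simp: P'_def)
      ultimately show ?thesis unfolding linked_def by blast
    qed
  qed
  moreover have "card ?V < card (V1 \<union> V2)"
  proof -
    have f: "finite V1" "finite V2" using fin by auto
    \<comment> \<open>The translate of \<open>Q0\<close> already lies in \<open>V1\<close>, so at
      least one vertex is lost.\<close>
    have "?V = V1 \<union> lc h ` (V2 - {Q0})" using Q0 by auto
    then have "card ?V \<le> card V1 + card (lc h ` (V2 - {Q0}))" using card_Un_le by metis
    also have "\<dots> \<le> card V1 + card (V2 - {Q0})" using f by (simp add: card_image_le)
    also have "\<dots> < card V1 + card V2" using Q0(1) f(2) by (simp add: card_gt_0_iff card_Diff_singleton)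
      (metis card_gt_0_iff diff_less empty_iff zero_less_one One_nat_def)
    also have "\<dots> = card (V1 \<union> V2)" using disj f by (simp add: card_Un_disjoint)
    finally show ?thesis .
  qed
  ultimately show ?thesis using mv by blast
qed

text \<open>Two adjustments lead to \<open>merge_core\<close>: the part containing the vertex of 1
  must stay put, so if necessary the parts change roles and the inverse letter is used; and a letter
  that is an inverted entry is preceded by an inversion move.\<close>

lemma merge:
  assumes fin: "finite V" and con: "con V" and vert: "V \<subseteq> Vert" and base: "{\<one>} \<in> V"
    and tup: "tup t y" and tV: "\<And>i. i < n \<Longrightarrow> lc (t i) (A i) \<in> V"
    and lett: "lett t y ix h"
    and links: "\<And>j. j < k \<Longrightarrow> n + j \<noteq> ix \<Longrightarrow> linked V (y j)"
    and Q: "Q \<in> V" "lc h Q \<in> V" "lc h Q \<noteq> Q"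
  shows "\<exists>V' t' y'. moves (t, y) (t', y') \<and> state V' t' y' \<and> card V' < card V"
proof -
  have core: "\<exists>V' t' y'. moves (t, y) (t', y') \<and> state V' t' y' \<and> card V' < card (V1 \<union> V2)"
    if V12: "V1 \<union> V2 = V" "V1 \<inter> V2 = {}" "con V1" "con V2" and cd: "c \<in> V1" "d \<in> V2" "adj c d"
      and b: "{\<one>} \<in> V1" and l: "lett t y ix g" and R: "R \<in> V2" "lc g R \<in> V1" for V1 V2 c d g R
  proof (cases "n \<le> ix \<and> g \<noteq> y (ix - n)")
    case False
    show ?thesis
      by (rule merge_core[OF _ V12(3,4) _ V12(2) cd b tup _ l _ _ R])
         (use False V12(1) fin vert tV links in auto)
  next
    case True
    then have g: "g = inv (y (ix - n))" "ix - n < k" using l by (auto simp: lett_def)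
    let ?y = "y(ix - n := inv (y (ix - n)))"
    have m: "move (t, y) (t, ?y)" by (rule move_inv[OF g(2)])
    have "\<exists>V' t' y'. moves (t, ?y) (t', y') \<and> state V' t' y' \<and> card V' < card (V1 \<union> V2)"
    proof (rule merge_core[OF _ V12(3,4) _ V12(2) cd b move_tup[OF m tup] _ _ _ _ R])
      show "lett t ?y ix g" using True g l by (auto simp: lett_def)
      show "linked (V1 \<union> V2) (?y j)" if "j < k" "n + j \<noteq> ix" for j
        using links[OF that] that True V12(1) by auto
    qed (use g V12(1) fin vert tV in auto)
    then show ?thesis using m by (meson converse_rtranclp_into_rtranclp)
  qed
  obtain V1 V2 c d where V: "V1 \<union> V2 = V" "V1 \<inter> V2 = {}" "con V1" "con V2" "lc h Q \<in> V1" "Q \<in> V2"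
    "c \<in> V1" "d \<in> V2" "adj c d" using con_split[OF con fin Q(2,1,3)] by blast
  have h: "h \<in> carrier G" by (rule lett_closed[OF tup lett])
  show ?thesis
  proof (cases "{\<one>} \<in> V1")
    case True
    then show ?thesis using core[OF V(1-4,7-9) True lett V(6,5)] V(1) by simp
  next
    case False
    then have b: "{\<one>} \<in> V2" using V(1) base by blast
    have "lc (inv h) (lc h Q) = Q" using lc_inv(1)[OF _ h] Q(1) vert Vert_carrier by blast
    then have R: "lc h Q \<in> V1" "lc (inv h) (lc h Q) \<in> V2" using V by auto
    show ?thesis
      using core[OF _ _ V(4,3) V(8,7) adj_sym[OF V(9)] b lett_inv[OF tup lett] R] V(1,2) by (simp add: Un_commute Int_commute)
  qed
qed

text \<open>Vertex stabilisers are trivial or conjugates of some \<open>A i\<close>, and parities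
  vanish on both.\<close>

lemma stabilizer_par:
  assumes "Q \<in> Vert" "h \<in> carrier G" "lc h Q = Q"
  shows "\<not> par \<Lambda> h"
proof -
  from assms(1) consider g where "Q = {g}" "g \<in> carrier G" | g i where "Q = lc g (A i)" "g \<in> carrier G" "i < n"
    unfolding Vert_def by blast
  then show ?thesis
  proof cases
    case 1
    then have "h \<otimes> g = g" using assms(3) by simp
    then show ?thesis using 1 assms(2) r_cancel_one by simp
  next
    case 2
    have "g \<in> Q" using lc_self 2 by simp
    then have "h \<otimes> g \<in> Q" using assms(3) by (metis lc_def imageI)
    then obtain a where a: "a \<in> A i" "h \<otimes> g = g \<otimes> a" using 2 by (auto simp: lc_def)
    have "a \<in> carrier G" using a 2 by simp
    then have "par \<Lambda> h = (par \<Lambda> (g \<otimes> a) \<noteq> par \<Lambda> g)" using a(2) assms(2) 2 par_mult[of h g \<Lambda>] by auto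
    also have "\<dots> = par \<Lambda> a" using 2 \<open>a \<in> carrier G\<close> by auto
    finally show ?thesis using a 2 by simp
  qed
qed

end

section \<open>States that admit no merge\<close>

context fr_data
begin

lemma coset_not_single: "i < n \<Longrightarrow> g \<in> carrier G \<Longrightarrow> lc g (A i) \<noteq> {h}"
proof
  assume i: "i < n" "g \<in> carrier G" and eq: "lc g (A i) = {h}"
  obtain a where a: "a \<in> A i" "a \<noteq> \<one>" using nontrivial[OF i(1)] A_ops(1)[of i] i by fastforce
  then have "g \<otimes> a \<in> lc g (A i)" "g \<in> lc g (A i)" using i lc_self by (auto simp: lc_def)
  then have "g \<otimes> a = g" using eq by auto
  then show False using a i A_closed[OF a(1)] by simp
qed

lemma A_inter: "i < n \<Longrightarrow> i' < n \<Longrightarrow> a \<in> A i \<Longrightarrow> a \<in> A i' \<Longrightarrow> a \<noteq> \<one> \<Longrightarrow> i = i'"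
proof (rule ccontr)
  assume a: "i < n" "i' < n" "a \<in> A i" "a \<in> A i'" "a \<noteq> \<one>" "i \<noteq> i'"
  have c: "a \<in> carrier G" "inv a \<noteq> \<one>" using a A_closed[of a i] by auto
  have "foldr (\<otimes>) (map snd [(i, a), (i', inv a)]) \<one> \<noteq> \<one>"
    using free_product_factors[unfolded free_product_def, THEN conjunct2, THEN conjunct2, rule_format,
        of "[(i, a), (i', inv a)]"] a c by simp
  then show False using c by simp
qed

lemma lc_mem: "i < n \<Longrightarrow> g \<in> carrier G \<Longrightarrow> p \<in> lc g (A i) \<Longrightarrow> lc p (A i) = lc g (A i)"
proof -
  assume i: "i < n" "g \<in> carrier G" "p \<in> lc g (A i)"
  then obtain a where a: "a \<in> A i" "p = g \<otimes> a" by (auto simp: lc_def)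
  have "a \<in> carrier G" using a i by simp
  then show ?thesis using lc_lc[OF A_sub[OF i(1)] i(2), of a] lc_A[OF i(1) a(1)] a by simp
qed

text \<open>Makes the index of a coset vertex recoverable from the set alone, as the definition of
  \<open>pos\<close> in \<open>terminal_decided\<close> requires.\<close>

lemma coset_type:
  assumes "i < n" "i' < n" "g \<in> carrier G" "g' \<in> carrier G" "lc g (A i) = lc g' (A i')"
  shows "i = i'"
proof -
  obtain a where a: "a \<in> A i" "a \<noteq> \<one>" using nontrivial[OF assms(1)] A_ops(1)[of i] assms(1) by fastforce
  have ac: "a \<in> carrier G" using a assms by simp
  have "g \<in> lc g' (A i')" using lc_self assms by blast
  then have "lc g (A i') = lc g (A i)" using lc_mem[OF assms(2,4)] assms(5) by simp
  moreover have "g \<otimes> a \<in> lc g (A i)" using a by (auto simp: lc_def)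
  ultimately obtain b where b: "b \<in> A i'" "g \<otimes> a = g \<otimes> b" by (auto simp: lc_def)
  then have "a = b" using assms(2,3) ac A_closed[of b i'] by simp
  then show ?thesis using A_inter assms a b by blast
qed

text \<open>An action of \<open>A i\<close> in which prescribed points lie in prescribed regular orbits, one orbit
  being degenerate, and all others of the given points are moved.\<close>

lemma ex_factor_action:
  fixes att :: "'a \<Rightarrow> ('a set \<times> 'a) option"
  assumes i: "i < n" and fin: "finite S" "finite V" and z: "inj_on z S"
    and att: "\<And>p K b. p \<in> S \<Longrightarrow> att p = Some (K, b) \<Longrightarrow> K \<in> V \<and> b \<in> A i"
    and att_inj: "\<And>p p' K b. p \<in> S \<Longrightarrow> p' \<in> S \<Longrightarrow> att p = Some (K, b) \<Longrightarrow> att p' = Some (K, b) \<Longrightarrow> p = p'"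
    and att_K0: "\<And>p p' b b'. p \<in> S \<Longrightarrow> p' \<in> S \<Longrightarrow> att p = Some (K0, b) \<Longrightarrow> att p' = Some (K0, b') \<Longrightarrow> p = p'"
  shows "\<exists>L \<zeta>. (\<forall>K. \<forall>a\<in>A i. \<forall>b\<in>A i.
        swaps L (alpha i a (swaps (rev L) (\<zeta> K b))) = \<zeta> K (b \<otimes> inv a)) \<and>
      (\<forall>b. \<zeta> K0 b = \<zeta> K0 \<one>) \<and>
      (\<forall>p\<in>S. \<forall>K b. att p = Some (K, b) \<longrightarrow> z p = \<zeta> K b) \<and>
      (\<forall>p\<in>S. (\<forall>a\<in>A i. swaps L (alpha i a (swaps (rev L) (z p))) = z p) \<longrightarrow> (\<exists>b. att p = Some (K0, b)))"
proof -
  obtain \<kappa> :: "'a set \<Rightarrow> nat" where k: "inj_on \<kappa> V" using fin(2) finite_imp_inj_to_nat_seg by blast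
  \<comment> \<open>Cosets use orbits with odd first component, points without a coset use even
    positive ones, and \<open>K0\<close> collapses to the fixed point with code (0, 0), so the
    positions cannot clash.\<close>
  define pt where "pt K b = (if K = K0 then prod_encode (0, 0) else prod_encode (Suc (2 * \<kappa> K), enc i b))" for K b
  define \<tau> where "\<tau> p = (case att p of Some (K, b) \<Rightarrow> pt K b
      | None \<Rightarrow> prod_encode (Suc (Suc (2 * z p)), enc i \<one>))" for p
  have one: "\<one> \<in> A i" using i by simp
  have enc: "enc i a = enc i b \<longleftrightarrow> a = b" if "a \<in> A i" "b \<in> A i" for a b
    using inj_on_eq_iff[OF enc_inj[OF i]] that by blast
  have odd: "Suc (2 * m) \<noteq> 2 * l" "2 * l \<noteq> Suc (2 * m)" for m l :: nat by presburger+
  have "inj_on \<tau> S"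
  proof (rule inj_onI)
    fix p p' assume p: "p \<in> S" "p' \<in> S" "\<tau> p = \<tau> p'"
    show "p = p'"
    proof (cases "att p")
      case None
      show ?thesis
      proof (cases "att p'")
        case None': None
        then show ?thesis using None p inj_onD[OF z] by (simp add: \<tau>_def)
      next
        case (Some Kb)
        then show ?thesis using None p by (cases Kb) (auto simp: \<tau>_def pt_def odd split: if_splits)
      qed
    next
      case (Some Kb)
      obtain K b where Kb: "att p = Some (K, b)" using Some by (cases Kb) auto
      show ?thesis
      proof (cases "att p'")
        case None
        then show ?thesis using Kb p by (auto simp: \<tau>_def pt_def odd split: if_splits)
      next
        case (Some Kb')
        obtain K' b' where Kb': "att p' = Some (K', b')" using Some by (cases Kb') auto
        have "pt K b = pt K' b'" using p Kb Kb' by (simp add: \<tau>_def)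
        then have "K = K0 \<and> K' = K0 \<or> K = K' \<and> b = b'"
          using att[OF p(1) Kb] att[OF p(2) Kb'] inj_onD[OF k] enc
          by (auto simp: pt_def split: if_splits)
        then show ?thesis using att_K0[OF p(1,2)] att_inj[OF p(1,2)] Kb Kb' by auto
      qed
    qed
  qed
  \<comment> \<open>Conjugating by \<open>L\<close> renames the model positions to the prescribed
    numbers \<open>z p\<close>.\<close>
  then obtain L where L: "\<And>p. p \<in> S \<Longrightarrow> swaps L (\<tau> p) = z p" using ex_swaps[OF fin(1) _ z] by blast
  define \<zeta> where "\<zeta> K b = swaps L (pt K b)" for K b
  have "swaps L (alpha i a (swaps (rev L) (\<zeta> K b))) = \<zeta> K (b \<otimes> inv a)" if "a \<in> A i" "b \<in> A i" for K a b
    using alpha_enc[OF i that(2)] by (simp add: \<zeta>_def pt_def)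
  moreover have "\<zeta> K0 b = \<zeta> K0 \<one>" for b by (simp add: \<zeta>_def pt_def)
  moreover have "z p = \<zeta> K b" if "p \<in> S" "att p = Some (K, b)" for p K b
    using L[OF that(1)] that(2) by (simp add: \<zeta>_def \<tau>_def)
  moreover have "\<exists>b. att p = Some (K0, b)"
    if p: "p \<in> S" and fixed: "\<forall>a\<in>A i. swaps L (alpha i a (swaps (rev L) (z p))) = z p" for p
  proof (rule ccontr)
    assume no: "\<nexists>b. att p = Some (K0, b)"
    obtain c b where cb: "b \<in> A i" "\<tau> p = prod_encode (Suc c, enc i b)"
    proof (cases "att p")
      case None
      then show ?thesis using that[OF one, of "Suc (2 * z p)"] by (simp add: \<tau>_def)
    next
      case (Some Kb)
      then obtain K b where "att p = Some (K, b)" by (cases Kb) auto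
      then show ?thesis using that[of b "2 * \<kappa> K"] att[OF p] no by (auto simp: \<tau>_def pt_def)
    qed
    \<comment> \<open>A nontrivial element has no fixed point in a regular orbit, so the point
      cannot be fixed by all of \<open>A i\<close>.\<close>
    obtain a where a: "a \<in> A i" "a \<noteq> \<one>" using nontrivial[OF i] one by fastforce
    have "swaps (rev L) (z p) = \<tau> p" using L[OF p, symmetric] by simp
    then have "swaps L (alpha i a (\<tau> p)) = swaps L (\<tau> p)" using fixed a(1) L[OF p] by auto
    then have "alpha i a (\<tau> p) = \<tau> p" using swaps_rev(2) by metis
    then have "enc i (b \<otimes> inv a) = enc i b" using alpha_enc[OF i cb(1)] cb(2) by simp
    then have "b \<otimes> inv a = b" using enc cb(1) a(1) i by simp
    moreover have c: "a \<in> carrier G" "b \<in> carrier G" using a(1) cb(1) i by simp_all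
    ultimately have "inv a = \<one>" using inv_cancel(1)[of b "inv a"] by simp
    then show False using a(2) c(1) by (simp add: inv_eq_1_iff)
  qed
  ultimately show ?thesis by (intro exI[of _ L] exI[of _ \<zeta>]) blast
qed

text \<open>A pair (p, q) asks for q to be sent to p. Besides extending this partial injection, the
  permutation sends \<open>p0\<close> to a fresh number if nothing is prescribed for it.\<close>

lemma ex_partial_permutation:
  assumes "finite S" "inj_on z S" "R \<subseteq> S \<times> S" "p0 \<in> S"
    and "\<And>p q q'. (p, q) \<in> R \<Longrightarrow> (p, q') \<in> R \<Longrightarrow> q = q'"
    and "\<And>p p' q. (p, q) \<in> R \<Longrightarrow> (p', q) \<in> R \<Longrightarrow> p = p'"
  shows "\<exists>L. (\<forall>(p, q)\<in>R. swaps L (z q) = z p) \<and> ((\<forall>p. (p, p0) \<notin> R) \<longrightarrow> swaps L (z p0) \<noteq> z p0)"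
proof -
  have "finite (z ` S)" using assms(1) by simp
  then obtain M where M: "M \<notin> z ` S" using ex_new_if_finite infinite_UNIV_nat by blast
  define T where "T = insert p0 (snd ` R)"
  define g where "g q = (if q \<in> snd ` R then z (THE p. (p, q) \<in> R) else M)" for q
  have the: "(THE p. (p, q) \<in> R) = p" if "(p, q) \<in> R" for p q using that assms(6) by blast
  have T: "T \<subseteq> S" using assms(3,4) by (auto simp: T_def)
  have "inj_on g T"
  proof (rule inj_onI)
    fix q q' assume q: "q \<in> T" "q' \<in> T" "g q = g q'"
    have gz: "g q = z p \<and> p \<in> S" if "(p, q) \<in> R" for p q
      using that the[OF that] assms(3) by (force simp: g_def)
    show "q = q'"
    proof (cases "q \<in> snd ` R")
      case True
      then obtain p where p: "(p, q) \<in> R" by auto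
      have "g q' \<noteq> M" using gz[OF p] q M by auto
      then obtain p' where p': "(p', q') \<in> R" by (auto simp: g_def split: if_splits)
      have "z p = z p'" using gz[OF p] gz[OF p'] q by simp
      then have "p = p'" using inj_onD[OF assms(2)] gz[OF p] gz[OF p'] by blast
      then show ?thesis using assms(5) p p' by blast
    next
      case False
      have "g q = M" using False by (simp add: g_def)
      then have "q' \<notin> snd ` R" using q gz M by force
      then show ?thesis using q False by (auto simp: T_def)
    qed
  qed
  moreover have "inj_on z T" "finite T" using T assms(1,2) inj_on_subset finite_subset by blast+
  ultimately obtain L where L: "\<forall>q\<in>T. swaps L (z q) = g q" using ex_swaps by blast
  show ?thesis
  proof (intro exI[of _ L] conjI ballI impI)
    fix e assume "e \<in> R"
    then obtain p q where e: "e = (p, q)" "(p, q) \<in> R" by (cases e) auto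
    then have "q \<in> T" "g q = z p" using the[of p q] by (force simp: T_def g_def)+
    then show "case e of (p, q) \<Rightarrow> swaps L (z q) = z p" using L e by simp
  next
    assume "\<forall>p. (p, p0) \<notin> R"
    then have "g p0 = M" by (auto simp: g_def)
    then show "swaps L (z p0) \<noteq> z p0" using L M assms(4) by (auto simp: T_def)
  qed
qed

end

text \<open>\<open>sep\<close> covers every value that moves can give to the entry
  \<open>y l\<close> alone, since \<open>crossing_unique\<close> needs it for products of letters
  and not only for \<open>y l\<close>.\<close>

locale terminal_state = fr_data +
  fixes V :: "'a set set" and t y :: "nat \<Rightarrow> 'a" and P Q :: "nat \<Rightarrow> 'a set"
  assumes finV: "finite V" and conV: "con V" and VertV: "V \<subseteq> Vert" and oneV: "{\<one>} \<in> V"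
    and tup: "tup t y" and tV: "i < n \<Longrightarrow> lc (t i) (A i) \<in> V"
    and link: "l < k \<Longrightarrow> P l \<in> V \<and> Q l \<in> V \<and> adj (P l) (lc (y l) (Q l))"
    and stab: "i < n \<Longrightarrow> a \<in> A i \<Longrightarrow> R \<in> V \<Longrightarrow> lc (t i \<otimes> a \<otimes> inv (t i)) R \<in> V \<Longrightarrow>
        lc (t i \<otimes> a \<otimes> inv (t i)) R = R"
    and sep: "l < k \<Longrightarrow> h \<in> carrier G \<Longrightarrow> moves (t, y) (t, y(l := h)) \<Longrightarrow> R \<in> V \<Longrightarrow> lc h R \<notin> V"
begin

lemma tc [simp]: "i < n \<Longrightarrow> t i \<in> carrier G" using tup by (simp add: tup_def)

lemma yc [simp]: "j < k \<Longrightarrow> y j \<in> carrier G" using tup by (simp add: tup_def)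

lemma V_sub: "R \<in> V \<Longrightarrow> R \<subseteq> carrier G" using VertV Vert_carrier by blast

text \<open>\<open>crossing lab h P' Q'\<close> says that the vertices \<open>P'\<close> and \<open>h Q'\<close> are joined by an edge, which is an
  edge of the tree (\<open>lab = None\<close>) or comes from the link of \<open>y l\<close>.\<close>

definition crossing :: "(nat \<times> bool) option \<Rightarrow> 'a \<Rightarrow> 'a set \<Rightarrow> 'a set \<Rightarrow> bool" where
  "crossing lab h P' Q' \<longleftrightarrow> P' \<in> V \<and> Q' \<in> V \<and> (case lab of
     None \<Rightarrow> h = \<one> \<and> adj P' Q'
   | Some (l, e) \<Rightarrow> l < k \<and> (if e then h = y l \<and> P' = P l \<and> Q' = Q l else h = inv (y l) \<and> P' = Q l \<and> Q' = P l))"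

lemma crossing_closed:
  assumes "crossing lab h R S"
  shows "h \<in> carrier G" "R \<in> V" "S \<in> V" "R \<subseteq> carrier G" "S \<subseteq> carrier G"
proof -
  show RS: "R \<in> V" "S \<in> V" using assms by (simp_all add: crossing_def)
  then show "R \<subseteq> carrier G" "S \<subseteq> carrier G" using V_sub by blast+
  show "h \<in> carrier G"
  proof (cases lab)
    case None
    then show ?thesis using assms by (simp add: crossing_def)
  next
    case (Some le)
    then show ?thesis using assms by (cases le) (simp add: crossing_def split: if_splits)
  qed
qed

lemma crossing_flip:
  assumes "crossing lab h R S"
  shows "\<exists>lab'. crossing lab' (inv h) S R"
proof (cases lab)
  case None
  then show ?thesis using assms adj_sym by (intro exI[of _ None]) (auto simp: crossing_def)
next
  case (Some le)
  obtain l e where "lab = Some (l, e)" using Some by (cases le) auto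
  then show ?thesis using assms by (intro exI[of _ "Some (l, \<not> e)"]) (auto simp: crossing_def)
qed

lemma crossing_adj:
  assumes "crossing lab h R S"
  shows "adj R (lc h S)"
proof (cases lab)
  case None
  then show ?thesis using assms lc_one V_sub by (auto simp: crossing_def)
next
  case (Some le)
  obtain l e where le: "lab = Some (l, e)" using Some by (cases le) auto
  then have l: "l < k" using assms by (simp add: crossing_def)
  have "adj (Q l) (lc (inv (y l)) (P l))"
    using adj_lc[OF adj_sym, of "P l" "lc (y l) (Q l)" "inv (y l)"] link[OF l] lc_inv(1)[of "Q l" "y l"]
      V_sub l by auto
  then show ?thesis using assms le link[OF l] by (auto simp: crossing_def split: if_splits)
qed

definition stabs :: "'a set" where
  "stabs = insert \<one> {t i \<otimes> a \<otimes> inv (t i) |i a. i < n \<and> a \<in> A i}"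

lemma stabs_closed: "a \<in> stabs \<Longrightarrow> a \<in> carrier G"
proof -
  have "t i \<otimes> c \<otimes> inv (t i) \<in> carrier G" if "i < n" "c \<in> A i" for i c
    using that A_closed[OF that(2)] by simp
  then show "a \<in> stabs \<Longrightarrow> a \<in> carrier G" by (auto simp: stabs_def)
qed

lemma stabs_inv: "a \<in> stabs \<Longrightarrow> inv a \<in> stabs"
proof -
  have "inv (t i \<otimes> c \<otimes> inv (t i)) = t i \<otimes> inv c \<otimes> inv (t i)" if "i < n" "c \<in> A i" for i c
    using that A_closed[OF that(2)] by (simp add: m_assoc inv_mult_group)
  then show "a \<in> stabs \<Longrightarrow> inv a \<in> stabs" unfolding stabs_def using A_ops(2) by fastforce
qed

lemma stabs_fix: "a \<in> stabs \<Longrightarrow> R \<in> V \<Longrightarrow> lc a R \<in> V \<Longrightarrow> lc a R = R"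
  unfolding stabs_def using stab lc_one V_sub by auto

lemma moves_letter:
  assumes "l < k" "s = y l \<or> s = inv (y l)"
  shows "moves (t, y) (t, y(l := s))"
proof (cases "s = y l")
  case False
  then show ?thesis using assms move_inv[of l t y] r_into_rtranclp[of move] by simp
qed simp

lemma moves_stab:
  assumes "l < k" "s = y l \<or> s = inv (y l)" "a \<in> stabs"
  shows "moves (t, y) (t, y(l := a \<otimes> s))"
proof (cases "a = \<one>")
  case True
  then show ?thesis using moves_letter[OF assms(1,2)] assms by auto
next
  case False
  then obtain i c where i: "i < n" "c \<in> A i" "a = t i \<otimes> c \<otimes> inv (t i)" using assms(3) by (auto simp: stabs_def)
  then have "lett t (y(l := s)) i a" by (auto simp: lett_def)
  then have "move (t, y(l := s)) (t, (y(l := s))(l := a \<otimes> (y(l := s)) l))"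
    using assms(1) i(1) by (intro move_y[of l i]) auto
  then show ?thesis using moves_letter[OF assms(1,2)] by auto
qed

lemma moves_two:
  assumes "l < k" "s = y l \<or> s = inv (y l)" "a \<in> stabs" "l' < k" "l' \<noteq> l" "s' = y l' \<or> s' = inv (y l')"
  shows "moves (t, y) (t, y(l := s' \<otimes> (a \<otimes> s)))"
proof -
  have "lett t (y(l := a \<otimes> s)) (n + l') s'" using assms by (auto simp: lett_def)
  then have "move (t, y(l := a \<otimes> s)) (t, (y(l := a \<otimes> s))(l := s' \<otimes> (y(l := a \<otimes> s)) l))"
    using assms by (intro move_y[of l "n + l'"]) auto
  then show ?thesis using moves_stab[OF assms(1-3)] by auto
qed

text \<open>Local injectivity: edges at the same vertex \<open>R\<close>, taken up to the stabiliser letters, do not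
  coincide.\<close>

lemma crossing_unique:
  assumes X: "crossing lab h R S" "crossing lab' h' R S'" and a: "a \<in> stabs"
    and eq: "lc a (lc h S) = lc h' S'"
  shows "S = S' \<and> (h = h' \<or> R = S)"
proof -
  note c = crossing_closed[OF X(1)] and c' = crossing_closed[OF X(2)] and ac = stabs_closed[OF a]
  have s: "s = y l \<or> s = inv (y l) \<Longrightarrow> l < k \<Longrightarrow> s \<in> carrier G" for s l by auto
  \<comment> \<open>The two edges meet only if this product of letters maps \<open>S\<close> into V,
    which \<open>stabs_fix\<close> and \<open>sep\<close> restrict.\<close>
  have eq': "lc (inv h' \<otimes> (a \<otimes> h)) S = S'"
    using arg_cong[OF eq, of "lc (inv h')"] c c' ac by (simp add: lc_lc lc_closed lc_inv lc_one)
  show ?thesis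
  proof (cases lab)
    case None
    then have h: "h = \<one>" using X(1) by (simp add: crossing_def)
    show ?thesis
    proof (cases lab')
      case None': None
      then have h': "h' = \<one>" using X(2) by (simp add: crossing_def)
      then have "lc a S = S'" using eq' h ac by simp
      then show ?thesis using stabs_fix[OF a c(3)] c'(3) h h' by simp
    next
      case (Some le)
      then obtain l e where "lab' = Some (l, e)" by (cases le) auto
      then have l: "l < k" "h' = y l \<or> h' = inv (y l)" using X(2) by (auto simp: crossing_def split: if_splits)
      have "lc (inv a \<otimes> h') S' = S"
        using arg_cong[OF eq, of "lc (inv a)"] h c c' ac by (simp add: lc_lc lc_one lc_closed lc_inv)
      moreover have "lc (inv a \<otimes> h') S' \<notin> V"
        using sep[OF l(1) _ moves_stab[OF l stabs_inv[OF a]] c'(3)] ac c'(1) by simp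
      ultimately show ?thesis using c(3) by simp
    qed
  next
    case (Some le)
    then obtain l e where le: "lab = Some (l, e)" by (cases le) auto
    then have l: "l < k" "h = y l \<or> h = inv (y l)" using X(1) by (auto simp: crossing_def split: if_splits)
    show ?thesis
    proof (cases lab')
      case None
      then have h': "h' = \<one>" using X(2) by (simp add: crossing_def)
      then have "lc (a \<otimes> h) S = S'" using eq' ac c(1) by simp
      moreover have "lc (a \<otimes> h) S \<notin> V" using sep[OF l(1) _ moves_stab[OF l a] c(3)] ac c(1) by simp
      ultimately show ?thesis using c'(3) by simp
    next
      case (Some le')
      then obtain l' e' where le': "lab' = Some (l', e')" by (cases le') auto
      then have l': "l' < k" "h' = y l' \<or> h' = inv (y l')" using X(2) by (auto simp: crossing_def split: if_splits)
      show ?thesis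
      proof (cases "l' = l")
        case True
        \<comment> \<open>For one and the same entry, equal signs give equal crossings, while
          opposite signs force \<open>P l\<close> and \<open>Q l\<close> to coincide with
          \<open>R\<close>; hence the alternative \<open>R = S\<close> in the conclusion.\<close>
        then show ?thesis using X le le' by (cases e; cases e') (auto simp: crossing_def)
      next
        case False
        have "inv h' = y l' \<or> inv h' = inv (y l')" using l' by auto
        then have "lc (inv h' \<otimes> (a \<otimes> h)) S \<notin> V"
          using sep[OF l(1) _ moves_two[OF l a l'(1) False] c(3)] ac c(1) c'(1) by simp
        then show ?thesis using eq' c'(3) by simp
      qed
    qed
  qed
qed

end

section \<open>Edges at elements, turned into prescriptions for an action\<close>

context terminal_state
begin

definition factor_edge :: "nat \<Rightarrow> 'a \<Rightarrow> 'a \<Rightarrow> 'a set \<Rightarrow> bool" where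
  "factor_edge i p h K \<longleftrightarrow> (\<exists>lab. crossing lab h {p} K) \<and> (\<exists>g\<in>carrier G. K = lc g (A i))"

lemma factor_edge_mem:
  assumes "i < n" "factor_edge i p h K"
  shows "p \<in> carrier G" "h \<in> carrier G" "K \<in> V" "{p} \<in> V" "p \<in> lc h K" "lc h K = lc p (A i)"
    "inv h \<otimes> p \<in> K"
proof -
  obtain lab g where X: "crossing lab h {p} K" and g: "g \<in> carrier G" "K = lc g (A i)"
    using assms(2) by (auto simp: factor_edge_def)
  note c = crossing_closed[OF X]
  show "h \<in> carrier G" "K \<in> V" "{p} \<in> V" using c by auto
  show p: "p \<in> carrier G" using c(4) by simp
  have hK: "lc h K = lc (h \<otimes> g) (A i)" using lc_lc[OF A_sub[OF assms(1)] c(1) g(1)] g(2) by simp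
  have hg: "h \<otimes> g \<in> carrier G" using c(1) g(1) by simp
  from crossing_adj[OF X] show "p \<in> lc h K"
  proof cases
    case (adj_coset g' i')
    then show ?thesis using lc_self by simp
  next
    case (adj_coset' g' i')
    then show ?thesis using coset_not_single by metis
  next
    case (adj_x g' j)
    then show ?thesis using hK coset_not_single[OF assms(1) hg] by metis
  next
    case (adj_x' g' j)
    then show ?thesis using hK coset_not_single[OF assms(1) hg] by metis
  qed
  then show eq: "lc h K = lc p (A i)" using lc_mem[OF assms(1) hg] hK by simp
  obtain q where q: "q \<in> K" "p = h \<otimes> q" using \<open>p \<in> lc h K\<close> by (auto simp: lc_def)
  have "q \<in> carrier G" using q(1) c(5) by blast
  then show "inv h \<otimes> p \<in> K" using q c(1) by simp
qed

lemma factor_edge_unique: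
  assumes "i < n" "factor_edge i p h K" "factor_edge i p h' K'"
  shows "K = K' \<and> h = h'"
proof -
  obtain lab lab' g where X: "crossing lab h {p} K" "crossing lab' h' {p} K'"
    and g: "g \<in> carrier G" "K = lc g (A i)" using assms(2,3) by (auto simp: factor_edge_def)
  have "lc \<one> (lc h K) = lc h' K'"
    using factor_edge_mem(6)[OF assms(1,2)] factor_edge_mem(6)[OF assms(1,3)]
      lc_one[OF lc_closed[OF crossing_closed(5)[OF X(1)] crossing_closed(1)[OF X(1)]]] by simp
  moreover have "\<one> \<in> stabs" by (simp add: stabs_def)
  ultimately have "K = K' \<and> (h = h' \<or> {p} = K)" using crossing_unique[OF X] by metis
  then show ?thesis using coset_not_single[OF assms(1) g(1)] g(2) by metis
qed

text \<open>Seen from the coset, the edges to \<open>p\<close> and \<open>p'\<close> agree up to a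
  stabiliser letter, so local injectivity applies at the vertex K.\<close>

lemma factor_edge_inj:
  assumes "i < n" "factor_edge i p h K" "factor_edge i p' h' K" "a \<in> stabs"
    and "a \<otimes> (inv h \<otimes> p) = inv h' \<otimes> p'"
  shows "p = p'"
proof -
  obtain lab lab' where X: "crossing lab (inv h) K {p}" "crossing lab' (inv h') K {p'}"
    using assms(2,3) crossing_flip unfolding factor_edge_def by metis
  have "lc a (lc (inv h) {p}) = lc (inv h') {p'}" using assms(5) by simp
  then show ?thesis using crossing_unique[OF X assms(4)] by auto
qed

definition rep :: "'a set \<Rightarrow> 'a" where "rep K = (SOME r. r \<in> K)"

lemma rep:
  assumes "i < n" "g \<in> carrier G" "K = lc g (A i)"
  shows "rep K \<in> K" "rep K \<in> carrier G" "lc (rep K) (A i) = K"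
proof -
  have "g \<in> K" using lc_self assms by simp
  then show r: "rep K \<in> K" unfolding rep_def by (rule someI)
  then show "rep K \<in> carrier G" using lc_closed[OF A_sub[OF assms(1)] assms(2)] assms(3) by blast
  show "lc (rep K) (A i) = K" using lc_mem[OF assms(1,2)] r assms(3) by simp
qed

lemma rep_coord:
  assumes "i < n" "g \<in> carrier G" "K = lc g (A i)" "q \<in> K"
  shows "inv (rep K) \<otimes> q \<in> A i" "q \<in> carrier G" "rep K \<otimes> (inv (rep K) \<otimes> q) = q"
proof -
  note r = rep[OF assms(1-3)]
  obtain a where a: "a \<in> A i" "q = rep K \<otimes> a" using assms(4) r(3) by (auto simp: lc_def)
  have "a \<in> carrier G" using a assms(1) by simp
  then show "inv (rep K) \<otimes> q \<in> A i" "q \<in> carrier G" "rep K \<otimes> (inv (rep K) \<otimes> q) = q"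
    using a r(2) by simp_all
qed

text \<open>The coset to which \<open>p\<close> is joined in direction i, with the position of
  \<open>p\<close> in it relative to the representative; \<open>factor_edge_unique\<close> makes the
  choice harmless.\<close>

definition att :: "nat \<Rightarrow> 'a \<Rightarrow> ('a set \<times> 'a) option" where
  "att i p = (if \<exists>h K. factor_edge i p h K
     then (case SOME (h, K). factor_edge i p h K of (h, K) \<Rightarrow> Some (K, inv (rep K) \<otimes> (inv h \<otimes> p)))
     else None)"

lemma att_edge:
  assumes "i < n" "factor_edge i p h K"
  shows "att i p = Some (K, inv (rep K) \<otimes> (inv h \<otimes> p))"
proof -
  have "(SOME (h, K). factor_edge i p h K) = (h, K)"
  proof (rule some_equality)
    show "case (h, K) of (h, K) \<Rightarrow> factor_edge i p h K" using assms(2) by simp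
  next
    fix e assume "case e of (h, K) \<Rightarrow> factor_edge i p h K"
    then show "e = (h, K)" using factor_edge_unique[OF assms(1) _ assms(2)] by (cases e) auto
  qed
  then show ?thesis using assms(2) unfolding att_def by auto
qed

lemma att_SomeD:
  assumes "i < n" "att i p = Some (K, b)"
  obtains h where "factor_edge i p h K" "b = inv (rep K) \<otimes> (inv h \<otimes> p)"
proof -
  obtain h' K' where e: "factor_edge i p h' K'" using assms(2) by (auto simp: att_def split: if_splits)
  then show ?thesis using att_edge[OF assms(1) e] assms(2) that by auto
qed

text \<open>For such a pair \<open>x j\<close> must send the number of q to that of p: since
  \<open>p \<otimes> x j\<close> equals \<open>h \<otimes> q\<close>, the point that p makes of
  \<open>z p\<close> is then \<open>h\<close> applied to the point that q makes of
  \<open>z q\<close>.\<close>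

definition x_edge :: "nat \<Rightarrow> ('a \<times> 'a) set" where
  "x_edge j = {(p, q). {p} \<in> V \<and> {q} \<in> V \<and> (\<exists>lab h. crossing lab h {p} {q} \<and> h \<otimes> q = p \<otimes> x j)}"

lemma x_edge_unique:
  assumes "j < k"
  shows "(p, q) \<in> x_edge j \<Longrightarrow> (p, q') \<in> x_edge j \<Longrightarrow> q = q'"
    "(p, q) \<in> x_edge j \<Longrightarrow> (p', q) \<in> x_edge j \<Longrightarrow> p = p'"
proof -
  assume "(p, q) \<in> x_edge j" "(p, q') \<in> x_edge j"
  then obtain lab h lab' h' where X: "crossing lab h {p} {q}" "crossing lab' h' {p} {q'}"
    and e: "h \<otimes> q = p \<otimes> x j" "h' \<otimes> q' = p \<otimes> x j" by (auto simp: x_edge_def)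
  have "p \<in> carrier G" using crossing_closed[OF X(1)] by simp
  then have "lc \<one> (lc h {q}) = lc h' {q'}" using e assms by simp
  then show "q = q'" using crossing_unique[OF X, of \<one>] by (simp add: stabs_def)
next
  assume "(p, q) \<in> x_edge j" "(p', q) \<in> x_edge j"
  then obtain lab h lab' h' where X: "crossing lab h {p} {q}" "crossing lab' h' {p'} {q}"
    and e: "h \<otimes> q = p \<otimes> x j" "h' \<otimes> q = p' \<otimes> x j" by (auto simp: x_edge_def)
  note c = crossing_closed[OF X(1)] crossing_closed[OF X(2)]
  obtain m m' where Y: "crossing m (inv h) {q} {p}" "crossing m' (inv h') {q} {p'}"
    using crossing_flip X by metis
  have i: "inv h \<otimes> p = q \<otimes> inv (x j)" if "h \<otimes> q = p \<otimes> x j" "h \<in> carrier G" "p \<in> carrier G" for h p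
  proof -
    have q: "q \<in> carrier G" using c by simp
    have "p = h \<otimes> q \<otimes> inv (x j)" using that assms by (simp add: m_assoc)
    then show ?thesis using that(2) q assms by (simp add: m_assoc)
  qed
  have "inv h \<otimes> p = inv h' \<otimes> p'" using i[OF e(1)] i[OF e(2)] c by simp
  moreover have "inv h \<otimes> p \<in> carrier G" using c by simp
  ultimately have "lc \<one> (lc (inv h) {p}) = lc (inv h') {p'}" by simp
  then show "p = p'" using crossing_unique[OF Y, of \<one>] by (simp add: stabs_def)
qed

text \<open>One action meeting all prescriptions at once. The element 1 gets the number 0, and the
  remaining freedom is used to move 0: a factor or basis element fixes it only if an edge at 1
  forces this.\<close>

lemma ex_action:
  obtains z L \<zeta> where "z \<one> = (0::nat)" "inj_on z {p. {p} \<in> V}"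
    "\<And>i K a b. i < n \<Longrightarrow> a \<in> A i \<Longrightarrow> b \<in> A i \<Longrightarrow> act L a (\<zeta> i K b) = \<zeta> i K (b \<otimes> inv a)"
    "\<And>i b. i < n \<Longrightarrow> \<zeta> i (lc (t i) (A i)) b = \<zeta> i (lc (t i) (A i)) \<one>"
    "\<And>i p h K. i < n \<Longrightarrow> factor_edge i p h K \<Longrightarrow> z p = \<zeta> i K (inv (rep K) \<otimes> (inv h \<otimes> p))"
    "\<And>i. i < n \<Longrightarrow> (\<And>a. a \<in> A i \<Longrightarrow> act L a 0 = 0) \<Longrightarrow> \<exists>h. factor_edge i \<one> h (lc (t i) (A i))"
    "\<And>j p q. j < k \<Longrightarrow> (p, q) \<in> x_edge j \<Longrightarrow> act L (x j) (z q) = z p"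
    "\<And>j. j < k \<Longrightarrow> act L (x j) 0 = 0 \<Longrightarrow> \<exists>p. (p, \<one>) \<in> x_edge j"
proof -
  define S where "S = {p. {p} \<in> V}"
  have "finite ((\<lambda>p. {p}) ` S)" using finV by (rule rev_finite_subset) (auto simp: S_def)
  then have fS: "finite S" by (rule finite_imageD) (auto simp: inj_on_def)
  then obtain z0 :: "'a \<Rightarrow> nat" where z0: "inj_on z0 S" using finite_imp_inj_to_nat_seg by blast
  define z where "z p = (if p = \<one> then 0 else Suc (z0 p))" for p
  have z: "inj_on z S" using z0 by (auto simp: inj_on_def z_def)
  have oneS: "\<one> \<in> S" using oneV by (simp add: S_def)
  define good where "good i L \<zeta> \<longleftrightarrow> (\<forall>K. \<forall>a\<in>A i. \<forall>b\<in>A i.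
        swaps L (alpha i a (swaps (rev L) (\<zeta> K b))) = \<zeta> K (b \<otimes> inv a)) \<and>
      (\<forall>b. \<zeta> (lc (t i) (A i)) b = \<zeta> (lc (t i) (A i)) \<one>) \<and>
      (\<forall>p\<in>S. \<forall>K b. att i p = Some (K, b) \<longrightarrow> z p = \<zeta> K b) \<and>
      (\<forall>p\<in>S. (\<forall>a\<in>A i. swaps L (alpha i a (swaps (rev L) (z p))) = z p) \<longrightarrow>
         (\<exists>b. att i p = Some (lc (t i) (A i), b)))" for i L and \<zeta> :: "'a set \<Rightarrow> 'a \<Rightarrow> nat"
  have "\<forall>i. \<exists>L\<zeta>. i < n \<longrightarrow> good i (fst L\<zeta>) (snd L\<zeta>)"
  proof (intro allI)
    fix i
    show "\<exists>L\<zeta>. i < n \<longrightarrow> good i (fst L\<zeta>) (snd L\<zeta>)"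
    proof (cases "i < n")
      case True
      have "\<exists>L \<zeta>. good i L \<zeta>" unfolding good_def
      proof (rule ex_factor_action[OF True fS finV z])
        fix p K b assume p: "p \<in> S" "att i p = Some (K, b)"
        from p(2) obtain h where h: "factor_edge i p h K" "b = inv (rep K) \<otimes> (inv h \<otimes> p)"
          by (rule att_SomeD[OF True])
        obtain g where g: "g \<in> carrier G" "K = lc g (A i)" using h(1) by (auto simp: factor_edge_def)
        show "K \<in> V \<and> b \<in> A i"
          using factor_edge_mem[OF True h(1)] rep_coord(1)[OF True g] h(2) by simp
      next
        fix p p' K b assume p: "att i p = Some (K, b)" "att i p' = Some (K, b)"
        from p(1) obtain h where h: "factor_edge i p h K" "b = inv (rep K) \<otimes> (inv h \<otimes> p)"
          by (rule att_SomeD[OF True])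
        from p(2) obtain h' where h': "factor_edge i p' h' K" "b = inv (rep K) \<otimes> (inv h' \<otimes> p')"
          by (rule att_SomeD[OF True])
        obtain g where g: "g \<in> carrier G" "K = lc g (A i)" using h(1) by (auto simp: factor_edge_def)
        have eq: "inv h \<otimes> p = inv h' \<otimes> p'"
          using rep_coord(3)[OF True g factor_edge_mem(7)[OF True h(1)]]
            rep_coord(3)[OF True g factor_edge_mem(7)[OF True h'(1)]] h(2) h'(2) by simp
        show "p = p'"
          by (rule factor_edge_inj[OF True h(1) h'(1), of \<one>])
             (use eq factor_edge_mem[OF True h(1)] factor_edge_mem[OF True h'(1)] in \<open>simp_all add: stabs_def\<close>)
      next
        \<comment> \<open>Elements attached to the coset of \<open>t i\<close> differ by a letter of
          its stabiliser, so there is at most one of them; this permits shrinking that orbit to a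
          point.\<close>
        fix p p' b b' assume p: "att i p = Some (lc (t i) (A i), b)" "att i p' = Some (lc (t i) (A i), b')"
        from p(1) obtain h where h: "factor_edge i p h (lc (t i) (A i))" by (rule att_SomeD[OF True])
        from p(2) obtain h' where h': "factor_edge i p' h' (lc (t i) (A i))" by (rule att_SomeD[OF True])
        obtain a a' where a: "a \<in> A i" "inv h \<otimes> p = t i \<otimes> a" "a' \<in> A i" "inv h' \<otimes> p' = t i \<otimes> a'"
          using factor_edge_mem(7)[OF True h] factor_edge_mem(7)[OF True h'] by (auto simp: lc_def)
        have ac: "a \<in> carrier G" "a' \<in> carrier G" using a True by simp_all
        show "p = p'"
        proof (rule factor_edge_inj[OF True h h'])
          show "t i \<otimes> (a' \<otimes> inv a) \<otimes> inv (t i) \<in> stabs"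
          proof -
            have "a' \<otimes> inv a \<in> A i" using a True by simp
            then show ?thesis using True unfolding stabs_def by blast
          qed
          show "t i \<otimes> (a' \<otimes> inv a) \<otimes> inv (t i) \<otimes> (inv h \<otimes> p) = inv h' \<otimes> p'"
            using ac True unfolding a(2,4) by (simp add: m_assoc)
        qed
      qed
      then obtain L \<zeta> where "good i L \<zeta>" by blast
      then show ?thesis by (intro exI[of _ "(L, \<zeta>)"]) simp
    qed simp
  qed
  from choice[OF this] obtain F where F: "\<And>i. i < n \<Longrightarrow> good i (fst (F i)) (snd (F i))" by blast
  note F = F[unfolded good_def]
  have "\<forall>j. \<exists>L. j < k \<longrightarrow> (\<forall>(p, q)\<in>x_edge j. swaps L (z q) = z p) \<and>
      ((\<forall>p. (p, \<one>) \<notin> x_edge j) \<longrightarrow> swaps L (z \<one>) \<noteq> z \<one>)"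
  proof
    fix j
    show "\<exists>L. j < k \<longrightarrow> (\<forall>(p, q)\<in>x_edge j. swaps L (z q) = z p) \<and>
      ((\<forall>p. (p, \<one>) \<notin> x_edge j) \<longrightarrow> swaps L (z \<one>) \<noteq> z \<one>)"
    proof (cases "j < k")
      case True
      have "x_edge j \<subseteq> S \<times> S" by (auto simp: x_edge_def S_def)
      then have "\<exists>L. (\<forall>(p, q)\<in>x_edge j. swaps L (z q) = z p) \<and>
          ((\<forall>p. (p, \<one>) \<notin> x_edge j) \<longrightarrow> swaps L (z \<one>) \<noteq> z \<one>)"
        by (rule ex_partial_permutation[OF fS z _ oneS]) (use x_edge_unique[OF True] in blast)+
      then show ?thesis by blast
    qed simp
  qed
  from choice[OF this] obtain H where H: "\<And>j. j < k \<Longrightarrow> (\<forall>(p, q)\<in>x_edge j. swaps (H j) (z q) = z p) \<and>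
      ((\<forall>p. (p, \<one>) \<notin> x_edge j) \<longrightarrow> swaps (H j) (z \<one>) \<noteq> z \<one>)" by blast
  define L where "L m = (if m < n then fst (F m) else H (m - n))" for m
  show thesis
  proof (rule that[of z L "\<lambda>i. snd (F i)"])
    show "z \<one> = 0" by (simp add: z_def)
    show "inj_on z {p. {p} \<in> V}" using z by (simp add: S_def)
    show "act L a (snd (F i) K b) = snd (F i) K (b \<otimes> inv a)" if "i < n" "a \<in> A i" "b \<in> A i" for i K a b
      using F[OF that(1)] that by (simp add: act_A L_def)
    show "snd (F i) (lc (t i) (A i)) b = snd (F i) (lc (t i) (A i)) \<one>" if "i < n" for i b
      using F[OF that] by blast
    show "z p = snd (F i) K (inv (rep K) \<otimes> (inv h \<otimes> p))" if "i < n" "factor_edge i p h K" for i p h K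
    proof -
      have "p \<in> S" using factor_edge_mem(4)[OF that] by (simp add: S_def)
      then show ?thesis using F[OF that(1)] att_edge[OF that] by blast
    qed
    show "\<exists>h. factor_edge i \<one> h (lc (t i) (A i))"
      if i: "i < n" and fixed: "\<And>a. a \<in> A i \<Longrightarrow> act L a 0 = 0" for i
    proof -
      have "\<forall>a\<in>A i. swaps (fst (F i)) (alpha i a (swaps (rev (fst (F i))) (z \<one>))) = z \<one>"
        using fixed i by (simp add: act_A L_def z_def)
      then obtain b where "att i \<one> = Some (lc (t i) (A i), b)" using F[OF i] oneS by blast
      then obtain h where "factor_edge i \<one> h (lc (t i) (A i))" by (rule att_SomeD[OF i])
      then show ?thesis by blast
    qed
    show "act L (x j) (z q) = z p" if "j < k" "(p, q) \<in> x_edge j" for j p q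
      using H[OF that(1)] that by (auto simp: act_x L_def)
    show "\<exists>p. (p, \<one>) \<in> x_edge j" if "j < k" "act L (x j) 0 = 0" for j
      using H[OF that(1)] that by (auto simp: act_x L_def z_def)
  qed
qed

lemma terminal_decided: "decided t y"
proof (rule ex_action)
  fix z L \<zeta>
  assume z: "z \<one> = (0::nat)" "inj_on z {p. {p} \<in> V}"
    and zeta: "\<And>i K a b. i < n \<Longrightarrow> a \<in> A i \<Longrightarrow> b \<in> A i \<Longrightarrow> act L a (\<zeta> i K b) = \<zeta> i K (b \<otimes> inv a)"
    and zeta0: "\<And>i b. i < n \<Longrightarrow> \<zeta> i (lc (t i) (A i)) b = \<zeta> i (lc (t i) (A i)) \<one>"
    and z_zeta: "\<And>i p h K. i < n \<Longrightarrow> factor_edge i p h K \<Longrightarrow> z p = \<zeta> i K (inv (rep K) \<otimes> (inv h \<otimes> p))"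
    and fixA: "\<And>i. i < n \<Longrightarrow> (\<And>a. a \<in> A i \<Longrightarrow> act L a 0 = 0) \<Longrightarrow> \<exists>h. factor_edge i \<one> h (lc (t i) (A i))"
    and x_z: "\<And>j p q. j < k \<Longrightarrow> (p, q) \<in> x_edge j \<Longrightarrow> act L (x j) (z q) = z p"
    and fixx: "\<And>j. j < k \<Longrightarrow> act L (x j) 0 = 0 \<Longrightarrow> \<exists>p. (p, \<one>) \<in> x_edge j"
  \<comment> \<open>An element vertex is applied to its own number, a coset vertex lets its
    representative act on the origin of its orbit. The two agree along edges, up to the letter of
    the crossing, and so \<open>pos\<close> will be 0 on all of V.\<close>
  define pos where "pos R = (if \<exists>p. R = {p} then act L (the_elem R) (z (the_elem R))
      else act L (rep R) (\<zeta> (SOME i. i < n \<and> (\<exists>g\<in>carrier G. R = lc g (A i))) R \<one>))" for R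
  have pos1: "pos {p} = act L p (z p)" for p by (simp add: pos_def)
  have pos2: "pos K = act L (rep K) (\<zeta> i K \<one>)" if i: "i < n" and g: "g \<in> carrier G" "K = lc g (A i)" for i g K
  proof -
    have "\<nexists>p. K = {p}" using coset_not_single i g by metis
    moreover have "(SOME i. i < n \<and> (\<exists>g\<in>carrier G. K = lc g (A i))) = i"
    proof (rule some_equality)
      show "i < n \<and> (\<exists>g\<in>carrier G. K = lc g (A i))" using i g by blast
    next
      fix i' assume "i' < n \<and> (\<exists>g\<in>carrier G. K = lc g (A i'))"
      then show "i' = i" using coset_type i g by metis
    qed
    ultimately show ?thesis by (simp add: pos_def)
  qed
  have pos_factor: "pos {p} = act L h (pos K)" if i: "i < n" and e: "factor_edge i p h K" for i p h K
  proof -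
    note m = factor_edge_mem[OF i e]
    obtain g where g: "g \<in> carrier G" "K = lc g (A i)" using e by (auto simp: factor_edge_def)
    note r = rep[OF i g] and rc = rep_coord[OF i g m(7)]
    let ?b = "inv (rep K) \<otimes> (inv h \<otimes> p)"
    have b: "?b \<in> carrier G" using rc(1) i A_closed by simp
    have "p = h \<otimes> (inv h \<otimes> p)" using m(1,2) by simp
    also have "inv h \<otimes> p = rep K \<otimes> ?b" using rc(3) by simp
    finally have p: "p = h \<otimes> (rep K \<otimes> ?b)" .
    \<comment> \<open>The coordinate of \<open>p\<close> acts on the position with this coordinate
      and returns the origin of the orbit.\<close>
    have "act L p (z p) = act L h (act L (rep K) (act L ?b (\<zeta> i K ?b)))"
      using m(2) r(2) b by (subst (1) p) (simp add: z_zeta[OF i e])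
    also have "act L ?b (\<zeta> i K ?b) = \<zeta> i K \<one>" using zeta[OF i rc(1) rc(1)] b by simp
    finally show ?thesis using pos1 pos2[OF i g] by simp
  qed
  have pos_x: "pos {p} = act L h (pos {q})" if j: "j < k" and X: "crossing lab h {p} {q}" and e: "h \<otimes> q = p \<otimes> x j"
    for j lab h p q
  proof -
    note c = crossing_closed[OF X]
    have "(p, q) \<in> x_edge j" using X e c by (auto simp: x_edge_def)
    then have "act L (x j) (z q) = z p" by (rule x_z[OF j])
    then have "act L p (z p) = act L (p \<otimes> x j) (z q)" using c j by simp
    also have "\<dots> = act L h (act L q (z q))" using c by (simp flip: e)
    finally show ?thesis using pos1 by simp
  qed
  have half: "pos R = act L h (pos S)"
    if X: "crossing lab h R S" and a: "(\<exists>g i. g \<in> carrier G \<and> i < n \<and> R = {g} \<and> lc h S = lc g (A i)) \<or>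
        (\<exists>g j. g \<in> carrier G \<and> j < k \<and> R = {g} \<and> lc h S = {g \<otimes> x j})" for lab h R S
  proof -
    note c = crossing_closed[OF X]
    have S: "S = lc (inv h) (lc h S)" using lc_inv(1)[OF c(5,1)] by simp
    from a show ?thesis
    proof (elim disjE exE conjE)
      fix g i assume g: "g \<in> carrier G" "i < n" "R = {g}" "lc h S = lc g (A i)"
      have "S = lc (inv h \<otimes> g) (A i)" using S g c(1) lc_lc[OF A_sub[OF g(2)]] by simp
      then have "factor_edge i g h S" using X g c(1) by (auto simp: factor_edge_def)
      then show ?thesis using pos_factor g by simp
    next
      fix g j assume g: "g \<in> carrier G" "j < k" "R = {g}" "lc h S = {g \<otimes> x j}"
      have "S = {inv h \<otimes> (g \<otimes> x j)}" using S g by simp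
      moreover have "h \<otimes> (inv h \<otimes> (g \<otimes> x j)) = g \<otimes> x j" using g c(1) by simp
      ultimately show ?thesis using pos_x[OF g(2)] X g(3) by simp
    qed
  qed
  have full: "pos R = act L h (pos S)" if X: "crossing lab h R S" for lab h R S
  proof -
    note c = crossing_closed[OF X]
    obtain lab' where Y: "crossing lab' (inv h) S R" using crossing_flip[OF X] by blast
    \<comment> \<open>The two remaining kinds of adjacency are the first two read from the other
      end.\<close>
    have flip: ?thesis if "pos S = act L (inv h) (pos R)" using that c(1) by simp
    from crossing_adj[OF X] show ?thesis
    proof cases
      case (adj_coset g i)
      then show ?thesis using half[OF X] by blast
    next
      case (adj_x g j)
      then show ?thesis using half[OF X] by blast
    next
      case (adj_coset' g i)
      have S: "S = {inv h \<otimes> g}" using lc_inv(1)[OF c(5,1)] adj_coset' by simp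
      have "lc (inv h) R = lc (inv h \<otimes> g) (A i)" using lc_lc[OF A_sub] adj_coset' c(1) by simp
      then show ?thesis using half[OF Y] S adj_coset' c(1) by (intro flip) blast
    next
      case (adj_x' g j)
      have S: "S = {inv h \<otimes> g}" using lc_inv(1)[OF c(5,1)] adj_x' by simp
      have "lc (inv h) R = {inv h \<otimes> g \<otimes> x j}" using adj_x' c(1) by (simp add: m_assoc)
      then show ?thesis using half[OF Y] S adj_x' c(1) by (intro flip) blast
    qed
  qed
  \<comment> \<open>Crossings inside V carry the trivial letter, so \<open>pos\<close> is unchanged
    along its edges, and a cut would contradict this.\<close>
  have pos0: "pos R = 0" if RV: "R \<in> V" for R
  proof (rule ccontr)
    assume R: "pos R \<noteq> 0"
    let ?S = "{R \<in> V. pos R = 0}"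
    have "{\<one>} \<in> ?S" using oneV z pos1[of \<one>] by simp
    then obtain R1 R2 where "R1 \<in> ?S" "R2 \<in> V - ?S" "adj R1 R2"
    proof -
      have "R \<notin> ?S" using R by simp
      then have "?S \<noteq> V" using RV by metis
      then show ?thesis using con_cut[OF conV, of ?S] \<open>{\<one>} \<in> ?S\<close> that by blast
    qed
    then have "crossing None \<one> R1 R2" by (simp add: crossing_def)
    then have "pos R1 = pos R2" using full[of None \<one> R1 R2] by simp
    then show False using \<open>R1 \<in> ?S\<close> \<open>R2 \<in> V - ?S\<close> by simp
  qed
  have y0: "act L (y j) 0 = 0" if j: "j < k" for j
  proof -
    have "crossing (Some (j, True)) (y j) (P j) (Q j)" using link[OF j] j by (simp add: crossing_def)
    then show ?thesis using full pos0 link[OF j] by metis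
  qed
  \<comment> \<open>The orbit of this coset was collapsed, so \<open>A i\<close> fixes its only
    point, which \<open>t i\<close> sends to 0.\<close>
  have t0: "act L (t i \<otimes> a \<otimes> inv (t i)) 0 = 0" if i: "i < n" and a: "a \<in> A i" for i a
  proof -
    let ?K = "lc (t i) (A i)"
    note r = rep[OF i tc[OF i] refl]
    have rz: "act L (rep ?K) (\<zeta> i ?K \<one>) = 0" using pos2[OF i tc[OF i] refl] pos0[OF tV[OF i]] by simp
    have zf: "act L b (\<zeta> i ?K \<one>) = \<zeta> i ?K \<one>" if "b \<in> A i" for b
      using zeta[OF i that, of \<one>] zeta0[OF i] i by simp
    obtain c where c: "c \<in> A i" "t i = rep ?K \<otimes> c"
      using rep_coord[OF i tc[OF i] refl lc_self[OF tc[OF i] i]] by metis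
    have cc: "c \<in> carrier G" "a \<in> carrier G" using c a i by simp_all
    have "act L (t i) (\<zeta> i ?K \<one>) = 0" using zf[OF c(1)] rz r(2) cc by (subst c(2)) simp
    then have "act L (inv (t i)) 0 = \<zeta> i ?K \<one>" using act_inv(2)[OF tc[OF i], of L "\<zeta> i ?K \<one>"] by simp
    then show ?thesis using zf[OF a] \<open>act L (t i) _ = 0\<close> cc i by simp
  qed
  show ?thesis
  proof (cases "\<exists>g\<in>carrier G. act L g 0 \<noteq> 0")
    case True
    then show ?thesis unfolding decided_def Neg_def using t0 y0 by blast
  next
    \<comment> \<open>If G fixes 0, the choices made at 1 leave only forced edges there, and these
      identify the tuple with the standard one.\<close>
    case False
    then have fix0: "act L g 0 = 0" if "g \<in> carrier G" for g using that by blast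
    have "\<exists>l. l < k \<and> P l = {\<one>} \<and> Q l = {\<one>} \<and> (x j = y l \<or> x j = inv (y l))" if j: "j < k" for j
    proof -
      obtain p where p: "(p, \<one>) \<in> x_edge j" using fixx[OF j] fix0 j by auto
      then obtain lab h where X: "crossing lab h {p} {\<one>}" "h \<otimes> \<one> = p \<otimes> x j" "{p} \<in> V" by (auto simp: x_edge_def)
      have "z p = z \<one>" using x_z[OF j p] z(1) fix0 j by simp
      then have "p = \<one>" using inj_onD[OF z(2)] X(3) oneV by simp
      then have hx: "h = x j" using X(2) crossing_closed(1)[OF X(1)] j by simp
      show ?thesis
      proof (cases lab)
        case None
        \<comment> \<open>A tree edge would make \<open>x j\<close> trivial, which its own parity
          excludes.\<close>
        then have "x j = \<one>" using X(1) hx by (simp add: crossing_def)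
        then show ?thesis using par_x[OF j, of "{j}"] by simp
      next
        case (Some le)
        then obtain l e where "lab = Some (l, e)" by (cases le) auto
        then show ?thesis using X(1) hx \<open>p = \<one>\<close> by (intro exI[of _ l]) (auto simp: crossing_def split: if_splits)
      qed
    qed
    then obtain \<sigma> where s: "\<And>j. j < k \<Longrightarrow> \<sigma> j < k \<and> P (\<sigma> j) = {\<one>} \<and> Q (\<sigma> j) = {\<one>} \<and>
        (x j = y (\<sigma> j) \<or> x j = inv (y (\<sigma> j)))" by metis
    have s_inj: "inj_on \<sigma> {..<k}"
    proof (rule inj_onI)
      fix j j' assume j: "j \<in> {..<k}" "j' \<in> {..<k}" "\<sigma> j = \<sigma> j'"
      \<comment> \<open>Signs are invisible to parities, so equal entries belong to equal basis
        elements.\<close>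
      have "par M (x m) = par M (y (\<sigma> m))" if "m < k" for m M
        using s[OF that] par_inv[OF yc] by metis
      then have "par {j} (x j) = par {j} (x j')" using j by (metis lessThan_iff)
      then show "j = j'" using j by simp
    qed
    have s_im: "\<sigma> ` {..<k} = {..<k}" using s by (intro endo_inj_surj s_inj) auto
    define \<pi> where "\<pi> = inv_into {..<k} \<sigma>"
    have pi: "\<pi> l < k" "\<sigma> (\<pi> l) = l" if "l < k" for l
      using inv_into_into[of l \<sigma> "{..<k}"] f_inv_into_f[of l \<sigma> "{..<k}"] that s_im by (auto simp: \<pi>_def)
    have links: "P l = {\<one>}" "Q l = {\<one>}" if "l < k" for l using s[OF pi(1)[OF that]] pi(2)[OF that] by auto
    have tA: "inv (t i) \<in> A i" if i: "i < n" for i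
    proof -
      obtain h where h: "factor_edge i \<one> h (lc (t i) (A i))" using fixA[OF i] fix0 i by auto
      then obtain lab where X: "crossing lab h {\<one>} (lc (t i) (A i))" by (auto simp: factor_edge_def)
      \<comment> \<open>By now all links are attached to the vertex of 1 at both ends, so the edge
        from 1 to this coset lies in V itself and puts 1 into the coset.\<close>
      have "lab = None"
      proof (rule ccontr)
        assume "lab \<noteq> None"
        then obtain l e where "lab = Some (l, e)" by auto
        then have "l < k" "lc (t i) (A i) = Q l \<or> lc (t i) (A i) = P l"
          using X by (simp_all add: crossing_def split: if_splits)
        then have "lc (t i) (A i) = {\<one>}" using links by metis
        then show False using coset_not_single[OF i tc[OF i]] by blast
      qed
      then have "h = \<one>" using X by (simp add: crossing_def)
      then have "\<one> \<in> lc (t i) (A i)" using factor_edge_mem(7)[OF i h] by simp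
      then obtain a where a: "a \<in> A i" "\<one> = t i \<otimes> a" by (auto simp: lc_def)
      have "a \<in> carrier G" using a i by simp
      then have "inv (t i) = a" using inv_cancel(1)[of "t i" a] a(2)[symmetric] i by simp
      then show ?thesis using a by simp
    qed
    have one: "\<one>\<^bsub>Aut\<^esub> g = g" if "g \<in> carrier G" for g using that by (simp add: Aut_one)
    have "Pos t y" unfolding Pos_def
    proof (intro bexI[OF _ AutZ_one] conjI allI impI)
      fix i assume i: "i < n"
      show "\<exists>c\<in>A i. \<forall>a\<in>A i. \<one>\<^bsub>Aut\<^esub> a = t i \<otimes> c \<otimes> a \<otimes> inv (t i \<otimes> c)"
        using tA[OF i] i one by (intro bexI[of _ "inv (t i)"]) auto
    next
      have "inj_on \<pi> {..<k}" unfolding \<pi>_def by (rule inj_on_inv_into) (simp add: s_im)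
      moreover have "y l = (if x (\<pi> l) = y l then \<one>\<^bsub>Aut\<^esub> (x (\<pi> l)) else inv (\<one>\<^bsub>Aut\<^esub> (x (\<pi> l))))" if l: "l < k" for l
        using s[OF pi(1)[OF l]] pi[OF l] l one by auto
      ultimately show "\<exists>\<pi> \<epsilon>. inj_on \<pi> {..<k} \<and> \<pi> ` {..<k} \<subseteq> {..<k} \<and>
        (\<forall>j<k. y j = (if \<epsilon> j then \<one>\<^bsub>Aut\<^esub> (x (\<pi> j)) else inv (\<one>\<^bsub>Aut\<^esub> (x (\<pi> j)))))"
        using pi(1) by (intro exI[of _ \<pi>] exI[of _ "\<lambda>l. x (\<pi> l) = y l"]) auto
    qed
    then show ?thesis by (simp add: decided_def)
  qed
qed

end

section \<open>The dichotomy\<close>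

context fr_data
begin

text \<open>Induction on the size of V. An undecided state admits no merge, since that leads to a
  smaller and hence decided state, and no entry fixing a vertex, by \<open>rank_loss\<close>; this
  is what a terminal state demands.\<close>

lemma state_decided:
  assumes "state V t y"
  shows "decided t y"
  using assms
proof (induction "card V" arbitrary: V t y rule: less_induct)
  case less
  have st: "finite V" "con V" "V \<subseteq> Vert" "{\<one>} \<in> V" "tup t y" "\<And>i. i < n \<Longrightarrow> lc (t i) (A i) \<in> V"
    "\<And>j. j < k \<Longrightarrow> linked V (y j)" using less.prems by (auto simp: state_def)
  show ?case
  proof (rule ccontr)
    assume und: "\<not> decided t y"
    have dm: "\<not> decided t' y'" if "moves (t, y) (t', y')" for t' y'
      using decided_moves[OF that] st(5) und by auto
    have no_merge: False
      if mv: "moves (t, y) (t, y')" and lt: "lett t y' ix h" and R: "R \<in> V" "lc h R \<in> V" "lc h R \<noteq> R"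
        and same: "\<And>j. j < k \<Longrightarrow> n + j \<noteq> ix \<Longrightarrow> y' j = y j" for y' ix h R
    proof -
      have "tup t y'" using moves_tup[OF that(1)] st(5) by simp
      moreover have "linked V (y' j)" if "j < k" "n + j \<noteq> ix" for j
        using st(7)[OF that(1)] same[OF that] by simp
      ultimately obtain V' t'' y'' where m: "moves (t, y') (t'', y'')" "state V' t'' y''" "card V' < card V"
        using merge[OF st(1-4) _ st(6) lt _ R] by blast
      have "decided t'' y''" by (rule less.hyps[OF m(3,2)])
      moreover have "moves (t, y) (t'', y'')" using mv m(1) by (rule rtranclp_trans)
      ultimately show False using dm by blast
    qed
    have sep: "lc h R \<notin> V" if l: "l < k" and h: "h \<in> carrier G" and mv: "moves (t, y) (t, y(l := h))" and R: "R \<in> V" for l h R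
    proof
      assume hR: "lc h R \<in> V"
      show False
      proof (cases "lc h R = R")
        case True
        have "tup t (y(l := h))" using moves_tup[OF mv] st(5) by simp
        then have "Neg t (y(l := h))"
          using stabilizer_par[OF _ h True] R st(3) l by (intro rank_loss[of _ _ l]) (auto simp: tup_def)
        then show False using dm[OF mv] by (simp add: decided_def)
      next
        case False
        have "lett t (y(l := h)) (n + l) h" using l by (simp add: lett_def)
        then show False using no_merge[OF mv _ R hR False, of "n + l"] by auto
      qed
    qed
    have stab: "lc (t i \<otimes> a \<otimes> inv (t i)) R = R"
      if "i < n" "a \<in> A i" "R \<in> V" "lc (t i \<otimes> a \<otimes> inv (t i)) R \<in> V" for i a R
    proof (rule ccontr)
      assume ne: "lc (t i \<otimes> a \<otimes> inv (t i)) R \<noteq> R"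
      have "lett t y i (t i \<otimes> a \<otimes> inv (t i))" using that by (auto simp: lett_def)
      then show False using no_merge[OF rtranclp.rtrancl_refl _ that(3,4) ne, of i] by blast
    qed
    have "\<forall>l. \<exists>PQ. l < k \<longrightarrow> fst PQ \<in> V \<and> snd PQ \<in> V \<and> adj (fst PQ) (lc (y l) (snd PQ))"
    proof
      fix l
      show "\<exists>PQ. l < k \<longrightarrow> fst PQ \<in> V \<and> snd PQ \<in> V \<and> adj (fst PQ) (lc (y l) (snd PQ))"
      proof (cases "l < k")
        case True
        obtain P Q where PQ: "P \<in> V" "Q \<in> V" "P = lc (y l) Q \<or> adj P (lc (y l) Q)"
          using st(7)[OF True] by (auto simp: linked_def)
        have "y l \<in> carrier G" using st(5) True by (simp add: tup_def)
        then have "P \<noteq> lc (y l) Q" using sep[OF True, of "y l" Q] PQ(1,2) by auto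
        then show ?thesis using PQ by (intro exI[of _ "(P, Q)"]) auto
      qed simp
    qed
    from choice[OF this] obtain PQ where PQ: "\<And>l. l < k \<Longrightarrow> fst (PQ l) \<in> V \<and> snd (PQ l) \<in> V \<and>
        adj (fst (PQ l)) (lc (y l) (snd (PQ l)))" by blast
    interpret terminal_state G n k A F x gens nfA V t y "\<lambda>l. fst (PQ l)" "\<lambda>l. snd (PQ l)"
      by unfold_locales (use st(1-6) PQ stab sep in auto)
    show False using terminal_decided und by blast
  qed
qed

text \<open>Any finite connected set through 1, the cosets and the entries will do as a start, since
  the induction in \<open>state_decided\<close> copes with every size.\<close>

theorem dichotomy:
  assumes "tup t y"
  shows "decided t y"
proof -
  let ?W = "(\<lambda>i. lc (t i) (A i)) ` {..<n} \<union> (\<lambda>j. {y j}) ` {..<k}"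
  have "?W \<subseteq> Vert" using assms Vert_coset Vert_single by (auto simp: tup_def)
  then obtain V where V: "finite V" "con V" "V \<subseteq> Vert" "{\<one>} \<in> V" "?W \<subseteq> V"
    using con_to_vertices[of ?W] by auto
  have "linked V (y j)" if "j < k" for j
  proof -
    have "{y j} \<in> V" "y j \<in> carrier G" using V(5) that assms by (auto simp: tup_def)
    then show ?thesis unfolding linked_def using V(4) by (intro bexI[of _ "{y j}"] bexI[of _ "{\<one>}"]) auto
  qed
  then have "state V t y" using V assms by (auto simp: state_def)
  then show ?thesis by (rule state_decided)
qed

end

section \<open>Effective operations on words\<close>

definition letter_code :: "('b \<Rightarrow> nat) \<Rightarrow> 'b \<times> bool \<Rightarrow> nat" where
  "letter_code c = (\<lambda>(a, e). prod_encode (c a, of_bool e))"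

lemma letter_code_simp [simp]: "letter_code c (a, e) = prod_encode (c a, of_bool e)"
  by (simp add: letter_code_def)

lemma word_code_eq: "word_code c w = list_encode (map (letter_code c) w)"
  by (simp add: word_code_def letter_code_def)

lemma letter_code_inj: "inj c \<Longrightarrow> inj (letter_code c)"
  by (auto simp: inj_def of_bool_def split: if_splits)

lemma inj_on_fr_code: "inj fr_code"
proof (rule injI)
  fix l l' assume "fr_code l = fr_code l'"
  then show "l = l'" by (cases l; cases l') (simp_all only: fr_code.simps list_encode_eq list.inject, auto)
qed

lemma inj_idn: "inj (\<lambda>m::nat. m)" by (rule injI)

lemma inj_pe: "inj prod_encode" by (rule inj_prod_encode)

lemma tlist_if [rec_intros]:
  "tdec orc P \<Longrightarrow> tlist orc F \<Longrightarrow> tlist orc H \<Longrightarrow> tlist orc (\<lambda>a. if P a then F a else H a)"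
  unfolding tlist_def if_distrib[of list_encode] by (rule trec_if)

text \<open>For a finite alphabet, this makes being the code of a word a finite test on each list
  entry.\<close>

lemma in_letter_codes:
  "(\<forall>c\<in>set xs. c \<in> letter_code cf ` (L \<times> UNIV)) \<longleftrightarrow> (\<exists>w\<in>words L. xs = map (letter_code cf) w)"
proof
  assume "\<forall>c\<in>set xs. c \<in> letter_code cf ` (L \<times> UNIV)"
  then have "xs \<in> lists (letter_code cf ` (L \<times> UNIV))" by (simp add: in_lists_conv_set)
  then show "\<exists>w\<in>words L. xs = map (letter_code cf) w" by (auto simp: words_def lists_image)
next
  assume "\<exists>w\<in>words L. xs = map (letter_code cf) w"
  then obtain w where w: "w \<in> words L" "xs = map (letter_code cf) w" by blast
  have "c \<in> L \<times> UNIV" if "c \<in> set w" for c using w(1) that by (auto simp: words_def in_lists_conv_set)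
  then show "\<forall>c\<in>set xs. c \<in> letter_code cf ` (L \<times> UNIV)"
    unfolding w(2) set_map by (simp only: ball_simps) blast
qed

locale eff_data = fr_data +
  fixes orc :: "nat \<Rightarrow> nat"
  assumes orc: "normalizing_oracle G n gens nfA orc"
begin

abbreviation GL :: "(nat \<times> nat) set" where "GL \<equiv> gen_letters (n + k) gens"
abbreviation gval :: "(nat \<times> nat) word \<Rightarrow> 'a" where "gval \<equiv> word_val G (gen_val gens)"
abbreviation fval :: "nat \<Rightarrow> nat word \<Rightarrow> 'a" where "fval i \<equiv> word_val G (\<lambda>m. gens i ! m)"
abbreviation gl :: "(nat \<times> nat) \<times> bool \<Rightarrow> nat" where "gl \<equiv> letter_code prod_encode"
abbreviation nl :: "nat \<times> bool \<Rightarrow> nat" where "nl \<equiv> letter_code (\<lambda>m. m)"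
abbreviation fl :: "fr_letter \<times> bool \<Rightarrow> nat" where "fl \<equiv> letter_code fr_code"
abbreviation FL :: "fr_letter set" where "FL \<equiv> fr_letters n k gens"

definition GLc :: "nat set" where "GLc = gl ` (GL \<times> UNIV)"
definition NLc :: "nat \<Rightarrow> nat set" where "NLc i = nl ` ({..<length (gens i)} \<times> UNIV)"
definition FLc :: "nat set" where "FLc = fl ` (FL \<times> UNIV)"

section \<open>Words over the chosen generators of the factors\<close>

lemma finite_GL: "finite GL"
proof -
  have "GL = (SIGMA i:{..<n + k}. {..<length (gens i)})" by (auto simp: gen_letters_def)
  then show ?thesis by simp
qed

lemma finite_FL: "finite FL"
proof -
  let ?S = "SIGMA i:{..<n + k}. {..<length (gens i)} \<times> {..<n + k}"
  have "FL \<subseteq> (\<lambda>(i, m, j). PConj i m j) ` ?S \<union> (\<lambda>(i, m, j). LTrans i m j) ` ?S \<union> (\<lambda>(i, m, j). RTrans i m j) ` ?S"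
  proof
    fix l assume l: "l \<in> FL"
    show "l \<in> (\<lambda>(i, m, j). PConj i m j) ` ?S \<union> (\<lambda>(i, m, j). LTrans i m j) ` ?S \<union> (\<lambda>(i, m, j). RTrans i m j) ` ?S"
    proof (cases l)
      case (PConj i m j)
      then have "(i, m, j) \<in> ?S" using l by (simp add: fr_letters_def)
      then show ?thesis unfolding PConj by (intro UnI1 image_eqI[of _ _ "(i, m, j)"]) simp_all
    next
      case (LTrans i m j)
      then have "(i, m, j) \<in> ?S" using l by (simp add: fr_letters_def)
      then show ?thesis unfolding LTrans by (intro UnI1 UnI2 image_eqI[of _ _ "(i, m, j)"]) simp_all
    next
      case (RTrans i m j)
      then have "(i, m, j) \<in> ?S" using l by (simp add: fr_letters_def)
      then show ?thesis unfolding RTrans by (intro UnI2 image_eqI[of _ _ "(i, m, j)"]) simp_all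
    qed
  qed
  moreover have "finite ?S" by simp
  ultimately show ?thesis by (meson finite_UnI finite_imageI finite_subset)
qed

lemma finite_codes: "finite GLc" "finite (NLc i)" "finite FLc"
  using finite_GL finite_FL by (simp_all add: GLc_def NLc_def FLc_def)

lemma gens_mem: "i < n + k \<Longrightarrow> m < length (gens i) \<Longrightarrow> gens i ! m \<in> A i"
  using gens[of i] nth_mem[of m "gens i"] by blast

lemma gens_carrier: "i < n + k \<Longrightarrow> m < length (gens i) \<Longrightarrow> gens i ! m \<in> carrier G"
  using A_closed[OF gens_mem] by blast

lemma gens_closed: "(\<lambda>m. gens i ! m) ` {..<length (gens i)} \<subseteq> carrier G" if "i < n + k"
  using gens_carrier[OF that] by auto

lemma gen_val_closed: "gen_val gens ` GL \<subseteq> carrier G"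
  using gens_carrier by (auto simp: gen_val_def gen_letters_def)

lemma gval_closed [simp]: "u \<in> words GL \<Longrightarrow> gval u \<in> carrier G"
  using word_val_closed[OF gen_val_closed] by blast

lemma gval_append: "u \<in> words GL \<Longrightarrow> v \<in> words GL \<Longrightarrow> gval (u @ v) = gval u \<otimes> gval v"
  using word_val_append[OF gen_val_closed] by blast

lemma fval_mem: "i < n + k \<Longrightarrow> w \<in> words {..<length (gens i)} \<Longrightarrow> fval i w \<in> A i"
  by (rule word_val_in_subgroup[OF subgroup_A]) (use gens_mem in auto)

lemma fval_append: "i < n + k \<Longrightarrow> u \<in> words {..<length (gens i)} \<Longrightarrow> v \<in> words {..<length (gens i)} \<Longrightarrow>
    fval i (u @ v) = fval i u \<otimes> fval i v"
  by (rule word_val_append[OF gens_closed])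

lemma fval_ex: "i < n + k \<Longrightarrow> a \<in> A i \<Longrightarrow> \<exists>w\<in>words {..<length (gens i)}. fval i w = a"
proof -
  assume i: "i < n + k" "a \<in> A i"
  have "(\<lambda>m. gens i ! m) ` {..<length (gens i)} = set (gens i)" by (auto simp: in_set_conv_nth image_iff Bex_def)
  then show ?thesis using word_val_generate[OF gens_closed[OF i(1)], of a] gens[OF i(1)] i(2) by simp
qed

definition lift_word :: "nat \<Rightarrow> nat word \<Rightarrow> (nat \<times> nat) word" where
  "lift_word i w = map (\<lambda>(m, e). ((i, m), e)) w"

lemma lift_word:
  "i < n + k \<Longrightarrow> w \<in> words {..<length (gens i)} \<Longrightarrow> lift_word i w \<in> words GL"
  "gval (lift_word i w) = fval i w"
proof -
  show "i < n + k \<Longrightarrow> w \<in> words {..<length (gens i)} \<Longrightarrow> lift_word i w \<in> words GL"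
    by (auto simp: lift_word_def words_def gen_letters_def in_lists_conv_set)
  show "gval (lift_word i w) = fval i w"
    by (induction w) (auto simp: lift_word_def gen_val_def)
qed

lemma gval_ex: "g \<in> carrier G \<Longrightarrow> \<exists>u\<in>words GL. gval u = g"
proof (induction rule: factors_induct)
  case one
  show ?case by (rule bexI[of _ "[]"]) auto
next
  case (factor i a g)
  then obtain u w where u: "u \<in> words GL" "gval u = g" "w \<in> words {..<length (gens i)}" "fval i w = a"
    using fval_ex[of i a] by auto
  then show ?case using lift_word[of i w] factor(1) gval_append by (intro bexI[of _ "lift_word i w @ u"]) auto
next
  case (basis j g y)
  have "y \<in> A (n + j)" using basis(1,2) x_A[OF basis(1)] by auto
  then obtain u w where u: "u \<in> words GL" "gval u = g" "w \<in> words {..<length (gens (n + j))}" "fval (n + j) w = y"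
    using fval_ex[of "n + j" y] basis by auto
  then show ?case using lift_word[of "n + j" w] basis(1) gval_append by (intro bexI[of _ "lift_word (n + j) w @ u"]) auto
qed

subsection \<open>Computing the permutation actions\<close>

lemma trec_swaps:
  assumes "tlist orc W" "trec orc f"
  shows "trec orc (\<lambda>a. swaps (map prod_decode (W a)) (f a))"
proof -
  have "trec orc (\<lambda>a. foldr (\<lambda>c z. if z = pfst c then psnd c else if z = psnd c then pfst c else z) (W a) (f a))"
    by (rule trec_foldr[OF assms]) (intro rec_intros)
  moreover have "foldr (\<lambda>c z. if z = pfst c then psnd c else if z = psnd c then pfst c else z) xs z
      = swaps (map prod_decode xs) z" for xs z
  proof (induction xs)
    case (Cons c xs)
    have "swp (prod_decode c) z = (if z = pfst c then psnd c else if z = psnd c then pfst c else z)" for z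
      by (cases "prod_decode c") simp
    then show ?case using Cons.IH unfolding swaps_def by simp
  qed (simp add: swaps_def)
  ultimately show ?thesis by simp
qed

lemma orc_value:
  "i < n \<Longrightarrow> w \<in> words {..<length (gens i)} \<Longrightarrow> orc (prod_encode (i, list_encode (map nl w))) = enc i (fval i w)"
  using orc[unfolded normalizing_oracle_def word_code_eq, rule_format, of i w] unfolding enc_def word_code_eq by simp

lemma enc_word: "i < n \<Longrightarrow> a \<in> A i \<Longrightarrow> nfA i a \<in> words {..<length (gens i)} \<and> fval i (nfA i a) = a"
  using nfA[of i] unfolding normal_form_def by blast

text \<open>Membership in the set of normal forms is decidable: they are the words that the oracle
  reproduces. The letters have to be checked as well because the oracle is unconstrained on other
  numbers.\<close>

lemma enc_range: "i < n \<Longrightarrow> r \<in> enc i ` A i \<longleftrightarrow>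
    (\<forall>c\<in>set (list_decode r). c \<in> NLc i) \<and> orc (prod_encode (i, r)) = r"
proof
  assume i: "i < n" and "r \<in> enc i ` A i"
  then obtain a where a: "a \<in> A i" "r = enc i a" by blast
  have r: "r = list_encode (map nl (nfA i a))" by (simp add: a(2) enc_def word_code_eq)
  have "orc (prod_encode (i, r)) = r" using orc_value[OF i, of "nfA i a"] enc_word[OF i a(1)] a(2) unfolding r by simp
  moreover have "\<forall>c\<in>set (list_decode r). c \<in> NLc i"
    unfolding NLc_def in_letter_codes r using enc_word[OF i a(1)] by auto
  ultimately show "(\<forall>c\<in>set (list_decode r). c \<in> NLc i) \<and> orc (prod_encode (i, r)) = r" by blast
next
  assume i: "i < n" and r: "(\<forall>c\<in>set (list_decode r). c \<in> NLc i) \<and> orc (prod_encode (i, r)) = r"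
  then obtain w where w: "w \<in> words {..<length (gens i)}" "list_decode r = map nl w"
    unfolding NLc_def in_letter_codes by blast
  then have "r = list_encode (map nl w)" by (metis list_decode_inverse)
  then have "r = enc i (fval i w)" using orc_value[OF i w(1)] r by simp
  then show "r \<in> enc i ` A i" using fval_mem[of i w] i w(1) by simp
qed

lemma trec_alpha:
  assumes i: "i < n" and m: "m < length (gens i)" and f: "trec orc f"
  shows "trec orc (\<lambda>a. alpha i (if e then gens i ! m else inv (gens i ! m)) (f a))"
proof -
  let ?g = "if e then gens i ! m else inv (gens i ! m)"
  have g: "gens i ! m \<in> A i" "gens i ! m \<in> carrier G" using gens_mem[of i m] i m by auto
  \<comment> \<open>Right translation by the inverse appends the inverse letter to the stored normal
    form and renormalises by one query.\<close>
  have "alpha i ?g z = (if \<not> pfst z = 0 \<and> (\<forall>c\<in>set (list_decode (psnd z)). c \<in> NLc i) \<and> orc (prod_encode (i, psnd z)) = psnd z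
     then prod_encode (pfst z, orc (prod_encode (i, list_encode (list_decode (psnd z) @ [nl (m, \<not> e)])))) else z)" for z
  proof (cases "\<not> pfst z = 0 \<and> psnd z \<in> enc i ` A i")
    case True
    then obtain a where a: "a \<in> A i" "psnd z = enc i a" by blast
    have w: "nfA i a @ [(m, \<not> e)] \<in> words {..<length (gens i)}" using enc_word[OF i a(1)] m by simp
    have "list_decode (psnd z) @ [nl (m, \<not> e)] = map nl (nfA i a @ [(m, \<not> e)])"
      by (simp add: a(2) enc_def word_code_eq)
    moreover have "fval i (nfA i a @ [(m, \<not> e)]) = a \<otimes> inv ?g"
      using fval_append[of i "nfA i a" "[(m, \<not> e)]"] enc_word[OF i a(1)] i m g by simp
    ultimately have "orc (prod_encode (i, list_encode (list_decode (psnd z) @ [nl (m, \<not> e)]))) = enc i (a \<otimes> inv ?g)"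
      using orc_value[OF i w] by simp
    moreover have "dec i (psnd z) = a" using a i by simp
    ultimately show ?thesis using True enc_range[OF i, of "psnd z"] by (simp add: alpha_def)
  next
    case False
    then show ?thesis using enc_range[OF i, of "psnd z"] by (auto simp: alpha_def)
  qed
  moreover have "tdec orc (\<lambda>a. \<forall>c\<in>set (list_decode (psnd (f a))). c \<in> NLc i)"
    by (rule tdec_list_all) (intro rec_intros f finite_codes)+
  then have "trec orc (\<lambda>a. if \<not> pfst (f a) = 0 \<and> (\<forall>c\<in>set (list_decode (psnd (f a))). c \<in> NLc i) \<and> orc (prod_encode (i, psnd (f a))) = psnd (f a)
     then prod_encode (pfst (f a), orc (prod_encode (i, list_encode (list_decode (psnd (f a)) @ [nl (m, \<not> e)])))) else f a)"
    by (intro rec_intros f)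
  ultimately show ?thesis by simp
qed

definition cert :: "nat list \<Rightarrow> nat \<Rightarrow> (nat \<times> nat) list" where
  "cert C i = map prod_decode (list_decode (nth0 C i))"

lemma trec_swaps_cert:
  assumes "tlist orc C" "trec orc f"
  shows "trec orc (\<lambda>a. swaps (cert (C a) i) (f a))" "trec orc (\<lambda>a. swaps (rev (cert (C a) i)) (f a))"
proof -
  show "trec orc (\<lambda>a. swaps (cert (C a) i) (f a))" unfolding cert_def
    by (intro trec_swaps rec_intros assms)
  have "trec orc (\<lambda>a. swaps (map prod_decode (rev (list_decode (nth0 (C a) i)))) (f a))"
    by (intro trec_swaps rec_intros assms)
  then show "trec orc (\<lambda>a. swaps (rev (cert (C a) i)) (f a))" by (simp add: cert_def rev_map)
qed

text \<open>A chosen generator of \<open>A (n + j)\<close> may be any power of x j. Its exponent is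
  a constant of the program, which repeats the transpositions that often.\<close>

lemma trec_act_x:
  assumes j: "j < k" and C: "tlist orc C" and f: "trec orc f"
  shows "trec orc (\<lambda>a. act (cert (C a)) (x j [^] (z::int)) (f a))"
proof -
  have p: "trec orc (\<lambda>a. act (cert (C a)) (x j [^] (m::nat)) (f a))" if "trec orc f" for m f
    using that
  proof (induction m arbitrary: f)
    case 0
    then show ?case by simp
  next
    case (Suc m)
    have "trec orc (\<lambda>a. act (cert (C a)) (x j [^] m) (swaps (cert (C a) (n + j)) (f a)))"
      by (rule Suc.IH) (rule trec_swaps_cert[OF C Suc.prems])
    moreover have "act L (x j [^] Suc m) z = act L (x j [^] m) (swaps (L (n + j)) z)" for L z
      using j by (simp add: act_x)
    ultimately show ?case by simp
  qed
  have q: "trec orc (\<lambda>a. act (cert (C a)) (inv (x j) [^] (m::nat)) (f a))" if "trec orc f" for m f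
    using that
  proof (induction m arbitrary: f)
    case 0
    then show ?case by simp
  next
    case (Suc m)
    have "trec orc (\<lambda>a. act (cert (C a)) (inv (x j) [^] m) (swaps (rev (cert (C a) (n + j))) (f a)))"
      by (rule Suc.IH) (rule trec_swaps_cert[OF C Suc.prems])
    moreover have "act L (inv (x j)) z = swaps (rev (L (n + j))) z" for L z
      using act_inv(2)[OF x_closed[OF j], of L "swaps (rev (L (n + j))) z"] j by (simp add: act_x)
    then have "act L (inv (x j) [^] Suc m) z = act L (inv (x j) [^] m) (swaps (rev (L (n + j))) z)" for L z
      using j by simp
    ultimately show ?case by simp
  qed
  show ?thesis
  proof (cases "z \<ge> 0")
    case True
    then have "x j [^] z = x j [^] nat z" unfolding int_pow_def2 by simp
    then show ?thesis using p[OF f] by simp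
  next
    case False
    then have "x j [^] z = inv (x j [^] nat (- z))" unfolding int_pow_def2 by simp
    also have "\<dots> = inv (x j) [^] nat (- z)" using j by (simp add: nat_pow_inv)
    finally show ?thesis using q[OF f] by simp
  qed
qed

definition lval :: "(nat \<times> nat) \<times> bool \<Rightarrow> 'a" where
  "lval c = gval [c]"

lemma lval_simp: "(i, m) \<in> GL \<Longrightarrow> lval ((i, m), e) = (if e then gens i ! m else inv (gens i ! m))"
  using gens_mem[of i m] A_closed[of "gens i ! m" i] by (auto simp: lval_def gen_val_def gen_letters_def)

lemma trec_act_letter:
  assumes c: "c \<in> GL \<times> UNIV" and C: "tlist orc C" and f: "trec orc f"
  shows "trec orc (\<lambda>a. act (cert (C a)) (lval c) (f a))"
proof -
  obtain i m e where c: "c = ((i, m), e)" "(i, m) \<in> GL" "i < n + k" "m < length (gens i)"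
    using c by (auto simp: gen_letters_def)
  show ?thesis
  proof (cases "i < n")
    case True
    have g: "lval c \<in> A i" using lval_simp[OF c(2)] gens_mem[OF c(3,4)] c by auto
    have "trec orc (\<lambda>a. swaps (cert (C a) i) (alpha i (lval c) (swaps (rev (cert (C a) i)) (f a))))"
      using lval_simp[OF c(2)] trec_alpha[OF True c(4) trec_swaps_cert(2)[OF C f], of e]
      by (intro trec_swaps_cert C) (simp add: c(1))
    then show ?thesis using act_A[OF True g] by simp
  next
    case False
    then have j: "i - n < k" "n + (i - n) = i" using c by auto
    have "lval c \<in> A i" using lval_simp[OF c(2)] gens_mem[OF c(3,4)] c by auto
    then obtain z :: int where "lval c = x (i - n) [^] z" using A_cyclic_pow[OF j(1)] j(2) by auto
    then show ?thesis using trec_act_x[OF j(1) C f] by simp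
  qed
qed

definition lval_code :: "nat \<Rightarrow> 'a" where
  "lval_code s = lval (inv_into UNIV gl s)"

lemma lval_code [simp]: "lval_code (gl c) = lval c"
  by (simp add: lval_code_def inv_f_f letter_code_inj inj_pe)

text \<open>Numbers that code no letter send the point to 0; this default is never met on codes of
  words.\<close>

definition run :: "nat list \<Rightarrow> nat list \<Rightarrow> nat \<Rightarrow> nat" where
  "run C W z = foldr (\<lambda>c z. if c \<in> GLc then act (cert C) (lval_code c) z else 0) W z"

lemma trec_run:
  assumes "tlist orc C" "tlist orc W" "trec orc f"
  shows "trec orc (\<lambda>a. run (C a) (W a) (f a))"
  unfolding run_def
proof (rule trec_foldr[OF assms(2,3)])
  have p: "trec orc (\<lambda>b. pfst (psnd b))" "trec orc (\<lambda>b. psnd (psnd b))" by (intro rec_intros)+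
  have C: "tlist orc (\<lambda>b. C (pfst b))"
    using trec_comp[OF assms(1)[unfolded tlist_def], of "\<lambda>b. pfst b"] trec_fst[OF trec_id] by (simp add: tlist_def)
  show "trec orc (\<lambda>b. if pfst (psnd b) \<in> GLc then act (cert (C (pfst b))) (lval_code (pfst (psnd b))) (psnd (psnd b)) else 0)"
  proof (rule trec_dispatch[where f = "\<lambda>s b. act (cert (C (pfst b))) (lval_code s) (psnd (psnd b))", OF finite_codes(1) p(1)])
    fix s assume "s \<in> GLc"
    then obtain c where "c \<in> GL \<times> UNIV" "s = gl c" by (auto simp: GLc_def)
    then show "trec orc (\<lambda>b. act (cert (C (pfst b))) (lval_code s) (psnd (psnd b)))"
      using trec_act_letter[OF _ C p(2)] by simp
  qed (rule trec_const)
qed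

lemma run_word: "w \<in> words GL \<Longrightarrow> run C (map gl w) z = act (cert C) (gval w) z"
proof (induction w)
  case (Cons c w)
  obtain a e where c: "c = (a, e)" by (cases c)
  have w: "a \<in> GL" "w \<in> words GL" using Cons.prems by (auto simp: c)
  then have "gval (c # w) = lval c \<otimes> gval w" "lval c \<in> carrier G"
    using gval_append[of "[c]" w] gval_closed[of "[c]"] by (auto simp: c lval_def)
  then show ?case using Cons.IH[OF w(2)] w by (simp add: run_def GLc_def c del: letter_code_simp)
qed (simp add: run_def)

subsection \<open>The word problem\<close>

definition table :: "nat set \<Rightarrow> (nat \<Rightarrow> nat) \<Rightarrow> nat \<Rightarrow> nat" where
  "table S f c = (if c \<in> S then f c else 0)"

lemma trec_table: "finite S \<Longrightarrow> trec orc g \<Longrightarrow> trec orc (\<lambda>a. table S f (g a))"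
  unfolding table_def by (rule trec_dispatch[where f = "\<lambda>s a. f s"]) (auto intro: trec_const)

lemma trec_sum_table:
  assumes "finite S" "tlist orc W"
  shows "trec orc (\<lambda>a. sum_list (map (table S f) (W a)))"
proof -
  have "trec orc (\<lambda>a. foldr (\<lambda>c s. table S f c + s) (W a) 0)"
    by (rule trec_foldr[OF assms(2)]) (intro rec_intros trec_table assms(1))+
  moreover have "foldr (\<lambda>c s. table S f c + s) xs 0 = sum_list (map (table S f) xs)" for xs
    by (induction xs) auto
  ultimately show ?thesis by simp
qed

text \<open>The exponent of a signed generator as a power of x j, a constant for each letter that
  the algorithm reads from a table.\<close>

definition ex_nat :: "nat \<Rightarrow> nat \<Rightarrow> int" where
  "ex_nat i c = (SOME z. \<forall>m e. c = nl (m, e) \<longrightarrow> (if e then gens i ! m else inv (gens i ! m)) = x (i - n) [^] z)"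

lemma ex_nat:
  assumes "j < k" "m < length (gens (n + j))"
  shows "(if e then gens (n + j) ! m else inv (gens (n + j) ! m)) = x j [^] ex_nat (n + j) (nl (m, e))"
proof -
  have "(if e then gens (n + j) ! m else inv (gens (n + j) ! m)) \<in> A (n + j)"
    using gens_mem[of "n + j" m] assms by auto
  then obtain z :: int where z: "(if e then gens (n + j) ! m else inv (gens (n + j) ! m)) = x j [^] z"
    using A_cyclic_pow[OF assms(1)] by blast
  have "\<forall>m' e'. nl (m, e) = nl (m', e') \<longrightarrow> (if e' then gens (n + j) ! m' else inv (gens (n + j) ! m')) = x (n + j - n) [^] z"
  proof (intro allI impI)
    fix m' e' assume "nl (m, e) = nl (m', e')"
    then have "(m, e) = (m', e')" by (rule injD[OF letter_code_inj[OF inj_idn]])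
    then have "m' = m" "e' = e" by simp_all
    then show "(if e' then gens (n + j) ! m' else inv (gens (n + j) ! m')) = x (n + j - n) [^] z" using z by (cases e) simp_all
  qed
  then have "\<forall>m' e'. nl (m, e) = nl (m', e') \<longrightarrow> (if e' then gens (n + j) ! m' else inv (gens (n + j) ! m')) =
      x (n + j - n) [^] ex_nat (n + j) (nl (m, e))"
    unfolding ex_nat_def by (rule someI)
  then show ?thesis by simp
qed

text \<open>In an \<open>A i\<close> with oracle the normal form is compared with that of the empty
  word, whose code is 0. In a cyclic factor positive and negative exponents are added up separately,
  to stay within the natural numbers.\<close>

definition triv :: "nat \<Rightarrow> nat \<Rightarrow> bool" where
  "triv i c \<longleftrightarrow> (if i < n then orc (prod_encode (i, c)) = orc (prod_encode (i, 0))
     else sum_list (map (table (NLc i) (\<lambda>c. nat (ex_nat i c))) (list_decode c)) =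
       sum_list (map (table (NLc i) (\<lambda>c. nat (- ex_nat i c))) (list_decode c)))"

lemma tdec_triv: "trec orc f \<Longrightarrow> tdec orc (\<lambda>a. triv i (f a))"
  unfolding triv_def by (cases "i < n") (simp, intro rec_intros, assumption, simp, intro rec_intros trec_sum_table finite_codes)

lemma triv_iff:
  assumes i: "i < n + k" and w: "w \<in> words {..<length (gens i)}"
  shows "triv i (list_encode (map nl w)) \<longleftrightarrow> fval i w = \<one>"
proof (cases "i < n")
  case True
  have "orc (prod_encode (i, 0)) = enc i \<one>" using orc_value[OF True, of "[]"] by simp
  then show ?thesis using True orc_value[OF True w] inj_on_eq_iff[OF enc_inj[OF True] fval_mem[OF i w], of \<one>] i
    by (simp add: triv_def)
next
  case False
  define j where "j = i - n"
  have j: "i = n + j" "j < k" using False i by (auto simp: j_def)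
  let ?p = "\<lambda>w. sum_list (map (table (NLc i) (\<lambda>c. nat (ex_nat i c))) (map nl w))"
  let ?q = "\<lambda>w. sum_list (map (table (NLc i) (\<lambda>c. nat (- ex_nat i c))) (map nl w))"
  have "fval i w = x j [^] (int (?p w) - int (?q w))" using w
  proof (induction w)
    case (Cons c w)
    obtain m e where c: "c = (m, e)" by force
    have m: "m < length (gens i)" "w \<in> words {..<length (gens i)}" using Cons.prems by (auto simp: c)
    have mem: "nl c \<in> NLc i" using m unfolding NLc_def c by (intro imageI) simp
    let ?z = "ex_nat i (nl c)"
    have "fval i (c # w) = x j [^] ?z \<otimes> fval i w"
      using ex_nat[of j m e] m j by (simp add: c)
    also have "\<dots> = x j [^] (?z + (int (?p w) - int (?q w)))"
      using Cons.IH m(2) j by (simp add: int_pow_mult)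
    also have "?z + (int (?p w) - int (?q w)) = int (?p (c # w)) - int (?q (c # w))"
      using mem by (simp add: table_def)
    finally show ?case .
  qed simp
  then show ?thesis using x_pow_eq_one[OF j(2)] False by (simp add: triv_def)
qed

text \<open>One step of a reduction to syllables from the right end of a word. A letter code unpairs
  into factor, generator and sign; if the factor agrees with that of the top syllable, the letter is
  put in front of its word, with \<open>Suc\<close> and pairing as list constructor, and a syllable
  that becomes trivial is dropped.\<close>

definition push :: "nat \<Rightarrow> nat list \<Rightarrow> nat list" where
  "push c st = (let i = pfst (pfst c); mc = prod_encode (psnd (pfst c), psnd c);
      b = (st \<noteq> [] \<and> pfst (nth0 st 0) = i);
      w = Suc (prod_encode (mc, if b then psnd (nth0 st 0) else 0));
      r = (if b then tl st else st)
    in if triv i w then r else prod_encode (i, w) # r)"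

lemma tlist_push:
  assumes "tlist orc W"
  shows "tlist orc (\<lambda>a. push c (W a))"
  unfolding push_def Let_def by (intro rec_intros tdec_triv assms)

definition syl :: "nat \<times> nat word \<Rightarrow> nat" where
  "syl = (\<lambda>(i, w). prod_encode (i, list_encode (map nl w)))"

text \<open>Syllables are kept as unnormalised words, since only their nontriviality matters for
  being reduced.\<close>

definition stack :: "nat list \<Rightarrow> 'a \<Rightarrow> bool" where
  "stack st g \<longleftrightarrow> (\<exists>ps. st = map syl ps \<and>
     (\<forall>(i, w)\<in>set ps. i < n + k \<and> w \<in> words {..<length (gens i)} \<and> fval i w \<noteq> \<one>) \<and>
     distinct_adj (map fst ps) \<and> lprod (map (\<lambda>(i, w). fval i w) ps) = g)"

lemma stack_one:
  assumes "stack st g"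
  shows "g = \<one> \<longleftrightarrow> st = []"
proof -
  obtain ps where ps: "st = map syl ps"
     "\<forall>(i, w)\<in>set ps. i < n + k \<and> w \<in> words {..<length (gens i)} \<and> fval i w \<noteq> \<one>"
     "distinct_adj (map fst ps)" "lprod (map (\<lambda>(i, w). fval i w) ps) = g"
    using assms by (auto simp: stack_def)
  show ?thesis
  proof (cases "ps = []")
    case False
    let ?qs = "map (\<lambda>(i, w). (i, fval i w)) ps"
    have m: "map fst ?qs = map fst ps" "map snd ?qs = map (\<lambda>(i, w). fval i w) ps" by auto
    have "\<forall>(i, h)\<in>set ?qs. i \<in> {..<n + k} \<and> h \<in> A i \<and> h \<noteq> \<one>" using ps(2) fval_mem by fastforce
    then have "foldr (\<otimes>) (map snd ?qs) \<one> \<noteq> \<one>"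
      using free_product_factors[unfolded free_product_def, THEN conjunct2, THEN conjunct2, rule_format, of ?qs]
        False ps(3) unfolding m(1) by blast
    then have "lprod (map (\<lambda>(i, w). fval i w) ps) \<noteq> \<one>" unfolding m(2) lprod_def .
    then show ?thesis using ps(1,4) False by simp
  qed (use ps in auto)
qed

lemma stack_push:
  assumes "stack st g" "c \<in> GL \<times> UNIV"
  shows "stack (push (gl c) st) (lval c \<otimes> g)"
proof -
  obtain ps where ps: "st = map syl ps"
     "\<forall>(i, w)\<in>set ps. i < n + k \<and> w \<in> words {..<length (gens i)} \<and> fval i w \<noteq> \<one>"
     "distinct_adj (map fst ps)" "lprod (map (\<lambda>(i, w). fval i w) ps) = g"
    using assms(1) by (auto simp: stack_def)
  obtain i m e where c: "c = ((i, m), e)" "i < n + k" "m < length (gens i)" "(i, m) \<in> GL"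
    using assms(2) by (auto simp: gen_letters_def)
  define b where "b \<longleftrightarrow> ps \<noteq> [] \<and> fst (hd ps) = i"
  define w where "w = (m, e) # (if b then snd (hd ps) else [])"
  define rs where "rs = (if b then tl ps else ps)"
  \<comment> \<open>Once a top syllable of the same factor is removed, the next one belongs to
    another factor, so neither outcome creates equal neighbours.\<close>
  have rs: "set rs \<subseteq> set ps" "distinct_adj (map fst rs)" "rs = [] \<or> fst (hd rs) \<noteq> i"
    using ps(3) by (cases ps; cases "tl ps"; auto simp: rs_def b_def)+
  have ww: "w \<in> words {..<length (gens i)}"
    using ps(2) c(3) by (cases ps) (auto simp: w_def b_def)
  have cl: "set (map (\<lambda>(i, w). fval i w) qs) \<subseteq> carrier G" if "set qs \<subseteq> set ps" for qs
    using that ps(2) fval_mem A_closed by fastforce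
  have val: "fval i w \<otimes> lprod (map (\<lambda>(i, w). fval i w) rs) = lval c \<otimes> g"
  proof -
    have l: "lval c \<in> carrier G" using gval_closed[of "[c]"] c by (simp add: lval_def)
    have lc: "fval i [(m, e)] = lval c" using lval_simp[OF c(4)] gens_mem[OF c(2,3)] c by auto
    show ?thesis
    proof (cases b)
      case True
      then obtain v qs where q: "ps = (i, v) # qs" by (cases ps) (auto simp: b_def)
      have v: "v \<in> words {..<length (gens i)}" using ps(2) q by auto
      have "fval i w = lval c \<otimes> fval i v" using fval_append[OF c(2), of "[(m, e)]" v] v c(3) lc True
        by (simp add: w_def q)
      moreover have "fval i v \<in> carrier G" "lprod (map (\<lambda>(i, w). fval i w) qs) \<in> carrier G"
        using fval_mem[OF c(2) v] c(2) lprod_closed[OF cl[of qs]] q by auto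
      ultimately show ?thesis using ps(4) True l by (simp add: rs_def q m_assoc)
    next
      case False
      then show ?thesis using ps(4) lc by (simp add: rs_def w_def)
    qed
  qed
  have push: "push (gl c) st = (if fval i w = \<one> then map syl rs else map syl ((i, w) # rs))"
  proof -
    have b': "(st \<noteq> [] \<and> pfst (nth0 st 0) = i) = b"
      unfolding ps(1) b_def by (cases ps) (auto simp: nth0_def syl_def)
    have "Suc (prod_encode (prod_encode (m, of_bool e), if b then psnd (nth0 st 0) else 0)) = list_encode (map nl w)"
      unfolding ps(1) w_def by (cases ps) (auto simp: nth0_def syl_def b_def)
    moreover have "(if b then tl st else st) = map syl rs" by (simp add: ps(1) rs_def map_tl)
    ultimately show ?thesis unfolding push_def Let_def c(1) letter_code_simp prod_encode_inverse fst_conv snd_conv b'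
      using triv_iff[OF c(2) ww] by (simp add: syl_def)
  qed
  show ?thesis
  proof (cases "fval i w = \<one>")
    case True
    have "lprod (map (\<lambda>(i, w). fval i w) rs) = lval c \<otimes> g"
      using val True lprod_closed[OF cl[OF rs(1)]] by simp
    then show ?thesis unfolding push using True ps(2) rs unfolding stack_def by (intro exI[of _ rs]) auto
  next
    case False
    have "distinct_adj (map fst ((i, w) # rs))" using rs(2,3) by (cases rs) auto
    then show ?thesis unfolding push using False ps(2) rs ww c(2) val unfolding stack_def
      by (intro exI[of _ "(i, w) # rs"]) auto
  qed
qed

definition wp :: "nat list \<Rightarrow> bool" where
  "wp W \<longleftrightarrow> foldr (\<lambda>c st. if c \<in> GLc then push c st else []) W [] = []"

lemma wp_word: "w \<in> words GL \<Longrightarrow> wp (map gl w) \<longleftrightarrow> gval w = \<one>"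
proof -
  have "w \<in> words GL \<Longrightarrow> stack (foldr (\<lambda>c st. if c \<in> GLc then push c st else []) (map gl w) []) (gval w)"
  proof (induction w)
    case Nil
    show ?case by (simp add: stack_def)
  next
    case (Cons c w)
    have w: "c \<in> GL \<times> UNIV" "w \<in> words GL" using Cons.prems by (cases c; auto)+
    have "gval (c # w) = lval c \<otimes> gval w" using gval_append[of "[c]" w] w by (cases c) (auto simp: lval_def)
    moreover have "gl c \<in> GLc" using w(1) by (simp add: GLc_def)
    ultimately show ?case using stack_push[OF Cons.IH[OF w(2)] w(1)] by simp
  qed
  then show "w \<in> words GL \<Longrightarrow> wp (map gl w) \<longleftrightarrow> gval w = \<one>" using stack_one wp_def by blast
qed

lemma tdec_wp: "tlist orc W \<Longrightarrow> tdec orc (\<lambda>a. wp (W a))"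
proof -
  assume W: "tlist orc W"
  have "trec orc (\<lambda>a. foldr (\<lambda>c s. if c \<in> GLc then list_encode (push c (list_decode s)) else 0) (W a) 0)"
  proof (rule trec_foldr[OF W trec_const])
    have p: "trec orc (\<lambda>b. pfst (psnd b))" "tlist orc (\<lambda>b. list_decode (psnd (psnd b)))" by (intro rec_intros)+
    show "trec orc (\<lambda>b. if pfst (psnd b) \<in> GLc then list_encode (push (pfst (psnd b)) (list_decode (psnd (psnd b)))) else 0)"
      by (rule trec_dispatch[where f = "\<lambda>s b. list_encode (push s (list_decode (psnd (psnd b))))", OF finite_codes(1) p(1) _ trec_const])
         (intro trec_list_encode tlist_push p(2))
  qed
  moreover have "foldr (\<lambda>c s. if c \<in> GLc then list_encode (push c (list_decode s)) else 0) xs 0 =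
      list_encode (foldr (\<lambda>c st. if c \<in> GLc then push c st else []) xs [])" for xs
    by (induction xs) auto
  ultimately have "tlist orc (\<lambda>a. foldr (\<lambda>c st. if c \<in> GLc then push c st else []) (W a) [])"
    by (simp add: tlist_def)
  then show ?thesis unfolding wp_def by (rule tdec_eq_Nil)
qed

definition flip_code :: "nat \<Rightarrow> nat" where
  "flip_code c = prod_encode (pfst c, 1 - psnd c)"

definition same :: "nat list \<Rightarrow> nat list \<Rightarrow> bool" where
  "same U W \<longleftrightarrow> wp (U @ rev (concat (map (\<lambda>c. [flip_code c]) W)))"

lemma tdec_same [rec_intros]: "tlist orc W \<Longrightarrow> tlist orc H \<Longrightarrow> tdec orc (\<lambda>a. same (W a) (H a))"
  unfolding same_def by (intro tdec_wp rec_intros tlist_concat_map) (simp_all add: flip_code_def, intro rec_intros)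

lemma same_word:
  assumes "u \<in> words GL" "v \<in> words GL"
  shows "same (map gl u) (map gl v) \<longleftrightarrow> gval u = gval v"
proof -
  have fc: "flip_code (gl c) = gl (case c of (a, e) \<Rightarrow> (a, \<not> e))" for c
    by (cases c) (simp add: flip_code_def)
  have "concat (map (\<lambda>c. [flip_code c]) (map gl v)) = map (\<lambda>c. flip_code (gl c)) v"
    by (induction v) auto
  then have "rev (concat (map (\<lambda>c. [flip_code c]) (map gl v))) = map gl (word_inv v)"
    unfolding fc by (simp add: word_inv_def rev_map)
  then have "same (map gl u) (map gl v) \<longleftrightarrow> gval (u @ word_inv v) = \<one>"
    using wp_word[of "u @ word_inv v"] assms by (simp add: same_def)
  also have "gval (u @ word_inv v) = gval u \<otimes> inv (gval v)"
    using gval_append assms word_val_inv[OF gen_val_closed assms(2)] by simp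
  also have "\<dots> = \<one> \<longleftrightarrow> gval u = gval v"
    using assms by (metis gval_closed inv_closed inv_equality inv_inv r_inv)
  finally show ?thesis .
qed

subsection \<open>Images of words under automorphisms\<close>

abbreviation "frv \<equiv> fr_val G n k A x gens"
abbreviation fword :: "fr_letter word \<Rightarrow> 'a \<Rightarrow> 'a" where "fword \<equiv> word_val Aut frv"

lemma frv_AutZ: "l \<in> FL \<Longrightarrow> frv l \<in> AutZ"
proof -
  assume l: "l \<in> FL"
  show ?thesis
  proof (cases l)
    case (PConj i m j)
    then show ?thesis using l AutZ_gens(1)[of i _ j] gens_mem[of i m] by (simp add: fr_letters_def)
  next
    case (LTrans i m j)
    then show ?thesis using l AutZ_gens(2)[of i _ j] gens_mem[of i m] by (simp add: fr_letters_def)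
  next
    case (RTrans i m j)
    then show ?thesis using l AutZ_gens(3)[of i _ j] gens_mem[of i m] by (simp add: fr_letters_def)
  qed
qed

lemma frv_auto: "frv ` FL \<subseteq> carrier Aut"
  using frv_AutZ AutZ_auto by auto

lemma fword_AutZ: "w \<in> words FL \<Longrightarrow> fword w \<in> AutZ"
proof -
  assume w: "w \<in> words FL"
  have "fr_gens \<subseteq> carrier Aut" using fr_gens_auto by simp
  then have "subgroup AutZ Aut" unfolding AutZ_eq by (rule group.generate_is_subgroup[OF Aut_group])
  then show ?thesis using group.word_val_in_subgroup[OF Aut_group _ _ w] frv_AutZ by blast
qed

lemma AutZ_fword: "\<Phi> \<in> AutZ \<Longrightarrow> \<exists>w\<in>words FL. fword w = \<Phi>"
  using group.word_val_generate[OF Aut_group frv_auto] AutZ_generated[OF gens] by blast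

text \<open>Chosen nonconstructively, but needed for finitely many pairs of letters only, so the
  choices form a finite table in the program.\<close>

definition subst :: "fr_letter \<times> bool \<Rightarrow> (nat \<times> nat) \<times> bool \<Rightarrow> (nat \<times> nat) word" where
  "subst L c = (SOME u. u \<in> words GL \<and> gval u = fword [L] (lval c))"

lemma subst:
  assumes "L \<in> FL \<times> UNIV" "c \<in> GL \<times> UNIV"
  shows "subst L c \<in> words GL" "gval (subst L c) = fword [L] (lval c)"
proof -
  have "[L] \<in> words FL" using assms(1) by (cases L) auto
  then have "fword [L] \<in> auto G" using fword_AutZ AutZ_auto by blast
  moreover have "lval c \<in> carrier G" using gval_closed[of "[c]"] assms(2) by (cases c) (auto simp: lval_def)
  ultimately have "fword [L] (lval c) \<in> carrier G" by (rule auto_closed)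
  then have "\<exists>u. u \<in> words GL \<and> gval u = fword [L] (lval c)" using gval_ex by blast
  then have "subst L c \<in> words GL \<and> gval (subst L c) = fword [L] (lval c)" unfolding subst_def by (rule someI_ex)
  then show "subst L c \<in> words GL" "gval (subst L c) = fword [L] (lval c)" by auto
qed

definition subst_code :: "nat \<Rightarrow> nat \<Rightarrow> nat list" where
  "subst_code s c = (if c \<in> GLc then map gl (subst (inv_into UNIV fl s) (inv_into UNIV gl c)) else [])"

text \<open>Letters are applied from the last to the first, as products in the automorphism group
  are compositions.\<close>

definition img :: "nat list \<Rightarrow> nat list \<Rightarrow> nat list" where
  "img W U = foldr (\<lambda>s U. if s \<in> FLc then concat (map (subst_code s) U) else []) W U"

lemma tlist_img:
  assumes "tlist orc W" "tlist orc U"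
  shows "tlist orc (\<lambda>a. img (W a) (U a))"
proof -
  have "trec orc (\<lambda>a. foldr (\<lambda>s u. if s \<in> FLc then list_encode (concat (map (subst_code s) (list_decode u))) else 0)
      (W a) (list_encode (U a)))"
  proof (rule trec_foldr[OF assms(1) trec_list_encode[OF assms(2)]])
    have p: "trec orc (\<lambda>b. pfst (psnd b))" "tlist orc (\<lambda>b. list_decode (psnd (psnd b)))" by (intro rec_intros)+
    show "trec orc (\<lambda>b. if pfst (psnd b) \<in> FLc then
        list_encode (concat (map (subst_code (pfst (psnd b))) (list_decode (psnd (psnd b))))) else 0)"
    proof (rule trec_dispatch[where f = "\<lambda>s b. list_encode (concat (map (subst_code s) (list_decode (psnd (psnd b)))))",
          OF finite_codes(3) p(1) _ trec_const])
      fix s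
      have "trec orc (\<lambda>b. if psnd b \<in> GLc then list_encode (map gl (subst (inv_into UNIV fl s) (inv_into UNIV gl (psnd b)))) else list_encode [])"
        by (rule trec_dispatch[where f = "\<lambda>c b. list_encode (map gl (subst (inv_into UNIV fl s) (inv_into UNIV gl c)))",
             OF finite_codes(1) trec_snd[OF trec_id] trec_const trec_const])
      then have "tlist orc (\<lambda>b. subst_code s (psnd b))"
        unfolding tlist_def subst_code_def if_distrib[of list_encode] .
      then show "trec orc (\<lambda>b. list_encode (concat (map (subst_code s) (list_decode (psnd (psnd b))))))"
        by (intro trec_list_encode tlist_concat_map[OF p(2)])
    qed
  qed
  moreover have "foldr (\<lambda>s u. if s \<in> FLc then list_encode (concat (map (subst_code s) (list_decode u))) else 0) xs (list_encode u)
      = list_encode (img xs u)" for xs u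
    by (induction xs) (auto simp: img_def)
  ultimately show ?thesis by (simp add: tlist_def)
qed

lemma img_word:
  assumes "w \<in> words FL" "u \<in> words GL"
  shows "\<exists>v\<in>words GL. img (map fl w) (map gl u) = map gl v \<and> gval v = fword w (gval u)"
  using assms(1)
proof (induction w)
  case Nil
  have "fword [] (gval u) = gval u"
    using group.word_val_Nil[OF Aut_group, of frv] gval_closed[OF assms(2)] by (simp add: Aut_one)
  then show ?case using assms(2) by (intro bexI[of _ u]) (auto simp: img_def)
next
  case (Cons L w)
  have w: "L \<in> FL \<times> UNIV" "w \<in> words FL" "[L] \<in> words FL" using Cons.prems by (cases L; auto)+
  obtain v where v: "v \<in> words GL" "img (map fl w) (map gl u) = map gl v" "gval v = fword w (gval u)"
    using Cons.IH w by blast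
  have L: "fword [L] \<in> auto G" "fword w \<in> auto G" using fword_AutZ AutZ_auto w by blast+
  interpret p: group_hom G G "fword [L]"
    using auto_hom[OF L(1)] by (simp add: group_hom_def group_hom_axioms_def is_group)
  have sc: "subst_code (fl L) (gl c) = map gl (subst L c)" if "c \<in> GL \<times> UNIV" for c
    using that by (simp add: subst_code_def GLc_def inv_f_f letter_code_inj inj_pe inj_on_fr_code)
  define v' where "v' = concat (map (subst L) v)"
  have "v' \<in> words GL \<and> gval v' = fword [L] (gval v) \<and> concat (map (subst_code (fl L)) (map gl v)) = map gl v'"
    using v(1) unfolding v'_def
  proof (induction v)
    case (Cons c v)
    have c: "c \<in> GL \<times> UNIV" "v \<in> words GL" "[c] \<in> words GL" using Cons.prems by (cases c; auto)+
    have "gval (c # v) = lval c \<otimes> gval v" using gval_append[OF c(3,2)] by (simp add: lval_def)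
    moreover have "lval c \<in> carrier G" using gval_closed[OF c(3)] by (simp add: lval_def)
    ultimately show ?case using Cons.IH[OF c(2)] subst[OF w(1) c(1)] sc[OF c(1)] gval_append c(2) by simp
  qed simp
  moreover have "img (map fl (L # w)) (map gl u) = concat (map (subst_code (fl L)) (map gl v))"
    using v(2) w(1) by (simp add: img_def FLc_def)
  moreover have "fword (L # w) = fword [L] \<otimes>\<^bsub>Aut\<^esub> fword w"
    using group.word_val_append[OF Aut_group frv_auto w(3,2)] by simp
  then have "fword (L # w) (gval u) = fword [L] (gval v)"
    using Aut_mult_apply[OF L gval_closed[OF assms(2)]] v(3) by simp
  ultimately show ?case by (intro bexI[of _ v']) auto
qed

end

section \<open>Certificates\<close>

lemma triangle_mono: "m \<le> m' \<Longrightarrow> triangle m \<le> triangle m'"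
  by (induction rule: dec_induct) auto

text \<open>This makes the least certificate carry the least word among all words that share its
  second component.\<close>

lemma prod_encode_less: "a < b \<Longrightarrow> prod_encode (a, r) < prod_encode (b, r)"
  using triangle_mono[of "a + r" "b + r"] by (simp add: prod_encode_def)

context eff_data
begin

text \<open>Extensional functions make the set of candidate permutations and signs finite, so these
  data are searched for by \<open>pos_code\<close> and not stored in the certificate.\<close>

definition signs :: "((nat \<Rightarrow> nat) \<times> (nat \<Rightarrow> bool)) set" where
  "signs = {\<pi> \<in> {..<k} \<rightarrow>\<^sub>E {..<k}. inj_on \<pi> {..<k}} \<times> ({..<k} \<rightarrow>\<^sub>E UNIV)"

lemma finite_signs: "finite signs"
proof -
  have "finite {\<pi> \<in> {..<k} \<rightarrow>\<^sub>E {..<k}. inj_on \<pi> {..<k}}"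
    by (rule finite_subset[OF _ finite_PiE[of "{..<k}" "\<lambda>_. {..<k}"]]) auto
  moreover have "finite ({..<k} \<rightarrow>\<^sub>E (UNIV :: bool set))" by (intro finite_PiE) auto
  ultimately show ?thesis by (simp add: signs_def)
qed

definition sx :: "nat \<Rightarrow> bool \<Rightarrow> 'a" where
  "sx j e = (if e then x j else inv (x j))"

definition xword :: "nat \<Rightarrow> bool \<Rightarrow> (nat \<times> nat) word" where
  "xword j e = (SOME u. u \<in> words GL \<and> gval u = sx j e)"

lemma xword: "j < k \<Longrightarrow> xword j e \<in> words GL \<and> gval (xword j e) = sx j e"
proof -
  assume "j < k"
  then have "sx j e \<in> carrier G" by (simp add: sx_def)
  then have "\<exists>u. u \<in> words GL \<and> gval u = sx j e" using gval_ex by blast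
  then show ?thesis unfolding xword_def by (rule someI_ex)
qed

definition ALc :: "nat \<Rightarrow> nat set" where
  "ALc i = gl ` (({i} \<times> {..<length (gens i)}) \<times> UNIV)"

lemma finite_ALc: "finite (ALc i)" by (simp add: ALc_def)

definition inw :: "nat \<Rightarrow> nat \<Rightarrow> nat list" where
  "inw a i = list_decode (nth0 (list_decode a) i)"

text \<open>That the conjugate of a generator by an entry fixes 0 is tested as the generator fixing
  the image of 0 under the entry, which avoids inverse words.\<close>

definition neg_code :: "nat \<Rightarrow> nat \<Rightarrow> bool" where
  "neg_code a r \<longleftrightarrow>
     (\<forall>i<n. \<forall>m<length (gens i). run (list_decode r) (gl ((i, m), True) # inw a i) 0 = run (list_decode r) (inw a i) 0) \<and>
     (\<forall>j<k. run (list_decode r) (inw a (n + j)) 0 = 0) \<and>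
     (\<exists>c\<in>GL. \<not> run (list_decode r) [gl (c, True)] 0 = 0)"

text \<open>For each i below n, \<open>r\<close> stores a word for a slack element of
  \<open>A i\<close>; the conjugation equation is multiplied out, again to avoid inverses.\<close>

definition pos_code :: "nat \<Rightarrow> nat \<Rightarrow> nat \<Rightarrow> bool" where
  "pos_code a s r \<longleftrightarrow>
     (\<forall>c\<in>set (list_decode s). c \<in> FLc) \<and>
     (\<forall>i<n. (\<forall>c\<in>set (inw r i). c \<in> ALc i) \<and>
        (\<forall>m<length (gens i). same (inw r i @ inw a i @ img (list_decode s) [gl ((i, m), True)])
            (gl ((i, m), True) # inw r i @ inw a i))) \<and>
     (\<exists>p\<in>signs. \<forall>j<k. same (img (list_decode s) (map gl (xword (fst p j) (snd p j)))) (inw a (n + j)))"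

text \<open>Negative certificates have first component 0 and positive ones the successor of a word
  code, so the first component of a certificate is already the answer in the sense of
  \<open>answer_code\<close>.\<close>

definition check :: "nat \<Rightarrow> nat \<Rightarrow> bool" where
  "check a y \<longleftrightarrow> (if pfst y = 0 then neg_code a (psnd y) else pos_code a (pfst y - 1) (psnd y))"

lemma tlist_inw [rec_intros]: "trec orc f \<Longrightarrow> tlist orc (\<lambda>a. inw (f a) i)"
  unfolding inw_def by (intro rec_intros)

lemma tdec_neg_code:
  assumes "trec orc f" "trec orc g" shows "tdec orc (\<lambda>b. neg_code (f b) (g b))"
  unfolding neg_code_def by (intro rec_intros trec_run finite_GL assms)

lemma tdec_pos_code:
  assumes "trec orc f" "trec orc s" "trec orc g" shows "tdec orc (\<lambda>b. pos_code (f b) (s b) (g b))"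
proof -
  have "tdec orc (\<lambda>b. \<forall>c\<in>set (list_decode (s b)). c \<in> FLc)"
    by (rule tdec_list_all) (intro rec_intros assms finite_codes)+
  moreover have "tdec orc (\<lambda>b. \<forall>c\<in>set (inw (g b) i). c \<in> ALc i)" for i
    by (rule tdec_list_all) (intro rec_intros assms finite_ALc)+
  ultimately show ?thesis unfolding pos_code_def
    by (intro rec_intros tlist_img finite_signs assms)
qed

lemma tdec_check: "tdec orc (\<lambda>b. check (pfst b) (psnd b))"
  unfolding check_def by (intro rec_intros tdec_neg_code tdec_pos_code)

text \<open>The checks only depend on the elements of \<open>G\<close> and of \<open>Aut0\<close> that the words represent.\<close>

definition neg_cert :: "'a list \<Rightarrow> nat \<Rightarrow> bool" where
  "neg_cert gs r \<longleftrightarrow>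
     (\<forall>i<n. \<forall>m<length (gens i). act (cert (list_decode r)) (gens i ! m \<otimes> gs ! i) 0 = act (cert (list_decode r)) (gs ! i) 0) \<and>
     (\<forall>j<k. act (cert (list_decode r)) (gs ! (n + j)) 0 = 0) \<and>
     (\<exists>c\<in>GL. act (cert (list_decode r)) (gen_val gens c) 0 \<noteq> 0)"

definition pos_cert :: "'a list \<Rightarrow> ('a \<Rightarrow> 'a) \<Rightarrow> nat \<Rightarrow> bool" where
  "pos_cert gs \<Phi> r \<longleftrightarrow>
     (\<forall>i<n. \<exists>v\<in>words ({i} \<times> {..<length (gens i)}). inw r i = map gl v \<and>
        (\<forall>m<length (gens i). gval v \<otimes> gs ! i \<otimes> \<Phi> (gens i ! m) = gens i ! m \<otimes> (gval v \<otimes> gs ! i))) \<and>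
     (\<exists>p\<in>signs. \<forall>j<k. \<Phi> (sx (fst p j) (snd p j)) = gs ! (n + j))"

definition certified :: "'a list \<Rightarrow> nat \<Rightarrow> bool" where
  "certified gs y \<longleftrightarrow> (if pfst y = 0 then neg_cert gs (psnd y)
     else \<exists>w\<in>words FL. pfst y - 1 = word_code fr_code w \<and> pos_cert gs (fword w) (psnd y))"

lemma inw_input:
  assumes "length ws = n + k" "i < n + k"
  shows "inw (input_code ws) i = map gl (ws ! i)"
  using assms by (simp add: inw_def input_code_def nth0_def word_code_eq)

lemma AL_GL: "i < n + k \<Longrightarrow> words ({i} \<times> {..<length (gens i)}) \<subseteq> words GL"
  by (auto simp: words_def gen_letters_def in_lists_conv_set)

lemma check_iff:
  assumes ws: "length ws = n + k" "set ws \<subseteq> words GL"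
  shows "check (input_code ws) y \<longleftrightarrow> certified (map gval ws) y"
proof -
  let ?gs = "map gval ws"
  have w: "ws ! i \<in> words GL" "?gs ! i = gval (ws ! i)" "?gs ! i \<in> carrier G" if "i < n + k" for i
  proof -
    show "ws ! i \<in> words GL" using ws(2) nth_mem[of i ws] that ws(1) by (simp add: subset_iff)
    then show "?gs ! i = gval (ws ! i)" "?gs ! i \<in> carrier G" using that ws(1) by simp_all
  qed
  have inw: "inw (input_code ws) i = map gl (ws ! i)" if "i < n + k" for i
    using inw_input[OF ws(1) that] .
  have letter: "((i, m), True) # u \<in> words GL" "gval (((i, m), True) # u) = gens i ! m \<otimes> gval u"
    if "i < n + k" "m < length (gens i)" "u \<in> words GL" for i m u
    using that by (auto simp: gen_letters_def gen_val_def)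
  have gl_Cons: "gl c # map gl u = map gl (c # u)" for c u by simp
  have neg: "neg_code (input_code ws) r \<longleftrightarrow> neg_cert ?gs r" for r
  proof -
    let ?C = "list_decode r"
    have "run ?C (gl ((i, m), True) # inw (input_code ws) i) 0 = act (cert ?C) (gens i ! m \<otimes> ?gs ! i) 0"
      if "i < n" "m < length (gens i)" for i m
      unfolding inw[OF trans_less_add1[OF that(1)]] gl_Cons
      using run_word[OF letter(1)[OF _ that(2) w(1)]] letter(2)[OF _ that(2) w(1)] w(2) that(1) by simp
    moreover have r: "run ?C (inw (input_code ws) i) 0 = act (cert ?C) (?gs ! i) 0" if "i < n + k" for i
      unfolding inw[OF that] w(2)[OF that] by (rule run_word[OF w(1)[OF that]])
    moreover have "run ?C [gl (c, True)] 0 = act (cert ?C) (gen_val gens c) 0" if "c \<in> GL" for c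
      using run_word[of "[(c, True)]" ?C 0] that gen_val_closed by auto
    ultimately show ?thesis unfolding neg_code_def neg_cert_def by simp
  qed
  have pos: "pos_code (input_code ws) s r \<longleftrightarrow> (\<exists>w\<in>words FL. s = word_code fr_code w \<and> pos_cert ?gs (fword w) r)" for s r
  proof (cases "\<exists>w\<in>words FL. list_decode s = map fl w")
    case False
    then have "\<not> (\<forall>c\<in>set (list_decode s). c \<in> FLc)" unfolding FLc_def in_letter_codes by blast
    moreover have "s \<noteq> word_code fr_code w" if "w \<in> words FL" for w
      using False that by (auto simp: word_code_eq)
    ultimately show ?thesis unfolding pos_code_def by blast
  next
    case True
    then obtain f where f: "f \<in> words FL" "list_decode s = map fl f" by blast
    have s: "s = word_code fr_code f" using f(2) unfolding word_code_eq by (metis list_decode_inverse)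
    have Phi: "fword f \<in> auto G" using fword_AutZ[OF f(1)] AutZ_auto by blast
    have FLs: "\<forall>c\<in>set (list_decode s). c \<in> FLc" unfolding FLc_def in_letter_codes f(2) using f(1) by blast
    have A: "((\<forall>c\<in>set (inw r i). c \<in> ALc i) \<and>
        (\<forall>m<length (gens i). same (inw r i @ inw (input_code ws) i @ img (list_decode s) [gl ((i, m), True)])
            (gl ((i, m), True) # inw r i @ inw (input_code ws) i))) \<longleftrightarrow>
        (\<exists>v\<in>words ({i} \<times> {..<length (gens i)}). inw r i = map gl v \<and>
        (\<forall>m<length (gens i). gval v \<otimes> ?gs ! i \<otimes> fword f (gens i ! m) = gens i ! m \<otimes> (gval v \<otimes> ?gs ! i)))"
      (is "?L \<longleftrightarrow> ?R") if i: "i < n" for i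
    proof -
      have ik: "i < n + k" using i by simp
      have eq: "same (map gl v @ inw (input_code ws) i @ img (list_decode s) [gl ((i, m), True)])
            (gl ((i, m), True) # map gl v @ inw (input_code ws) i) \<longleftrightarrow>
          gval v \<otimes> ?gs ! i \<otimes> fword f (gens i ! m) = gens i ! m \<otimes> (gval v \<otimes> ?gs ! i)"
        if v: "v \<in> words ({i} \<times> {..<length (gens i)})" and m: "m < length (gens i)" for v m
      proof -
        have vG: "v \<in> words GL" using v AL_GL[OF ik] by blast
        have l: "[((i, m), True)] \<in> words GL" "gval [((i, m), True)] = gens i ! m"
          using letter[OF ik m, of "[]"] gens_carrier[OF ik m] by auto
        obtain u where u: "u \<in> words GL" "img (map fl f) (map gl [((i, m), True)]) = map gl u"
          "gval u = fword f (gens i ! m)" using img_word[OF f(1) l(1)] l(2) by auto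
        have "same (map gl (v @ ws ! i @ u)) (map gl (((i, m), True) # v @ ws ! i)) \<longleftrightarrow>
            gval (v @ ws ! i @ u) = gval (((i, m), True) # v @ ws ! i)"
          by (rule same_word) (use vG w(1)[OF ik] u(1) letter(1)[OF ik m] in simp_all)
        moreover have "gval (v @ ws ! i @ u) = gval v \<otimes> ?gs ! i \<otimes> fword f (gens i ! m)"
        proof -
          have "gval (v @ ws ! i @ u) = gval v \<otimes> (gval (ws ! i) \<otimes> gval u)"
            using gval_append[OF vG, of "ws ! i @ u"] gval_append[OF w(1)[OF ik] u(1)] w(1)[OF ik] u(1) by simp
          also have "\<dots> = gval v \<otimes> gval (ws ! i) \<otimes> gval u"
            using m_assoc[OF gval_closed[OF vG] gval_closed[OF w(1)[OF ik]] gval_closed[OF u(1)]] by simp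
          finally show ?thesis unfolding w(2)[OF ik] u(3) .
        qed
        moreover have "gval (((i, m), True) # v @ ws ! i) = gens i ! m \<otimes> (gval v \<otimes> ?gs ! i)"
          using letter(2)[OF ik m, of "v @ ws ! i"] gval_append vG w[OF ik] by simp
        ultimately show ?thesis using u(2) by (simp add: inw[OF ik] f(2))
      qed
      have "(\<forall>c\<in>set (inw r i). c \<in> ALc i) \<longleftrightarrow> (\<exists>v\<in>words ({i} \<times> {..<length (gens i)}). inw r i = map gl v)"
        unfolding ALc_def by (rule in_letter_codes)
      then have L: "?L \<longleftrightarrow> (\<exists>v\<in>words ({i} \<times> {..<length (gens i)}). inw r i = map gl v) \<and>
          (\<forall>m<length (gens i). same (inw r i @ inw (input_code ws) i @ img (list_decode s) [gl ((i, m), True)])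
            (gl ((i, m), True) # inw r i @ inw (input_code ws) i))" by (rule arg_cong)
      show ?thesis
      proof
        assume ?L
        then obtain v where v: "v \<in> words ({i} \<times> {..<length (gens i)})" "inw r i = map gl v" unfolding L by blast
        have "\<forall>m<length (gens i). gval v \<otimes> ?gs ! i \<otimes> fword f (gens i ! m) = gens i ! m \<otimes> (gval v \<otimes> ?gs ! i)"
          using \<open>?L\<close>[THEN conjunct2] unfolding v(2) using eq[OF v(1)] by blast
        then show ?R using v by blast
      next
        assume ?R
        then obtain v where v: "v \<in> words ({i} \<times> {..<length (gens i)})" "inw r i = map gl v"
          "\<forall>m<length (gens i). gval v \<otimes> ?gs ! i \<otimes> fword f (gens i ! m) = gens i ! m \<otimes> (gval v \<otimes> ?gs ! i)" by blast
        have "\<forall>m<length (gens i). same (inw r i @ inw (input_code ws) i @ img (list_decode s) [gl ((i, m), True)])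
            (gl ((i, m), True) # inw r i @ inw (input_code ws) i)"
          unfolding v(2) using v(3) eq[OF v(1)] by blast
        then show ?L unfolding L using v(1,2) by blast
      qed
    qed
    have B: "same (img (list_decode s) (map gl (xword (fst p j) (snd p j)))) (inw (input_code ws) (n + j)) \<longleftrightarrow>
        fword f (sx (fst p j) (snd p j)) = ?gs ! (n + j)" if p: "p \<in> signs" and j: "j < k" for p j
    proof -
      have "fst p \<in> {..<k} \<rightarrow>\<^sub>E {..<k}" using p unfolding signs_def mem_Times_iff by blast
      then have pj: "fst p j < k" using PiE_mem[of "fst p" "{..<k}" "\<lambda>_. {..<k}" j] j by simp
      obtain u where u: "u \<in> words GL" "img (map fl f) (map gl (xword (fst p j) (snd p j))) = map gl u"
        "gval u = fword f (sx (fst p j) (snd p j))" using img_word[OF f(1)] xword[OF pj] by metis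
      have jn: "n + j < n + k" using j by simp
      show ?thesis using same_word[OF u(1) w(1)[OF jn]] u(2,3) w(2)[OF jn] by (simp add: inw[OF jn] f(2))
    qed
    have "pos_code (input_code ws) s r \<longleftrightarrow> pos_cert ?gs (fword f) r"
      unfolding pos_code_def pos_cert_def using FLs A B by simp
    moreover have "s = word_code fr_code f' \<longleftrightarrow> f' = f" for f'
      using s word_code_inj[OF inj_on_fr_code] by metis
    ultimately show ?thesis using f(1) by simp
  qed
  show ?thesis unfolding check_def certified_def using neg pos by simp
qed

section \<open>Soundness and completeness of certificates\<close>

abbreviation gens_tuple :: "'a list \<Rightarrow> bool" where "gens_tuple gs \<equiv> tuple_generates G n k A gs"

text \<open>Only the first n + k lists matter, so an action fits into a finite certificate.\<close>

lemma act_cong: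
  assumes "\<And>i. i < n + k \<Longrightarrow> L i = L' i" "g \<in> carrier G"
  shows "act L g = act L' g"
proof (rule hom_eqI[OF group_SymN act_hom act_hom _ _ assms(2)])
  show "act L a = act L' a" if "i < n" "a \<in> A i" for i a
    using act_A[OF that] assms(1)[of i] that(1) by (intro ext) simp
  show "act L (x j) = act L' (x j)" if "j < k" for j
    using act_x[OF that] assms(1)[of "n + j"] that by (intro ext) simp
qed

lemma neg_cert_sound:
  assumes gs: "length gs = n + k" "set gs \<subseteq> carrier G" and "neg_cert gs r"
  shows "\<not> gens_tuple gs"
proof
  assume gen: "gens_tuple gs"
  let ?a = "act (cert (list_decode r))"
  have c: "gs ! i \<in> carrier G" if "i < n + k" for i using gs that nth_mem[of i gs] by auto
  have h: "\<And>i m. i < n \<Longrightarrow> m < length (gens i) \<Longrightarrow> ?a (gens i ! m \<otimes> gs ! i) 0 = ?a (gs ! i) 0"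
    "\<And>j. j < k \<Longrightarrow> ?a (gs ! (n + j)) 0 = 0" "\<exists>c\<in>GL. ?a (gen_val gens c) 0 \<noteq> 0"
    using assms(3) by (auto simp: neg_cert_def)
  let ?S = "(\<Union>i<n. conj_subgroup G (gs ! i) (A i)) \<union> {gs ! (n + j) |j. j < k}"
  \<comment> \<open>The stabiliser of a point is a subgroup, so testing the generators of
    \<open>A i\<close> is enough.\<close>
  have fixA: "?a a (?a (gs ! i) 0) = ?a (gs ! i) 0" if i: "i < n" and a: "a \<in> A i" for i a
  proof -
    have "a \<in> generate G (set (gens i))" using gens[of i] i a by simp
    then show ?thesis
    proof (induction rule: generate.induct)
      case one
      show ?case by simp
    next
      case (incl b)
      then obtain m where m: "m < length (gens i)" "b = gens i ! m" by (auto simp: in_set_conv_nth)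
      have mc: "gens i ! m \<in> carrier G" "gs ! i \<in> carrier G" using gens_carrier[of i m] m(1) c[of i] i by simp_all
      then show ?case using h(1)[OF i m(1)] m act_mult[OF mc(1) mc(2)] by simp
    next
      case (inv b)
      then obtain m where m: "m < length (gens i)" "b = gens i ! m" by (auto simp: in_set_conv_nth)
      have mc: "gens i ! m \<in> carrier G" "gs ! i \<in> carrier G" using gens_carrier[of i m] m(1) c[of i] i by simp_all
      have "?a b (?a (gs ! i) 0) = ?a (gs ! i) 0" "b \<in> carrier G"
        using h(1)[OF i m(1)] m act_mult[OF mc(1) mc(2)] mc by simp_all
      then show ?case using act_fix_inv by blast
    next
      case (eng b b')
      have "generate G (set (gens i)) \<subseteq> carrier G" using gens[of i] A_sub[OF i] i by simp
      then show ?case using eng by (simp add: subset_iff)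
    qed
  qed
  have S: "s \<in> carrier G \<and> ?a s 0 = 0" if "s \<in> ?S" for s
    using that
  proof
    assume "s \<in> (\<Union>i<n. conj_subgroup G (gs ! i) (A i))"
    then obtain i a where i: "i < n" "a \<in> A i" "s = inv (gs ! i) \<otimes> a \<otimes> gs ! i" by (auto simp: conj_subgroup_def)
    have cl: "a \<in> carrier G" "gs ! i \<in> carrier G" using i c by auto
    then show ?thesis using fixA[OF i(1,2)] by (simp add: i(3))
  next
    assume "s \<in> {gs ! (n + j) |j. j < k}"
    then show ?thesis using h(2) c by auto
  qed
  have z: "?a g 0 = 0" if "g \<in> carrier G" for g
  proof -
    have "g \<in> generate G ?S" using gen that by (simp add: tuple_generates_def)
    moreover have "?S \<subseteq> carrier G" using S by blast
    ultimately show ?thesis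
    proof (induction rule: generate_induct_left)
      case (left s g)
      from left(1) have "?a s 0 = 0 \<and> s \<in> carrier G"
      proof
        assume s: "s \<in> ?S"
        show ?thesis using S[OF s] by simp
      next
        assume "\<exists>t\<in>?S. s = inv t"
        then obtain t where t: "t \<in> ?S" "s = inv t" by (rule bexE)
        show ?thesis using S[OF t(1)] act_fix_inv[of t] unfolding t(2) by simp
      qed
      then show ?case using left by simp
    qed simp
  qed
  obtain c where c: "c \<in> GL" "?a (gen_val gens c) 0 \<noteq> 0" using h(3) by (rule bexE)
  have "gen_val gens c \<in> carrier G" using gen_val_closed imageI[OF c(1)] by (rule subsetD)
  then show False using z c(2) by simp
qed

text \<open>\<open>\<Phi>\<close> and a conjugation are both homomorphisms, so their tested
  agreement on the generators extends to the factor.\<close>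

lemma pos_cert_conj:
  assumes gs: "length gs = n + k" "set gs \<subseteq> carrier G" and Phi: "\<Phi> \<in> AutZ" and cert: "pos_cert gs \<Phi> r"
    and i: "i < n"
  shows "\<exists>c\<in>A i. \<forall>a\<in>A i. \<Phi> a = inv (c \<otimes> gs ! i) \<otimes> a \<otimes> (c \<otimes> gs ! i)"
proof -
  have g: "gs ! i \<in> carrier G" using gs i nth_mem[of i gs] by auto
  have ik: "i < n + k" using i by simp
  obtain v where v: "v \<in> words ({i} \<times> {..<length (gens i)})"
    "\<And>m. m < length (gens i) \<Longrightarrow> gval v \<otimes> gs ! i \<otimes> \<Phi> (gens i ! m) = gens i ! m \<otimes> (gval v \<otimes> gs ! i)"
    using cert i unfolding pos_cert_def by blast
  have vA: "gval v \<in> A i"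
    by (rule word_val_in_subgroup[OF subgroup_A[OF ik] _ v(1)]) (use gens_mem[OF ik] in \<open>auto simp: gen_val_def\<close>)
  define c where "c = gval v \<otimes> gs ! i"
  have c: "c \<in> carrier G" using vA ik g by (simp add: c_def)
  have Pa: "\<Phi> \<in> auto G" using Phi AutZ_auto by blast
  have "(\<lambda>a. inv c \<otimes> a \<otimes> c) \<in> hom G G" using c by (auto simp: hom_def m_assoc)
  moreover have "\<Phi> s = inv c \<otimes> s \<otimes> c" if s: "s \<in> set (gens i)" for s
  proof -
    obtain m where m: "m < length (gens i)" "s = gens i ! m" using s by (auto simp: in_set_conv_nth)
    have "s \<in> carrier G" "\<Phi> s \<in> carrier G" using gens_carrier[OF ik m(1)] m(2) auto_closed[OF Pa] by auto
    moreover have "c \<otimes> \<Phi> s = s \<otimes> c" using v(2)[OF m(1)] m(2) by (simp add: c_def)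
    then have "inv c \<otimes> (c \<otimes> \<Phi> s) = inv c \<otimes> (s \<otimes> c)" by simp
    ultimately show ?thesis using c by (simp add: m_assoc)
  qed
  moreover have "set (gens i) \<subseteq> carrier G" using gens[OF ik] A_sub[OF i] by blast
  ultimately have "\<Phi> a = inv c \<otimes> a \<otimes> c" if "a \<in> A i" for a
    using hom_eq_on_generate[OF group_axioms auto_hom[OF Pa], of "\<lambda>a. inv c \<otimes> a \<otimes> c" "set (gens i)" a]
      gens[OF ik] that by blast
  then show ?thesis using vA by (auto simp: c_def)
qed

lemma pos_cert_sound:
  assumes gs: "length gs = n + k" "set gs \<subseteq> carrier G" and Phi: "\<Phi> \<in> AutZ" and cert: "pos_cert gs \<Phi> r"
  shows "\<And>i. i < n \<Longrightarrow> \<Phi> ` A i = conj_subgroup G (gs ! i) (A i)"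
    "\<exists>B. free_basis (G\<lparr>carrier := F\<rparr>) B \<and> \<Phi> ` B = {gs ! (n + j) |j. j < k}"
    "gens_tuple gs"
proof -
  have g: "gs ! i \<in> carrier G" if "i < n + k" for i using gs that nth_mem[of i gs] by auto
  have Pa: "\<Phi> \<in> auto G" using Phi AutZ_auto by blast
  interpret p: group_hom G G \<Phi>
    using auto_hom[OF Pa] by (simp add: group_hom_def group_hom_axioms_def is_group)
  show im: "\<Phi> ` A i = conj_subgroup G (gs ! i) (A i)" if i: "i < n" for i
  proof -
    obtain c where c: "c \<in> A i" "\<forall>a\<in>A i. \<Phi> a = inv (c \<otimes> gs ! i) \<otimes> a \<otimes> (c \<otimes> gs ! i)"
      using pos_cert_conj[OF gs Phi cert i] by blast
    have cc: "c \<in> carrier G" "gs ! i \<in> carrier G" using c(1) i g by auto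
    \<comment> \<open>Conjugation by the slack element permutes \<open>A i\<close>, so the image is
      the conjugate by \<open>gs ! i\<close> alone.\<close>
    have eq: "\<Phi> a = inv (gs ! i) \<otimes> (inv c \<otimes> a \<otimes> c) \<otimes> gs ! i" "inv c \<otimes> a \<otimes> c \<in> A i" if "a \<in> A i" for a
    proof -
      have "a \<in> carrier G" using that i by simp
      then show "\<Phi> a = inv (gs ! i) \<otimes> (inv c \<otimes> a \<otimes> c) \<otimes> gs ! i"
        using c(2) that cc by (simp add: m_assoc inv_mult_group)
      show "inv c \<otimes> a \<otimes> c \<in> A i" using c(1) that i by simp
    qed
    show ?thesis
    proof
      show "\<Phi> ` A i \<subseteq> conj_subgroup G (gs ! i) (A i)" using eq by (auto simp: conj_subgroup_def)
      show "conj_subgroup G (gs ! i) (A i) \<subseteq> \<Phi> ` A i"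
      proof
        fix s assume "s \<in> conj_subgroup G (gs ! i) (A i)"
        then obtain a where a: "a \<in> A i" "s = inv (gs ! i) \<otimes> a \<otimes> gs ! i" by (auto simp: conj_subgroup_def)
        have ac: "a \<in> carrier G" using a i by simp
        have "c \<otimes> a \<otimes> inv c \<in> A i" using a c(1) i by simp
        moreover have "\<Phi> (c \<otimes> a \<otimes> inv c) = s"
          using eq(1)[OF calculation] ac cc by (simp add: a(2) m_assoc)
        ultimately show "s \<in> \<Phi> ` A i" by (metis imageI)
      qed
    qed
  qed
  obtain \<pi> \<epsilon> where p: "(\<pi>, \<epsilon>) \<in> signs" "\<And>j. j < k \<Longrightarrow> \<Phi> (sx (\<pi> j) (\<epsilon> j)) = gs ! (n + j)"
    using cert unfolding pos_cert_def by auto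
  have pk: "\<pi> j < k" if "j < k" for j using p(1) that by (auto simp: signs_def)
  have pinj: "inj_on \<pi> {..<k}" using p(1) by (auto simp: signs_def)
  have pim: "\<pi> ` {..<k} = {..<k}" by (intro endo_inj_surj pinj) (use pk in auto)
  let ?b = "\<lambda>j. sx (\<pi> j) (\<epsilon> j)"
  let ?B = "?b ` {..<k}"
  have bF: "?b j \<in> F" if "j < k" for j
    using x_F[OF pk[OF that]] subgroup.m_inv_closed[OF subgroup_F] by (simp add: sx_def)
  have bc: "?b j \<in> carrier G" if "j < k" for j using pk[OF that] by (simp add: sx_def)
  have xb: "x (\<pi> j) = (if \<epsilon> j then ?b j else inv (?b j))" if "j < k" for j
    using pk[OF that] by (simp add: sx_def)
  have b_par: "par {\<pi> j} (?b j') \<longleftrightarrow> \<pi> j' = \<pi> j" if "j < k" "j' < k" for j j'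
    using pk that by (simp add: sx_def)
  have b_inj: "inj_on ?b {..<k}"
  proof (rule inj_onI)
    fix j j' assume j: "j \<in> {..<k}" "j' \<in> {..<k}" "?b j = ?b j'"
    then have "\<pi> j' = \<pi> j" using b_par[of j j'] b_par[of j j] by simp
    then show "j = j'" using inj_onD[OF pinj] j by force
  qed
  have "free_basis (G\<lparr>carrier := F\<rparr>) ?B"
    unfolding free_basis_def
  proof (intro conjI ballI impI)
    show "?B \<subseteq> carrier (G\<lparr>carrier := F\<rparr>)" using bF by auto
    have "BX \<subseteq> generate G ?B"
    proof
      fix s assume "s \<in> BX"
      then obtain l where l: "l < k" "s = x l" by auto
      then obtain j where j: "j < k" "l = \<pi> j" using pim by (metis imageE lessThan_iff)
      have "s = (if \<epsilon> j then ?b j else inv (?b j))" using xb[OF j(1)] l j by simp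
      moreover have "?b j \<in> ?B" using j by auto
      ultimately show "s \<in> generate G ?B" using generate.incl generate.inv by metis
    qed
    then have "F \<subseteq> generate G ?B"
      unfolding F_eq by (rule generate_subgroup_incl[OF _ generate_is_subgroup]) (use bc in auto)
    moreover have "generate G ?B \<subseteq> F"
      by (rule generate_subgroup_incl[OF _ subgroup_F]) (use bF in auto)
    moreover have "generate (G\<lparr>carrier := F\<rparr>) ?B = generate G ?B"
      by (rule generate_consistent[OF _ subgroup_F]) (use bF in auto)
    ultimately show "generate (G\<lparr>carrier := F\<rparr>) ?B = carrier (G\<lparr>carrier := F\<rparr>)" by simp
  next
    fix w assume w: "w \<in> words ?B" "w \<noteq> [] \<and> freely_reduced w"
    define j where "j = inv_into {..<k} ?b"
    have j: "j b < k" "?b (j b) = b" if "b \<in> ?B" for b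
      using inv_into_into[OF that] f_inv_into_f[OF that] by (auto simp: j_def)
    \<comment> \<open>A word in the signed basis is respelled in the old one: a letter keeps its
      sign where \<open>\<epsilon>\<close> is true and flips it otherwise, which preserves values
      and reducedness.\<close>
    define f where "f = (\<lambda>(b, e). (x (\<pi> (j b)), e = \<epsilon> (j b)))"
    have wB: "b \<in> ?B" if "(b, e) \<in> set w" for b e using w(1) that by (auto simp: words_def)
    have f_words: "map f u \<in> words BX" if "set u \<subseteq> set w" for u
    proof -
      have "f c \<in> BX \<times> UNIV" if c: "c \<in> set u" for c
      proof -
        obtain b e where be: "c = (b, e)" by (cases c)
        have "b \<in> ?B" using \<open>set u \<subseteq> set w\<close> c be wB by blast
        then show ?thesis using pk[OF j(1)] by (simp add: be f_def)
      qed
      then show ?thesis by (simp add: words_def in_lists_conv_set)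
    qed
    have f_val: "word_val G (\<lambda>b. b) (map f u) = word_val G (\<lambda>b. b) u" if "set u \<subseteq> set w" for u
      using that
    proof (induction u)
      case (Cons c u)
      obtain b e where c: "c = (b, e)" by (cases c)
      have b: "b \<in> ?B" using Cons.prems wB c by auto
      have "x (\<pi> (j b)) = (if \<epsilon> (j b) then b else inv b)" "b \<in> carrier G"
        using xb[OF j(1)[OF b]] bc[OF j(1)[OF b]] unfolding j(2)[OF b] by blast+
      then show ?case using Cons by (auto simp: c f_def)
    qed simp
    have "freely_reduced (map f w)"
    proof -
      have "successively (\<lambda>c d. (case f c of (a, e) \<Rightarrow> (case f d of (b, e') \<Rightarrow> a = b \<longrightarrow> e = e'))) w"
      proof (rule successively_mono)
        show "successively (\<lambda>(a, e) (b, e'). a = b \<longrightarrow> e = e') w" using w(2) by (simp add: freely_reduced_def)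
        fix c d assume cd: "c \<in> set w" "d \<in> set w" and r: "(\<lambda>(a, e) (b, e'). a = b \<longrightarrow> e = e') c d"
        obtain b e b' e' where c: "c = (b, e)" "d = (b', e')" by (cases c; cases d)
        have B: "b \<in> ?B" "b' \<in> ?B" using cd c wB by auto
        have "b = b'" if "x (\<pi> (j b)) = x (\<pi> (j b'))"
        proof -
          have "\<pi> (j b) = \<pi> (j b')" using inj_onD[OF inj_x that] pk j(1) B by simp
          then have "j b = j b'" using inj_onD[OF pinj] j(1) B by simp
          then show ?thesis using j(2) B by metis
        qed
        then show "case f c of (a, e) \<Rightarrow> (case f d of (b, e') \<Rightarrow> a = b \<longrightarrow> e = e')"
          using r by (auto simp: c f_def)
      qed
      then show ?thesis by (simp add: freely_reduced_def successively_map case_prod_unfold)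
    qed
    then have "word_val G (\<lambda>b. b) (map f w) \<noteq> \<one>"
      using reduced_word_nontrivial[OF f_words[of w]] w(2) by simp
    then have "word_val G (\<lambda>b. b) w \<noteq> \<one>" using f_val[of w] by simp
    moreover have "w \<in> words F" using wB bF j by (force simp: words_def)
    ultimately show "word_val (G\<lparr>carrier := F\<rparr>) (\<lambda>b. b) w \<noteq> \<one>\<^bsub>G\<lparr>carrier := F\<rparr>\<^esub>"
      using word_val_carrier_update[OF group_axioms subgroup_F] by simp
  qed
  moreover have "\<Phi> ` ?B = {gs ! (n + j) |j. j < k}" using p(2) by force
  ultimately show "\<exists>B. free_basis (G\<lparr>carrier := F\<rparr>) B \<and> \<Phi> ` B = {gs ! (n + j) |j. j < k}" by blast
  let ?S = "(\<Union>i<n. conj_subgroup G (gs ! i) (A i)) \<union> {gs ! (n + j) |j. j < k}"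
  have "?S \<subseteq> carrier G"
  proof -
    have "conj_subgroup G (gs ! i) (A i) \<subseteq> carrier G" if "i < n" for i
      using im[OF that, symmetric] A_sub[OF that] by auto
    then show ?thesis using g by auto
  qed
  then have sub: "subgroup (generate G ?S) G" "generate G ?S \<subseteq> carrier G"
    using generate_is_subgroup generate_incl by blast+
  have "\<Phi> h \<in> generate G ?S" if "h \<in> carrier G" for h
    using that
  proof (induction rule: factors_induct)
    case one
    show ?case using generate.one by simp
  next
    case (factor i a h)
    have "\<Phi> a \<in> ?S" using im[OF factor(1)] factor(1,2) by blast
    then have "\<Phi> a \<in> generate G ?S" by (rule generate.incl)
    then show ?case using generate.eng factor by simp
  next
    case (basis l h y)
    have "l \<in> \<pi> ` {..<k}" unfolding pim using basis(1) by simp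
    then obtain j where j: "j < k" "l = \<pi> j" by auto
    have "gs ! (n + j) \<in> generate G ?S" using j(1) by (intro generate.incl) auto
    then have "\<Phi> (?b j) \<in> generate G ?S" using p(2)[OF j(1)] by simp
    moreover have "y = ?b j \<or> y = inv (?b j)" using basis(1,2) j by (auto simp: sx_def)
    ultimately have "\<Phi> y \<in> generate G ?S" using subgroup.m_inv_closed[OF sub(1)] bc[OF j(1)] by auto
    moreover have "y \<in> carrier G" using basis(1,2) by auto
    ultimately show ?case using generate.eng basis(3,4) by simp
  qed
  then have "\<Phi> ` carrier G \<subseteq> generate G ?S" by (rule image_subsetI)
  moreover have "\<Phi> ` carrier G = carrier G" using Pa by (auto simp: auto_def Bij_def bij_betw_def)
  ultimately have "carrier G \<subseteq> generate G ?S" by (simp only:)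
  then show "gens_tuple gs" using sub(2) unfolding tuple_generates_def by blast
qed

lemma certified_ex:
  assumes gs: "length gs = n + k" "set gs \<subseteq> carrier G"
  shows "\<exists>y. certified gs y"
proof -
  have g: "gs ! i \<in> carrier G" if "i < n + k" for i using gs that nth_mem[of i gs] by auto
  \<comment> \<open>\<open>Pos\<close> and \<open>Neg\<close> conjugate with \<open>t i\<close> on
    the left, the tuple with \<open>gs ! i\<close> on the right.\<close>
  define t where "t i = inv (gs ! i)" for i
  define y where "y j = gs ! (n + j)" for j
  have "tup t y" using g by (simp add: tup_def t_def y_def)
  then have "decided t y" by (rule dichotomy)
  then consider "Pos t y" | "Neg t y" by (auto simp: decided_def)
  then show ?thesis
  proof cases
    case 1
    then obtain \<Phi> \<pi> \<epsilon> where P: "\<Phi> \<in> AutZ"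
      "\<And>i. i < n \<Longrightarrow> \<exists>c\<in>A i. \<forall>a\<in>A i. \<Phi> a = t i \<otimes> c \<otimes> a \<otimes> inv (t i \<otimes> c)"
      "inj_on \<pi> {..<k}" "\<pi> ` {..<k} \<subseteq> {..<k}"
      "\<And>j. j < k \<Longrightarrow> y j = (if \<epsilon> j then \<Phi> (x (\<pi> j)) else inv (\<Phi> (x (\<pi> j))))"
      unfolding Pos_def by blast
    obtain w where w: "w \<in> words FL" "fword w = \<Phi>" using AutZ_fword[OF P(1)] by blast
    have Pa: "\<Phi> \<in> auto G" using P(1) AutZ_auto by blast
    interpret p: group_hom G G \<Phi>
      using auto_hom[OF Pa] by (simp add: group_hom_def group_hom_axioms_def is_group)
    have "\<forall>i. \<exists>v. i < n \<longrightarrow> v \<in> words {..<length (gens i)} \<and>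
        (\<forall>a\<in>A i. fval i v \<otimes> gs ! i \<otimes> \<Phi> a = a \<otimes> (fval i v \<otimes> gs ! i))"
    proof
      fix i
      show "\<exists>v. i < n \<longrightarrow> v \<in> words {..<length (gens i)} \<and>
        (\<forall>a\<in>A i. fval i v \<otimes> gs ! i \<otimes> \<Phi> a = a \<otimes> (fval i v \<otimes> gs ! i))"
      proof (cases "i < n")
        case True
        obtain c where c: "c \<in> A i" "\<forall>a\<in>A i. \<Phi> a = t i \<otimes> c \<otimes> a \<otimes> inv (t i \<otimes> c)" using P(2)[OF True] by blast
        have "inv c \<in> A i" using c(1) True by simp
        then obtain v where v: "v \<in> words {..<length (gens i)}" "fval i v = inv c" using fval_ex[of i "inv c"] True by auto
        have "inv c \<otimes> gs ! i \<otimes> \<Phi> a = a \<otimes> (inv c \<otimes> gs ! i)" if "a \<in> A i" for a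
        proof -
          have "a \<in> carrier G" "c \<in> carrier G" "gs ! i \<in> carrier G" using that c(1) True g by auto
          then show ?thesis using c(2) that by (simp add: t_def m_assoc inv_mult_group)
        qed
        then show ?thesis using v by auto
      qed simp
    qed
    from choice[OF this] obtain v where v: "\<And>i. i < n \<Longrightarrow> v i \<in> words {..<length (gens i)} \<and>
        (\<forall>a\<in>A i. fval i (v i) \<otimes> gs ! i \<otimes> \<Phi> a = a \<otimes> (fval i (v i) \<otimes> gs ! i))" by blast
    \<comment> \<open>The words represent inverses of the slack elements \<open>c\<close> of
      \<open>Pos\<close>, as \<open>t i \<otimes> c\<close> is inverse to
      \<open>inv c \<otimes> gs ! i\<close>.\<close>
    define r where "r = list_encode (map (\<lambda>i. list_encode (map gl (lift_word i (v i)))) [0..<n])"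
    have inw: "inw r i = map gl (lift_word i (v i))" if "i < n" for i
      using that by (simp add: inw_def r_def nth0_def)
    have "pos_cert gs \<Phi> r" unfolding pos_cert_def
    proof (intro conjI allI impI)
      fix i assume i: "i < n"
      have "lift_word i (v i) \<in> words ({i} \<times> {..<length (gens i)})"
        using v[OF i] by (auto simp: lift_word_def words_def in_lists_conv_set)
      then show "\<exists>u\<in>words ({i} \<times> {..<length (gens i)}). inw r i = map gl u \<and>
        (\<forall>m<length (gens i). gval u \<otimes> gs ! i \<otimes> \<Phi> (gens i ! m) = gens i ! m \<otimes> (gval u \<otimes> gs ! i))"
        using inw[OF i] v[OF i] lift_word(2)[of i "v i"] gens_mem[of i] i
        by (intro bexI[of _ "lift_word i (v i)"]) auto
    next
      let ?p = "(restrict \<pi> {..<k}, restrict \<epsilon> {..<k})"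
      have "?p \<in> signs" using P(3,4) by (auto simp: signs_def inj_on_def)
      moreover have "\<Phi> (sx (fst ?p j) (snd ?p j)) = gs ! (n + j)" if "j < k" for j
      proof -
        have "\<pi> j < k" using P(4) that by auto
        then show ?thesis using P(5)[OF that] that by (simp add: sx_def y_def)
      qed
      ultimately show "\<exists>p\<in>signs. \<forall>j<k. \<Phi> (sx (fst p j) (snd p j)) = gs ! (n + j)" by blast
    qed
    then have "certified gs (prod_encode (Suc (word_code fr_code w), r))" using w by (auto simp: certified_def)
    then show ?thesis by blast
  next
    case 2
    then obtain L where L: "\<And>i a. i < n \<Longrightarrow> a \<in> A i \<Longrightarrow> act L (t i \<otimes> a \<otimes> inv (t i)) 0 = 0"
      "\<And>j. j < k \<Longrightarrow> act L (y j) 0 = 0" "\<exists>h\<in>carrier G. act L h 0 \<noteq> 0" unfolding Neg_def by blast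
    define r where "r = list_encode (map (\<lambda>i. list_encode (map prod_encode (L i))) [0..<n + k])"
    have "cert (list_decode r) i = L i" if "i < n + k" for i
      using that by (simp add: cert_def r_def nth0_def comp_def)
    then have eq: "act (cert (list_decode r)) h = act L h" if "h \<in> carrier G" for h using act_cong that by blast
    have "neg_cert gs r" unfolding neg_cert_def
    proof (intro conjI allI impI)
      fix i m assume i: "i < n" "m < length (gens i)"
      have c: "gens i ! m \<in> carrier G" "gs ! i \<in> carrier G" using gens_carrier[of i m] g i by auto
      have "act L (inv (gs ! i) \<otimes> gens i ! m \<otimes> gs ! i) 0 = 0"
        using L(1)[OF i(1) gens_mem[of i m]] i c by (simp add: t_def)
      then have "act L (inv (gs ! i)) (act L (gens i ! m \<otimes> gs ! i) 0) = 0" using c by simp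
      then have "act L (gens i ! m \<otimes> gs ! i) 0 = act L (gs ! i) 0"
        using act_inv(1)[OF c(2), of L "act L (gens i ! m \<otimes> gs ! i) 0"] by simp
      then show "act (cert (list_decode r)) (gens i ! m \<otimes> gs ! i) 0 = act (cert (list_decode r)) (gs ! i) 0"
        using eq c by simp
    next
      fix j assume "j < k"
      then show "act (cert (list_decode r)) (gs ! (n + j)) 0 = 0" using L(2) eq g by (simp add: y_def)
    next
      show "\<exists>c\<in>GL. act (cert (list_decode r)) (gen_val gens c) 0 \<noteq> 0"
      \<comment> \<open>If every generator fixed 0, so would every word and hence all of G.\<close>
      proof (rule ccontr)
        assume no: "\<not> (\<exists>c\<in>GL. act (cert (list_decode r)) (gen_val gens c) 0 \<noteq> 0)"
        have f: "act L (gen_val gens c) 0 = 0" "gen_val gens c \<in> carrier G" if "c \<in> GL" for c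
        proof -
          show "gen_val gens c \<in> carrier G" using gen_val_closed that by blast
          then show "act L (gen_val gens c) 0 = 0" using no that eq by metis
        qed
        have "act L (gval u) 0 = 0" if "u \<in> words GL" for u
          using that
        proof (induction u)
          case (Cons c u)
          obtain a e where c: "c = (a, e)" by (cases c)
          have "a \<in> GL" "u \<in> words GL" using Cons.prems by (auto simp: c)
          then show ?case using Cons.IH f[of a] act_fix_inv[OF f(2,1), of a] gval_closed[of u] by (simp add: c)
        qed simp
        then show False using L(3) gval_ex by metis
      qed
    qed
    then have "certified gs (prod_encode (0, r))" by (simp add: certified_def)
    then show ?thesis by blast
  qed
qed

section \<open>The normal form and the method\<close>

definition fr_nf :: "('a \<Rightarrow> 'a) \<Rightarrow> fr_letter word" where
  "fr_nf \<Phi> = (ARG_MIN (word_code fr_code) w. w \<in> words FL \<and> fword w = \<Phi>)"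

lemma fr_nf:
  assumes "w \<in> words FL" "\<And>w'. w' \<in> words FL \<Longrightarrow> fword w' = fword w \<Longrightarrow> word_code fr_code w \<le> word_code fr_code w'"
  shows "fr_nf (fword w) = w"
proof -
  let ?P = "\<lambda>v. v \<in> words FL \<and> fword v = fword w"
  have m: "?P (fr_nf (fword w)) \<and> word_code fr_code (fr_nf (fword w)) \<le> word_code fr_code w"
    unfolding fr_nf_def using arg_min_nat_lemma[of ?P w "word_code fr_code"] assms(1) by blast
  then have "word_code fr_code (fr_nf (fword w)) = word_code fr_code w"
    using assms(2)[of "fr_nf (fword w)"] by simp
  then show ?thesis by (rule word_code_inj[OF inj_on_fr_code])
qed

lemma fr_nf_normal_form: "normal_form Aut frv FL AutZ fr_nf"
  unfolding normal_form_def
proof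
  fix \<Phi> assume "\<Phi> \<in> AutZ"
  then obtain w where w: "w \<in> words FL \<and> fword w = \<Phi>" using AutZ_fword by blast
  show "fr_nf \<Phi> \<in> words FL \<and> fword (fr_nf \<Phi>) = \<Phi>"
    unfolding fr_nf_def by (rule arg_min_natI[of "\<lambda>w. w \<in> words FL \<and> fword w = \<Phi>", OF w])
qed

definition first_cert :: "'a list \<Rightarrow> nat" where
  "first_cert gs = (LEAST y. certified gs y)"

definition decide :: "'a list \<Rightarrow> fr_letter word option" where
  "decide gs = (if pfst (first_cert gs) = 0 then None
     else Some (SOME w. w \<in> words FL \<and> word_code fr_code w = pfst (first_cert gs) - 1))"

lemma decide_props:
  assumes gs: "length gs = n + k" "set gs \<subseteq> carrier G"
  shows "answer_code (decide gs) = pfst (first_cert gs)"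
    "if gens_tuple gs then \<exists>\<Phi>\<in>AutZ. \<exists>r. decide gs = Some (fr_nf \<Phi>) \<and> pos_cert gs \<Phi> r else decide gs = None"
proof -
  let ?y = "first_cert gs"
  have y: "certified gs ?y" unfolding first_cert_def using certified_ex[OF gs] by (rule LeastI_ex)
  have le: "?y \<le> y'" if "certified gs y'" for y' unfolding first_cert_def using that by (rule Least_le)
  have "answer_code (decide gs) = pfst ?y \<and>
    (if gens_tuple gs then \<exists>\<Phi>\<in>AutZ. \<exists>r. decide gs = Some (fr_nf \<Phi>) \<and> pos_cert gs \<Phi> r else decide gs = None)"
  proof (cases "pfst ?y = 0")
    case True
    then have "\<not> gens_tuple gs" using y neg_cert_sound[OF gs] by (simp add: certified_def)
    then show ?thesis using True by (simp add: decide_def answer_code_def)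
  next
    case False
    then obtain w where w: "w \<in> words FL" "pfst ?y - 1 = word_code fr_code w" "pos_cert gs (fword w) (psnd ?y)"
      using y by (auto simp: certified_def)
    have Phi: "fword w \<in> AutZ" by (rule fword_AutZ[OF w(1)])
    have "(SOME v. v \<in> words FL \<and> word_code fr_code v = pfst ?y - 1) = w"
    proof (rule some_equality)
      show "w \<in> words FL \<and> word_code fr_code w = pfst ?y - 1" using w by simp
    next
      fix v assume "v \<in> words FL \<and> word_code fr_code v = pfst ?y - 1"
      then have "word_code fr_code v = word_code fr_code w" using w(2) by simp
      then show "v = w" by (rule word_code_inj[OF inj_on_fr_code])
    qed
    then have d: "decide gs = Some w" using False by (simp add: decide_def)
    have "fr_nf (fword w) = w"
    proof (rule fr_nf[OF w(1)])
      fix v assume v: "v \<in> words FL" "fword v = fword w"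
      \<comment> \<open>Another word for the same automorphism may replace \<open>w\<close> while
        the second component is kept, so minimality of the pair bounds the word code.\<close>
      have "certified gs (prod_encode (Suc (word_code fr_code v), psnd ?y))"
        using v w(3) by (auto simp: certified_def)
      then have "prod_encode (pfst ?y, psnd ?y) \<le> prod_encode (Suc (word_code fr_code v), psnd ?y)"
        using le by simp
      then have "\<not> Suc (word_code fr_code v) < pfst ?y" using prod_encode_less by (meson not_less)
      then show "word_code fr_code w \<le> word_code fr_code v" using w(2) by linarith
    qed
    moreover have "gens_tuple gs" by (rule pos_cert_sound(3)[OF gs Phi w(3)])
    moreover have "answer_code (Some w) = pfst ?y"
      using w(2) False by (simp add: answer_code_def)
    ultimately show ?thesis unfolding d using Phi w(3) by (metis (lifting))
  qed
  then show "answer_code (decide gs) = pfst ?y"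
    "if gens_tuple gs then \<exists>\<Phi>\<in>AutZ. \<exists>r. decide gs = Some (fr_nf \<Phi>) \<and> pos_cert gs \<Phi> r else decide gs = None"
    by auto
qed

text \<open>\<open>check\<close> tests codes of words and \<open>certified\<close> the elements they
  represent; their agreement makes the outcome of the search independent of the words chosen for the
  tuple.\<close>

lemma decide_effective: "effective G (n + k) gens orc decide"
proof -
  obtain f where f: "recursive_in orc f"
    "\<And>a. \<exists>y. check a y \<Longrightarrow> f a = Some (pfst (LEAST y. check a y))"
    using recursive_in_LEAST[OF tdec_check trec_fst[OF trec_id]] by blast
  show ?thesis unfolding effective_def
  proof (intro exI[of _ f] conjI allI impI f(1))
    fix ws :: "(nat \<times> nat) word list" assume "length ws = n + k \<and> set ws \<subseteq> words GL"
    then have ws: "length ws = n + k" "set ws \<subseteq> words GL" by auto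
    have gs: "length (map gval ws) = n + k" "set (map gval ws) \<subseteq> carrier G" using ws by auto
    have "f (input_code ws) = Some (pfst (first_cert (map gval ws)))"
      using f(2)[of "input_code ws"] certified_ex[OF gs] unfolding check_iff[OF ws] first_cert_def by simp
    then show "f (input_code ws) = Some (answer_code (decide (map gval ws)))"
      using decide_props(1)[OF gs] by simp
  qed
qed

end

theorem corollary2p5p2:
  fixes G :: "('g, 'm) monoid_scheme"
    and n k :: nat
    and A :: "nat \<Rightarrow> 'g set"
    and F :: "'g set"
    and x :: "nat \<Rightarrow> 'g"
    and gens :: "nat \<Rightarrow> 'g list"
    and nfA :: "nat \<Rightarrow> 'g \<Rightarrow> nat word"
    and orc :: "nat \<Rightarrow> nat"
  assumes "group G"
    and "free_product G {..n} (\<lambda>i. if i < n then A i else F)"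
    and "\<And>i. i < n \<Longrightarrow> freely_indecomposable (G\<lparr>carrier := A i\<rparr>)"
    and "\<And>i. i < n \<Longrightarrow> \<not> infinite_cyclic (G\<lparr>carrier := A i\<rparr>)"
    and "free_basis (G\<lparr>carrier := F\<rparr>) (x ` {..<k})"
    and "inj_on x {..<k}"
    and "\<And>j. j < k \<Longrightarrow> A (n + j) = generate G {x j}"
    and "\<And>i. i < n + k \<Longrightarrow> set (gens i) \<subseteq> A i \<and> generate G (set (gens i)) = A i"
    and "\<And>i. i < n \<Longrightarrow> normal_form G (\<lambda>m. gens i ! m) {..<length (gens i)} (A i) (nfA i)"
    and "normalizing_oracle G n gens nfA orc"
  shows "\<exists>nf M.
      normal_form (AutoGroup G) (fr_val G n k A x gens) (fr_letters n k gens) (Aut0 G n k A x) nf \<and>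
      effective G (n + k) gens orc M \<and>
      (\<forall>gs. length gs = n + k \<and> set gs \<subseteq> carrier G \<longrightarrow>
         (if tuple_generates G n k A gs
          then \<exists>\<Phi>\<in>Aut0 G n k A x.
                 M gs = Some (nf \<Phi>) \<and>
                 (\<forall>i<n. \<Phi> ` A i = conj_subgroup G (gs ! i) (A i)) \<and>
                 (\<exists>B. free_basis (G\<lparr>carrier := F\<rparr>) B \<and> \<Phi> ` B = {gs ! (n + j) |j. j < k})
          else M gs = None))"
proof -
  have nontriv: "A i \<noteq> {\<one>\<^bsub>G\<^esub>}" if "i < n" for i
    using assms(3)[OF that] by (simp add: freely_indecomposable_def)
  interpret eff_data G n k A F x gens nfA orc
    by (intro eff_data.intro fr_data.intro free_product_data.intro free_product_data_axioms.intro
        fr_data_axioms.intro eff_data_axioms.intro)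
       (use assms nontriv in auto)
  have "if tuple_generates G n k A gs
          then \<exists>\<Phi>\<in>Aut0 G n k A x. decide gs = Some (fr_nf \<Phi>) \<and>
                 (\<forall>i<n. \<Phi> ` A i = conj_subgroup G (gs ! i) (A i)) \<and>
                 (\<exists>B. free_basis (G\<lparr>carrier := F\<rparr>) B \<and> \<Phi> ` B = {gs ! (n + j) |j. j < k})
          else decide gs = None" if gs: "length gs = n + k" "set gs \<subseteq> carrier G" for gs
  proof (cases "tuple_generates G n k A gs")
    case True
    then obtain \<Phi> r where P: "\<Phi> \<in> AutZ" "decide gs = Some (fr_nf \<Phi>)" "pos_cert gs \<Phi> r"
      using decide_props(2)[OF gs] by auto
    then show ?thesis using True pos_cert_sound[OF gs P(1,3)] by auto
  next
    case False
    then show ?thesis using decide_props(2)[OF gs] by simp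
  qed
  then show ?thesis using fr_nf_normal_form decide_effective
    by (intro exI[of _ fr_nf] exI[of _ decide]) blast
qed

end
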